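(* Let $d,n\in\mathbb N$, $\mathcal X=[-1,1]^d\cap\mathbb F^d$, $\delta>0$, $\mathcal D\subseteq\mathcal X$, let $f:\mathcal X\to\mathbb F^n$ be a classifier that is $\delta$-robust on $\mathcal D$, and let $\sigma:\overline{\mathbb F}\to\overline{\mathbb F}$ satisfy Condition 1. Then there exists a $\sigma$-network $\nu:\overline{\mathbb F}^d\to\overline{\mathbb F}^n$ that is $\delta$-provably robust on $\mathcal D$ and satisfies $\mathrm{class}(\nu(\mathbf x))=\mathrm{class}(f(\mathbf x))$ for all $\mathbf x\in\mathcal D$.
   Context: Floating point. Fix integers $E\ge 5$ and $M$ with $2^{E-1}\ge M\ge 3$; let $\mathfrak e_{\min}=-2^{E-1}+2$, $\mathfrak e_{\max}=2^{E-1}-1$. $\mathbb F=\{(-1)^b(s_0.s_1\dots s_M)_2\cdot 2^e: b,s_i\in\{0,1\},e\in\{\mathfrak e_{\min},\dots,\mathfrak e_{\max}\}\}$, $\overline{\mathbb F}=\mathbb F\cup\{-\infty,+\infty,\mathrm{NaN}\}$, $\Omega=2^{\mathfrak e_{\max}}(2-2^{-M})$, $\varepsilon=2^{-M-1}$; $x^+$ (resp. $x^-$) is the next larger (smaller) element of $\overline{\mathbb F}\setminus\{\mathrm{NaN}\}$. $\mathrm{rnd}:\mathbb R\to\overline{\mathbb F}$ is round-to-nearest-ties-to-even with overflow to $\pm\infty$ when $|x|\ge\Omega+2^{\mathfrak e_{\max}}\varepsilon$; $x\oplus y=\mathrm{rnd}(x+y)$, $x\otimes y=\mathrm{rnd}(xy)$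 for finite $x,y$ (IEEE-754 otherwise); sums $\bigoplus$ are evaluated left to right. Networks: $\mathrm{aff}_{W,\mathbf b}(\mathbf x)_i=(\bigoplus_{j}x_j\otimes w_{ij})\oplus b_i$ for $W\in\mathbb F^{m\times k}$, $\mathbf b\in\mathbb F^m$; a $\sigma$-network $\overline{\mathbb F}^{d_0}\to\overline{\mathbb F}^{d_L}$ is $\mathrm{aff}_{W_L,\mathbf b_L}\circ\tilde\sigma\circ\cdots\circ\tilde\sigma\circ\mathrm{aff}_{W_1,\mathbf b_1}$ with $\tilde\sigma$ coordinatewise $\sigma$. Intervals: $\mathbb I=\{\langle a,b\rangle:a,b\in\overline{\mathbb F}\setminus\{\mathrm{NaN}\},a\le b\}\cup\{\top\}$, $\gamma(\langle a,b\rangle)=[a,b]\cap\overline{\mathbb F}$, $\gamma(\top)=\overline{\mathbb F}$, $\gamma$ of a box is the product. For $\phi:\overline{\mathbb F}^k\to\overline{\mathbb F}$, $\phi^\sharp(\mathcal B)=\langle\min S,\max S\rangle$ ($S=\phi(\gamma(\mathcal B))$) if $\mathrm{NaN}\notin S$, else $\top$. $\langle a,b\rangle\odot^\sharp\langle c,d\rangle$ for $\odot\in\{\oplus,\otimes\}$ is $\langle\min S,\max S\rangle$ with $S=\{a\odot c,a\odot d,b\odot c,b\odot d\}$, or $\top$ if $\mathrm{NaN}\in S$ or an operand is $\top$. $\mathrm{aff}^\sharp_{W,\mathbf b}$ evaluates the formula of $\mathrm{aff}_{W,\mathbf b}$ with $\oplus^\sharp,\otimes^\sharp$ and singleton intervals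 for constants, and $\nu^\sharp$ is the composition of the $\mathrm{aff}^\sharp$ maps and coordinatewise $\sigma^\sharp$. Condition 1 on $\sigma$: (C1) there exist $c_1,c_2\in\mathbb F$ with $\sigma(c_1)=0$, $|\sigma(c_2)|\in[\frac\varepsilon2+2\varepsilon^2,\frac54-2\varepsilon]$, $\max\{|c_1|,|c_2|\}\ge2^{\mathfrak e_{\min}+1}$, and $\sigma(x)$ between $\sigma(c_1)$ and $\sigma(c_2)$ for all $x$ between $c_1,c_2$; (C2) there is $\eta\in\mathbb F$ with $|\eta|\in[2^{\mathfrak e_{\min}+5},4-8\varepsilon]$, $|\sigma(\eta)|,|\sigma(\eta^+)|\in[2^{\mathfrak e_{\min}+5},2^{\mathfrak e_{\max}-6}|\eta|]$, such that for all $x,y\in\mathbb F$ with $x\le\eta<\eta^+\le y$, either $\sigma(x)\le\sigma(\eta)<\sigma(\eta^+)\le\sigma(y)$ or $\sigma(x)\ge\sigma(\eta)>\sigma(\eta^+)\ge\sigma(y)$; (C3) there is $\lambda\in[0,2^{\mathfrak e_{\max}-7}\min\{|\sigma(\eta)|,2^{M+3}\}]$ with $|\sigma(x)-\sigma(\eta)|\le\lambda|x-\eta|$ and $|\sigma(y)-\sigma(\eta^+)|\le\lambda|y-\eta^+|$ for all $x,y\in\mathbb F$ with $x\le\eta<\eta^+\le y$. Classification: $\mathrm{class}(y_1,\dots,y_n)=\arg\max_{i\in[n]}y_i$ with an arbitrary fixed tie-breaking rule. $\mathcal N_\delta(\mathbf x_0)=\{\mathbf x\in\mathcal X:\|\mathbf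 x_0-\mathbf x\|_\infty\le\delta\}$. A classifier $f:\mathcal X\to\mathbb F^n$ is $\delta$-robust on $\mathcal D$ if for all $\mathbf x_0\in\mathcal D$ and $\mathbf y,\mathbf y'\in f(\mathcal N_\delta(\mathbf x_0))$, $\mathrm{class}(\mathbf y)=\mathrm{class}(\mathbf y')$. A network $\nu:\overline{\mathbb F}^d\to\overline{\mathbb F}^n$ is $\delta$-provably robust on $\mathcal D$ if for all $\mathbf x_0\in\mathcal D$ and $\mathbf y,\mathbf y'\in\gamma(\nu^\sharp(\mathcal B))$, $\mathrm{class}(\mathbf y)=\mathrm{class}(\mathbf y')$, where $\mathcal B\in\mathbb I^d$ is the abstract box with $\gamma(\mathcal B)=\mathcal N_\delta(\mathbf x_0)$. *)

theory Defs
  imports Complex_Main "HOL-Library.Extended_Real"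
begin

definition emin :: "nat \<Rightarrow> int" where
  "emin E = - (2 ^ (E - 1)) + 2"

definition emax :: "nat \<Rightarrow> int" where
  "emax E = 2 ^ (E - 1) - 1"

definition eps :: "nat \<Rightarrow> real" where
  "eps M = 2 powr (- real M - 1)"

definition Omega :: "nat \<Rightarrow> nat \<Rightarrow> real" where
  "Omega E M = 2 powr (of_int (emax E)) * (2 - 2 powr (- real M))"

text \<open>The value of (-1)^b (s_0.s_1...s_M)_2 * 2^e, with the significand bits encoded
  as the natural number m = (s_0 s_1 ... s_M)_2 < 2^(M+1).\<close>
definition fl_val :: "nat \<Rightarrow> bool \<Rightarrow> nat \<Rightarrow> int \<Rightarrow> real" where
  "fl_val M b m e = (if b then -1 else 1) * (real m / 2 ^ M) * 2 powr (of_int e)"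

definition Fset :: "nat \<Rightarrow> nat \<Rightarrow> real set" where
  "Fset E M = {fl_val M b m e | b m e. m < 2 ^ (M + 1) \<and> emin E \<le> e \<and> e \<le> emax E}"

definition fl_even :: "nat \<Rightarrow> nat \<Rightarrow> real \<Rightarrow> bool" where
  "fl_even E M y = (\<exists>b m e. m < 2 ^ (M + 1) \<and> emin E \<le> e \<and> e \<le> emax E \<and> even m
                         \<and> y = fl_val M b m e)"

datatype xfloat = Num real | PosInf | NegInf | NaN

definition Fbar :: "nat \<Rightarrow> nat \<Rightarrow> xfloat set" where
  "Fbar E M = Num ` Fset E M \<union> {PosInf, NegInf, NaN}"

fun xval :: "xfloat \<Rightarrow> ereal" where
  "xval (Num r) = ereal r"
| "xval PosInf = \<infinity>"
| "xval NegInf = - \<infinity>"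
| "xval NaN = 0" \<comment> \<open>irrelevant; NaN is never compared, see xle/xlt\<close>

definition xle :: "xfloat \<Rightarrow> xfloat \<Rightarrow> bool" where
  "xle a b = (a \<noteq> NaN \<and> b \<noteq> NaN \<and> xval a \<le> xval b)"

definition xlt :: "xfloat \<Rightarrow> xfloat \<Rightarrow> bool" where
  "xlt a b = (a \<noteq> NaN \<and> b \<noteq> NaN \<and> xval a < xval b)"

definition xsucc :: "nat \<Rightarrow> nat \<Rightarrow> xfloat \<Rightarrow> xfloat" where
  "xsucc E M x = (THE y. y \<in> Fbar E M - {NaN} \<and> xlt x y \<and>
                     (\<forall>z \<in> Fbar E M - {NaN}. xlt x z \<longrightarrow> xle y z))"

definition is_rnd_nearest_even :: "nat \<Rightarrow> nat \<Rightarrow> real \<Rightarrow> real \<Rightarrow> bool" where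
  "is_rnd_nearest_even E M x y =
     (y \<in> Fset E M \<and> (\<forall>z \<in> Fset E M. \<bar>x - y\<bar> \<le> \<bar>x - z\<bar>) \<and>
      (\<forall>z \<in> Fset E M. z \<noteq> y \<and> \<bar>x - z\<bar> = \<bar>x - y\<bar> \<longrightarrow> fl_even E M y))"

definition rnd :: "nat \<Rightarrow> nat \<Rightarrow> real \<Rightarrow> xfloat" where
  "rnd E M x =
     (let thr = Omega E M + 2 powr (of_int (emax E)) * eps M in
      if x \<ge> thr then PosInf
      else if x \<le> - thr then NegInf
      else Num (THE y. is_rnd_nearest_even E M x y))"

fun xadd :: "nat \<Rightarrow> nat \<Rightarrow> xfloat \<Rightarrow> xfloat \<Rightarrow> xfloat" where
  "xadd E M (Num a) (Num b) = rnd E M (a + b)"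
| "xadd E M NaN y = NaN"
| "xadd E M x NaN = NaN"
| "xadd E M PosInf NegInf = NaN"
| "xadd E M NegInf PosInf = NaN"
| "xadd E M PosInf y = PosInf"
| "xadd E M NegInf y = NegInf"
| "xadd E M x PosInf = PosInf"
| "xadd E M x NegInf = NegInf"

fun xsgn :: "xfloat \<Rightarrow> int" where
  "xsgn (Num r) = (if r > 0 then 1 else if r < 0 then -1 else 0)"
| "xsgn PosInf = 1"
| "xsgn NegInf = -1"
| "xsgn NaN = 0"

fun xmul :: "nat \<Rightarrow> nat \<Rightarrow> xfloat \<Rightarrow> xfloat \<Rightarrow> xfloat" where
  "xmul E M (Num a) (Num b) = rnd E M (a * b)"
| "xmul E M NaN y = NaN"
| "xmul E M x NaN = NaN"
| "xmul E M x y = (let s = xsgn x * xsgn y in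
                    if s > 0 then PosInf else if s < 0 then NegInf else NaN)"

fun xsum :: "nat \<Rightarrow> nat \<Rightarrow> xfloat list \<Rightarrow> xfloat" where
  "xsum E M [] = Num 0"
| "xsum E M (t # ts) = foldl (xadd E M) t ts"

text \<open>A layer is (W, b): W given as list of rows (W!i!j = w_ij), b the bias list.\<close>
type_synonym layer = "real list list \<times> real list"

definition aff :: "nat \<Rightarrow> nat \<Rightarrow> layer \<Rightarrow> xfloat list \<Rightarrow> xfloat list" where
  "aff E M l x = map2 (\<lambda>row bi. xadd E M (xsum E M (map2 (\<lambda>xj wij. xmul E M xj (Num wij)) x row)) (Num bi))
                      (fst l) (snd l)"

fun wf_net :: "nat \<Rightarrow> nat \<Rightarrow> nat \<Rightarrow> layer list \<Rightarrow> nat \<Rightarrow> bool" where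
  "wf_net E M k [] n = False"
| "wf_net E M k (l # ls) n =
     (length (fst l) = length (snd l) \<and>
      (\<forall>row \<in> set (fst l). length row = k \<and> set row \<subseteq> Fset E M) \<and>
      set (snd l) \<subseteq> Fset E M \<and>
      (if ls = [] then length (snd l) = n else wf_net E M (length (snd l)) ls n))"

fun net_eval :: "nat \<Rightarrow> nat \<Rightarrow> (xfloat \<Rightarrow> xfloat) \<Rightarrow> layer list \<Rightarrow> xfloat list \<Rightarrow> xfloat list" where
  "net_eval E M \<sigma> [] x = x"
| "net_eval E M \<sigma> [l] x = aff E M l x"
| "net_eval E M \<sigma> (l # l' # ls) x = net_eval E M \<sigma> (l' # ls) (map \<sigma> (aff E M l x))"

datatype ival = Ival xfloat xfloat | Top

definition in_I :: "nat \<Rightarrow> nat \<Rightarrow> ival \<Rightarrow> bool" where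
  "in_I E M B = (case B of Top \<Rightarrow> True
     | Ival a b \<Rightarrow> a \<in> Fbar E M - {NaN} \<and> b \<in> Fbar E M - {NaN} \<and> xle a b)"

fun gamma :: "nat \<Rightarrow> nat \<Rightarrow> ival \<Rightarrow> xfloat set" where
  "gamma E M (Ival a b) = {x \<in> Fbar E M. xle a x \<and> xle x b}"
| "gamma E M Top = Fbar E M"

definition gamma_box :: "nat \<Rightarrow> nat \<Rightarrow> ival list \<Rightarrow> xfloat list set" where
  "gamma_box E M Bs = {xs. length xs = length Bs \<and> (\<forall>i < length Bs. xs ! i \<in> gamma E M (Bs ! i))}"

definition xmin :: "xfloat set \<Rightarrow> xfloat" where
  "xmin S = (THE y. y \<in> S \<and> (\<forall>z \<in> S. xle y z))"

definition xmax :: "xfloat set \<Rightarrow> xfloat" where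
  "xmax S = (THE y. y \<in> S \<and> (\<forall>z \<in> S. xle z y))"

definition ihull :: "xfloat set \<Rightarrow> ival" where
  "ihull S = (if NaN \<in> S then Top else Ival (xmin S) (xmax S))"

definition sigma_sharp :: "nat \<Rightarrow> nat \<Rightarrow> (xfloat \<Rightarrow> xfloat) \<Rightarrow> ival \<Rightarrow> ival" where
  "sigma_sharp E M \<sigma> B = ihull (\<sigma> ` gamma E M B)"

fun iop :: "(xfloat \<Rightarrow> xfloat \<Rightarrow> xfloat) \<Rightarrow> ival \<Rightarrow> ival \<Rightarrow> ival" where
  "iop f (Ival a b) (Ival c d) = ihull {f a c, f a d, f b c, f b d}"
| "iop f Top J = Top"
| "iop f I Top = Top"

definition iadd :: "nat \<Rightarrow> nat \<Rightarrow> ival \<Rightarrow> ival \<Rightarrow> ival" where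
  "iadd E M = iop (xadd E M)"

definition imul :: "nat \<Rightarrow> nat \<Rightarrow> ival \<Rightarrow> ival \<Rightarrow> ival" where
  "imul E M = iop (xmul E M)"

fun isum :: "nat \<Rightarrow> nat \<Rightarrow> ival list \<Rightarrow> ival" where
  "isum E M [] = Ival (Num 0) (Num 0)"
| "isum E M (t # ts) = foldl (iadd E M) t ts"

definition aff_sharp :: "nat \<Rightarrow> nat \<Rightarrow> layer \<Rightarrow> ival list \<Rightarrow> ival list" where
  "aff_sharp E M l X = map2 (\<lambda>row bi. iadd E M (isum E M (map2 (\<lambda>Xj wij. imul E M Xj (Ival (Num wij) (Num wij))) X row))
                                        (Ival (Num bi) (Num bi)))
                      (fst l) (snd l)"

fun net_sharp :: "nat \<Rightarrow> nat \<Rightarrow> (xfloat \<Rightarrow> xfloat) \<Rightarrow> layer list \<Rightarrow> ival list \<Rightarrow> ival list" where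
  "net_sharp E M \<sigma> [] X = X"
| "net_sharp E M \<sigma> [l] X = aff_sharp E M l X"
| "net_sharp E M \<sigma> (l # l' # ls) X = net_sharp E M \<sigma> (l' # ls) (map (sigma_sharp E M \<sigma>) (aff_sharp E M l X))"

definition cond1 :: "nat \<Rightarrow> nat \<Rightarrow> (xfloat \<Rightarrow> xfloat) \<Rightarrow> bool" where
  "cond1 E M \<sigma> =
   ((\<exists>c1 \<in> Fset E M. \<exists>c2 \<in> Fset E M. \<exists>s2.
       \<sigma> (Num c1) = Num 0 \<and> \<sigma> (Num c2) = Num s2 \<and>
       eps M / 2 + 2 * eps M ^ 2 \<le> \<bar>s2\<bar> \<and> \<bar>s2\<bar> \<le> 5 / 4 - 2 * eps M \<and>
       max \<bar>c1\<bar> \<bar>c2\<bar> \<ge> 2 powr (of_int (emin E + 1)) \<and>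
       (\<forall>x \<in> Fset E M. min c1 c2 \<le> x \<and> x \<le> max c1 c2 \<longrightarrow>
          (\<exists>s. \<sigma> (Num x) = Num s \<and> min 0 s2 \<le> s \<and> s \<le> max 0 s2)))
    \<and>
    (\<exists>\<eta> \<in> Fset E M. \<exists>s s' \<eta>p.
       xsucc E M (Num \<eta>) = Num \<eta>p \<and>
       \<sigma> (Num \<eta>) = Num s \<and> \<sigma> (Num \<eta>p) = Num s' \<and>
       2 powr (of_int (emin E + 5)) \<le> \<bar>\<eta>\<bar> \<and> \<bar>\<eta>\<bar> \<le> 4 - 8 * eps M \<and>
       2 powr (of_int (emin E + 5)) \<le> \<bar>s\<bar> \<and> \<bar>s\<bar> \<le> 2 powr (of_int (emax E - 6)) * \<bar>\<eta>\<bar> \<and>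
       2 powr (of_int (emin E + 5)) \<le> \<bar>s'\<bar> \<and> \<bar>s'\<bar> \<le> 2 powr (of_int (emax E - 6)) * \<bar>\<eta>\<bar> \<and>
       (\<forall>x \<in> Fset E M. \<forall>y \<in> Fset E M. x \<le> \<eta> \<and> \<eta>p \<le> y \<longrightarrow>
          (xle (\<sigma> (Num x)) (Num s) \<and> s < s' \<and> xle (Num s') (\<sigma> (Num y))) \<or>
          (xle (Num s) (\<sigma> (Num x)) \<and> s > s' \<and> xle (\<sigma> (Num y)) (Num s'))) \<and>
       (\<exists>lam::real. 0 \<le> lam \<and> lam \<le> 2 powr (of_int (emax E - 7)) * min \<bar>s\<bar> (2 ^ (M + 3)) \<and>
          (\<forall>x \<in> Fset E M. \<forall>y \<in> Fset E M. x \<le> \<eta> \<and> \<eta>p \<le> y \<longrightarrow>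
             (\<exists>t. \<sigma> (Num x) = Num t \<and> \<bar>t - s\<bar> \<le> lam * \<bar>x - \<eta>\<bar>) \<and>
             (\<exists>t. \<sigma> (Num y) = Num t \<and> \<bar>t - s'\<bar> \<le> lam * \<bar>y - \<eta>p\<bar>)))))"

text \<open>class(y) = argmax_i y_i, ties broken by a fixed rule tb choosing from the set of maximisers.\<close>
definition argmax_set :: "xfloat list \<Rightarrow> nat set" where
  "argmax_set y = {i. i < length y \<and> (\<forall>j < length y. xle (y ! j) (y ! i))}"

definition cls :: "(nat set \<Rightarrow> nat) \<Rightarrow> xfloat list \<Rightarrow> nat" where
  "cls tb y = tb (argmax_set y)"

definition valid_tiebreak :: "(nat set \<Rightarrow> nat) \<Rightarrow> bool" where
  "valid_tiebreak tb = (\<forall>A. A \<noteq> {} \<longrightarrow> tb A \<in> A)"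

definition Xdom :: "nat \<Rightarrow> nat \<Rightarrow> nat \<Rightarrow> real list set" where
  "Xdom E M d = {x. length x = d \<and> (\<forall>r \<in> set x. r \<in> Fset E M \<and> \<bar>r\<bar> \<le> 1)}"

definition nbhd :: "nat \<Rightarrow> nat \<Rightarrow> nat \<Rightarrow> real \<Rightarrow> real list \<Rightarrow> real list set" where
  "nbhd E M d \<delta> x0 = {x \<in> Xdom E M d. \<forall>i < d. \<bar>x0 ! i - x ! i\<bar> \<le> \<delta>}"

definition robust :: "nat \<Rightarrow> nat \<Rightarrow> nat \<Rightarrow> (nat set \<Rightarrow> nat) \<Rightarrow> (real list \<Rightarrow> real list)
                      \<Rightarrow> real \<Rightarrow> real list set \<Rightarrow> bool" where
  "robust E M d tb f \<delta> D =
     (\<forall>x0 \<in> D. \<forall>x \<in> nbhd E M d \<delta> x0. \<forall>x' \<in> nbhd E M d \<delta> x0.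
        cls tb (map Num (f x)) = cls tb (map Num (f x')))"

definition provably_robust :: "nat \<Rightarrow> nat \<Rightarrow> nat \<Rightarrow> (nat set \<Rightarrow> nat) \<Rightarrow> (xfloat \<Rightarrow> xfloat)
                               \<Rightarrow> layer list \<Rightarrow> real \<Rightarrow> real list set \<Rightarrow> bool" where
  "provably_robust E M d tb \<sigma> Ls \<delta> D =
     (\<forall>x0 \<in> D. \<forall>B. length B = d \<and> (\<forall>Bi \<in> set B. in_I E M Bi) \<and>
        gamma_box E M B = map Num ` nbhd E M d \<delta> x0 \<longrightarrow>
        (\<forall>y \<in> gamma_box E M (net_sharp E M \<sigma> Ls B). \<forall>y' \<in> gamma_box E M (net_sharp E M \<sigma> Ls B).
            cls tb y = cls tb y'))"

end

theory Submission
  imports Defs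
begin

text \<open>
  Boxes around points of different classes are disjoint, hence separated in some coordinate by two
  adjacent floats. So it suffices to evaluate, in interval arithmetic, the disjunction over the points of a
  class of the conjunctions of such coordinate tests: on each box every subformula that matters is
  definitely true or definitely false, and the output intervals are singletons.

  False and true are represented by the pre-activations \<open>\<eta>\<close> and \<open>\<eta>\<^sup>+\<close>. A linear map sends the
  adjacent floats of a test to \<open>\<eta>\<close> and \<open>\<eta>\<^sup>+\<close>, but other inputs may land far away. After
  the activation the value, scaled by \<open>w\<close> and shifted by \<open>\<sigma>(\<eta>)\<close>, is at most 0 or at least the
  least positive float. Adding and subtracting a float with odd significand doubles the gap while the ties
  keep both sides apart, so the gap can be widened to the grid of \<open>\<eta>\<close>. By the Lipschitz bound one such layer
  halves the deviation from \<open>\<eta>\<close> and \<open>\<eta>\<^sup>+\<close>, and once the deviation is below two grid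
  steps a final rounding removes it. The same layer, fed with two exact truth values, is an OR or NOR gate.
\<close>

section \<open>Binary floating-point numbers and rounding\<close>

text \<open>Absorption is the main obstacle: a gap of one least positive float vanishes as soon as
  it is added to a larger number. Ties to even can amplify it, since a value half a grid step above
  an odd multiple of the step is rounded up to the next multiple, while nonpositive offsets stay
  nonpositive. Every constant added on the way, apart from the bias, has to be a rounded product of
  a weight with the output of a constant neuron; such a product need only come within half a step of
  its target, or fall into an interval. The numerical ranges in Condition 1 keep the exponents of
  these weights, of the scale \<open>w\<close> and of the test weights admissible.

  A test made for one pair of points may cut the box of a third one. The meaning of a wire is
  therefore three-valued and depends on the centre of the box. An unknown wire does no harm: no
  float lies between \<eta> and its successor, so its interval contains only admissible inputs, and
  a true argument of a disjunction overrules it. Interval arithmetic itself loses nothing inside a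
  neuron, because each input occurs in just one summand.\<close>

definition p2 :: "int \<Rightarrow> real" where
  "p2 k = 2 powr real_of_int k"

lemma p2_pos [simp]: "0 < p2 k" "0 \<le> p2 k" "p2 k \<noteq> 0"
  by (auto simp: p2_def)

lemma p2_add: "p2 (a + b) = p2 a * p2 b"
  by (simp add: p2_def powr_add)

lemma p2_diff: "p2 (a - b) = p2 a / p2 b"
  by (simp add: p2_def powr_diff)

lemma p2_le_iff [simp]: "p2 a \<le> p2 b \<longleftrightarrow> a \<le> b"
  by (simp add: p2_def)

lemma p2_less_iff [simp]: "p2 a < p2 b \<longleftrightarrow> a < b"
  by (simp add: p2_def)

lemma p2_eq_iff [simp]: "p2 a = p2 b \<longleftrightarrow> a = b"
  by (metis order_antisym p2_le_iff order_refl)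

lemma p2_0 [simp]: "p2 0 = 1"
  by (simp add: p2_def)

lemma p2_of_nat: "p2 (int n) = 2 ^ n"
  by (simp add: p2_def powr_realpow)

lemma p2_numeral [simp]: "p2 (numeral n) = 2 ^ numeral n"
  using p2_of_nat[of "numeral n"] by simp

lemma p2_1 [simp]: "p2 1 = 2"
  by (simp add: p2_def)

lemma p2_minus: "p2 (- a) = 1 / p2 a"
  using p2_diff[of 0 a] by simp

lemma p2_Suc: "p2 (k + 1) = 2 * p2 k"
  by (simp add: p2_add)

lemma p2_split: "a \<le> b \<Longrightarrow> p2 b = real_of_int (2 ^ nat (b - a)) * p2 a"
  using p2_add[of "int (nat (b - a))" a] p2_of_nat[of "nat (b - a)"] by simp

lemma p2_between:
  assumes "0 < x"
  obtains k where "p2 k \<le> x" "x < p2 (k + 1)"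
proof
  let ?k = "\<lfloor>log 2 x\<rfloor>"
  show "p2 ?k \<le> x"
    unfolding p2_def using assms by (metis le_log_iff of_int_floor_le one_less_numeral_iff semiring_norm(76))
  show "x < p2 (?k + 1)"
    unfolding p2_def using assms by (metis floor_correct log_less_iff one_less_numeral_iff semiring_norm(76))
qed

locale fp =
  fixes E M :: nat
  assumes E5: "5 \<le> E" and M3: "3 \<le> M" and M_le: "M \<le> 2 ^ (E - 1)"
begin

abbreviation F :: "real set" where "F \<equiv> Fset E M"
abbreviation e0 :: int where "e0 \<equiv> emin E"
abbreviation e1 :: int where "e1 \<equiv> emax E"
abbreviation lo :: int where "lo \<equiv> e0 - int M"

text \<open>The least positive float: significand 1 at the least exponent.\<close>

definition ul :: real where "ul = p2 lo"

lemma e0_e1: "e0 = 1 - e1" by (simp add: emin_def emax_def)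

lemma e1_ge: "15 \<le> e1"
proof -
  have "(2::int) ^ 4 \<le> 2 ^ (E - 1)" using E5 by (intro power_increasing) auto
  then show ?thesis by (simp add: emax_def)
qed

lemma M_le_e1: "int M \<le> e1 + 1"
proof -
  have "int M \<le> int (2 ^ (E - 1))" using M_le by linarith
  then show ?thesis by (simp add: emax_def)
qed

lemma M3': "3 \<le> int M" using M3 by simp

lemmas exponent_bounds = e0_e1 e1_ge M_le_e1 M3'

lemma ul_pos [simp]: "0 < ul" "0 \<le> ul" by (auto simp: ul_def)

lemma fl_val_p2: "fl_val M b m e = real_of_int ((if b then -1 else 1) * int m) * p2 (e - int M)"
  using p2_of_nat[of M] by (simp add: fl_val_def p2_diff) (simp add: p2_def)

text \<open>The Boolean \<open>c\<close> serves two uses: \<open>False\<close> gives membership in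
  the float set, \<open>True\<close> gives evenness. The sign bit is absorbed into an integer
  significand, which makes negation and steps of one unit uniform.\<close>

lemma fl_val_iff:
  "(\<exists>b m e. m < 2 ^ (M + 1) \<and> e0 \<le> e \<and> e \<le> e1 \<and> (c \<longrightarrow> even m) \<and> x = fl_val M b m e) \<longleftrightarrow>
    (\<exists>m e. \<bar>m\<bar> < 2 ^ (M + 1) \<and> e0 \<le> e \<and> e \<le> e1 \<and> (c \<longrightarrow> even m) \<and> x = real_of_int m * p2 (e - int M))"
  (is "?l = ?r")
proof
  assume ?l
  then obtain b m e where *: "x = fl_val M b m e" "m < 2 ^ (M + 1)" "e0 \<le> e" "e \<le> e1" "c \<longrightarrow> even m" by blast
  have "int m < 2 ^ (M + 1)" using *(2) by (metis of_nat_less_iff of_nat_numeral of_nat_power)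
  with * show ?r
    by - (rule exI[of _ "(if b then -1 else 1) * int m"], rule exI[of _ e], auto simp: fl_val_p2)
next
  assume ?r
  then obtain m e where *: "\<bar>m\<bar> < 2 ^ (M + 1)" "e0 \<le> e" "e \<le> e1" "c \<longrightarrow> even m" "x = real_of_int m * p2 (e - int M)"
    by blast
  then have "x = fl_val M (m < 0) (nat \<bar>m\<bar>) e" by (auto simp: fl_val_p2)
  moreover have "nat \<bar>m\<bar> < 2 ^ (M + 1)" using *(1) by (simp add: nat_less_iff)
  moreover have "c \<longrightarrow> even (nat \<bar>m\<bar>)" using *(4) by (simp add: even_nat_iff)
  ultimately show ?l using * by blast
qed

lemma F_iff: "x \<in> F \<longleftrightarrow> (\<exists>m e. \<bar>m\<bar> < 2 ^ (M + 1) \<and> e0 \<le> e \<and> e \<le> e1 \<and> x = real_of_int m * p2 (e - int M))"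
  using fl_val_iff[of False x] unfolding Fset_def mem_Collect_eq by (simp only: simp_thms) blast

lemma even_iff: "fl_even E M x \<longleftrightarrow>
    (\<exists>m e. \<bar>m\<bar> < 2 ^ (M + 1) \<and> e0 \<le> e \<and> e \<le> e1 \<and> even m \<and> x = real_of_int m * p2 (e - int M))"
  using fl_val_iff[of True x] by (simp add: fl_even_def)

lemma F_rep:
  "\<bar>m\<bar> < 2 ^ (M + 1) \<Longrightarrow> e0 \<le> e \<Longrightarrow> e \<le> e1 \<Longrightarrow> real_of_int m * p2 (e - int M) \<in> F"
  unfolding F_iff by blast

lemma even_rep:
  "\<bar>m\<bar> < 2 ^ (M + 1) \<Longrightarrow> e0 \<le> e \<Longrightarrow> e \<le> e1 \<Longrightarrow> even m \<Longrightarrow> fl_even E M (real_of_int m * p2 (e - int M))"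
  unfolding even_iff by blast

text \<open>A significand of magnitude \<open>2 ^ (M + 1)\<close> is one too large, but halving it
  and raising the exponent gives \<open>2 ^ M\<close>, which is even. Admitting this boundary value
  avoids a case distinction whenever a significand is increased by one.\<close>

lemma F_even_rep:
  assumes "\<bar>m\<bar> \<le> 2 ^ (M + 1)" "e0 \<le> e" "e < e1 \<or> e = e1 \<and> \<bar>m\<bar> < 2 ^ (M + 1)"
  shows "real_of_int m * p2 (e - int M) \<in> F"
    and "even m \<Longrightarrow> fl_even E M (real_of_int m * p2 (e - int M))"
proof -
  have "real_of_int m * p2 (e - int M) \<in> F \<and> (even m \<longrightarrow> fl_even E M (real_of_int m * p2 (e - int M)))"
  proof (cases "\<bar>m\<bar> < 2 ^ (M + 1)")
    case True
    then show ?thesis using assms F_rep[of m e] even_rep[of m e] by linarith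
  next
    case False
    then have m: "\<bar>m\<bar> = 2 ^ (M + 1)" and e: "e < e1" using assms by auto
    define m' where "m' = sgn m * 2 ^ M"
    have m': "m = 2 * m'" using m by (auto simp: m'_def abs_if sgn_if split: if_splits)
    have "even m'" using M3 by (auto simp: m'_def)
    moreover have "\<bar>m'\<bar> < 2 ^ (M + 1)" using m' m by (simp add: abs_mult)
    moreover have "real_of_int m * p2 (e - int M) = real_of_int m' * p2 ((e + 1) - int M)"
      using p2_Suc[of "e - int M"] by (simp add: m' algebra_simps)
    moreover have "e0 \<le> e + 1" "e + 1 \<le> e1" using e assms by auto
    ultimately show ?thesis using F_rep[of m' "e + 1"] even_rep[of m' "e + 1"] by simp
  qed
  then show "real_of_int m * p2 (e - int M) \<in> F"
    and "even m \<Longrightarrow> fl_even E M (real_of_int m * p2 (e - int M))" by auto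
qed

lemma F_I:
  assumes "\<bar>m\<bar> \<le> 2 ^ (M + 1)" "lo \<le> k" "k + int M < e1"
  shows "real_of_int m * p2 k \<in> F"
  using F_even_rep(1)[of m "k + int M"] assms by simp

lemma F_uminus [simp]: "- x \<in> F \<longleftrightarrow> x \<in> F"
proof -
  have "- x \<in> F" if "x \<in> F" for x
    using that unfolding F_iff by (metis abs_minus_cancel mult_minus_left of_int_minus)
  from this[of x] this[of "- x"] show ?thesis by auto
qed

lemma F_0 [simp]: "0 \<in> F"
  using F_I[of 0 "lo"] exponent_bounds by simp

lemma F_p2: "lo \<le> k \<Longrightarrow> k \<le> e1 \<Longrightarrow> p2 k \<in> F"
proof -
  assume k: "lo \<le> k" "k \<le> e1"
  show ?thesis
  proof (cases "k + int M < e1")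
    case True
    then show ?thesis using F_I[of 1 k] k one_le_power[of "2::int" "M + 1"] by simp
  next
    case False
    then have "p2 k = real_of_int (2 ^ M) * p2 (k - int M)" by (simp add: p2_diff p2_of_nat)
    then show ?thesis using F_rep[of "2 ^ M" k] k False exponent_bounds by simp
  qed
qed

lemma F_finite: "finite F"
proof -
  have "F \<subseteq> (\<lambda>(m, e). real_of_int m * p2 (e - int M)) ` ({- (2 ^ (M + 1))..2 ^ (M + 1)} \<times> {e0..e1})"
  proof
    fix x assume "x \<in> F"
    then obtain m e where "\<bar>m\<bar> < 2 ^ (M + 1)" "e0 \<le> e" "e \<le> e1" "x = real_of_int m * p2 (e - int M)"
      by (auto simp: F_iff)
    then show "x \<in> (\<lambda>(m, e). real_of_int m * p2 (e - int M)) ` ({- (2 ^ (M + 1))..2 ^ (M + 1)} \<times> {e0..e1})"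
      by (intro image_eqI[of _ _ "(m, e)"]) auto
  qed
  then show ?thesis by (rule finite_subset) auto
qed

lemma rep_bound:
  assumes "\<bar>m\<bar> < 2 ^ (M + 1)" shows "\<bar>real_of_int m * p2 (e - int M)\<bar> < p2 (e + 1)"
proof -
  have "\<bar>real_of_int m\<bar> < p2 (int (M + 1))"
    unfolding p2_of_nat using assms by (metis of_int_abs of_int_less_iff of_int_numeral of_int_power)
  then have "\<bar>real_of_int m * p2 (e - int M)\<bar> < p2 (int (M + 1)) * p2 (e - int M)" by (simp only: abs_mult) simp
  also have "\<dots> = p2 (e + 1)" by (simp flip: p2_add)
  finally show ?thesis .
qed

text \<open>A representation with exponent below \<open>e\<close> has magnitude below
  \<open>p2 e\<close>, so the exponent is at least \<open>e\<close> and \<open>x\<close> lies on the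
  grid belonging to \<open>e\<close>.\<close>

lemma F_multiple:
  assumes "x \<in> F" "p2 e \<le> \<bar>x\<bar> \<or> e = e0"
  obtains m where "x = real_of_int m * p2 (e - int M)"
proof -
  obtain m e' where *: "\<bar>m\<bar> < 2 ^ (M + 1)" "e0 \<le> e'" "e' \<le> e1" "x = real_of_int m * p2 (e' - int M)"
    using assms(1) by (auto simp: F_iff)
  have "p2 e < p2 (e' + 1) \<or> e = e0" using assms(2) rep_bound[OF *(1), of e'] *(4) order.strict_trans1 by blast
  then have "e \<le> e'" using *(2) by auto
  then have "x = real_of_int (m * 2 ^ nat (e' - e)) * p2 (e - int M)"
    using *(4) p2_split[of "e - int M" "e' - int M"] by simp
  then show ?thesis using that by blast
qed

lemma F_multiple_ul:
  assumes "x \<in> F" obtains m where "x = real_of_int m * ul"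
  using F_multiple[OF assms, of e0] unfolding ul_def by auto

lemma F_less_ul:
  assumes "x \<in> F" "y \<in> F" "x < y" shows "x + ul \<le> y"
proof -
  obtain m n where mn: "x = real_of_int m * ul" "y = real_of_int n * ul"
    using assms F_multiple_ul by metis
  then have "m < n" using assms(3) by simp
  then have "real_of_int m + 1 \<le> real_of_int n" by simp
  then have "(real_of_int m + 1) * ul \<le> real_of_int n * ul" by (intro mult_right_mono) auto
  then show ?thesis using mn by (simp add: algebra_simps)
qed

lemma F_le_max:
  assumes "x \<in> F" shows "\<bar>x\<bar> < p2 (e1 + 1)"
proof -
  obtain m e where *: "\<bar>m\<bar> < 2 ^ (M + 1)" "e \<le> e1" "x = real_of_int m * p2 (e - int M)"
    using assms by (auto simp: F_iff)
  have "p2 (e + 1) \<le> p2 (e1 + 1)" using * by simp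
  then show ?thesis using rep_bound[OF *(1), of e] *(3) by linarith
qed

section \<open>Neighbouring floats, and existence and uniqueness of rounding\<close>

lemma adjacent_aux:
  assumes a: "\<bar>a\<bar> < 2 ^ (M + 1)" "e0 \<le> e" "x = real_of_int a * p2 (e - int M)"
    and b: "\<bar>b\<bar> < 2 ^ (M + 1)" "e' \<le> e1" "y = real_of_int b * p2 (e' - int M)"
    and e: "e \<le> e'" "x < y" and no: "\<forall>z\<in>F. \<not> (x < z \<and> z < y)"
  shows "y = real_of_int (a + 1) * p2 (e - int M)"
proof -
  define u where "u = p2 (e - int M)"
  define c where "c = b * 2 ^ nat (e' - e)"
  have yc: "y = real_of_int c * u"
    using b(3) p2_split[of "e - int M" "e' - int M"] e(1) by (simp add: u_def c_def)
  have xa: "x = real_of_int a * u" using a by (simp add: u_def)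
  have upos: "0 < u" by (simp add: u_def)
  have ac: "a < c" using e(2) upos unfolding xa yc by simp
  \<comment> \<open>If \<open>e = e1\<close> then \<open>e' = e1\<close> as well, and
    \<open>a + 1 \<le> b\<close> stays in the significand range.\<close>
  have "e = e1 \<longrightarrow> \<bar>a + 1\<bar> < 2 ^ (M + 1)"
    using ac a(1) b(1,2) e(1) by (auto simp: c_def)
  then have "real_of_int (a + 1) * u \<in> F" unfolding u_def using a b(2) e(1) by (intro F_even_rep) auto
  moreover have "x < real_of_int (a + 1) * u" using xa upos by (simp add: algebra_simps)
  ultimately have "y \<le> real_of_int (a + 1) * u" using no by fastforce
  then have "c = a + 1" using ac upos unfolding yc by simp
  then show ?thesis using yc u_def by simp
qed

text \<open>The finer of the two representations fixes the grid: one step from it is again a float,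
  so the neighbour is that step. Negation swaps the two floats and covers the case in which the
  upper one is finer.\<close>

lemma adjacent:
  assumes x: "x \<in> F" and y: "y \<in> F" and "x < y" and no: "\<forall>z\<in>F. \<not> (x < z \<and> z < y)"
  obtains m k where "x = real_of_int m * p2 k" "y = real_of_int (m + 1) * p2 k"
    "\<bar>m\<bar> \<le> 2 ^ (M + 1)" "\<bar>m + 1\<bar> \<le> 2 ^ (M + 1)" "lo \<le> k" "k \<le> e1 - int M"
proof -
  obtain a e where a: "\<bar>a\<bar> < 2 ^ (M + 1)" "e0 \<le> e" "e \<le> e1" "x = real_of_int a * p2 (e - int M)"
    using x by (auto simp: F_iff)
  obtain b e' where b: "\<bar>b\<bar> < 2 ^ (M + 1)" "e0 \<le> e'" "e' \<le> e1" "y = real_of_int b * p2 (e' - int M)"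
    using y by (auto simp: F_iff)
  show ?thesis
  proof (cases "e \<le> e'")
    case True
    show ?thesis
      using that[of a "e - int M"] adjacent_aux[OF a(1,2,4) b(1,3,4) True \<open>x < y\<close> no] a by auto
  next
    case False
    have neg: "\<bar>- b\<bar> < 2 ^ (M + 1)" "- y = real_of_int (- b) * p2 (e' - int M)"
      "\<bar>- a\<bar> < 2 ^ (M + 1)" "- x = real_of_int (- a) * p2 (e - int M)" "e' \<le> e" "- y < - x"
      using a b False \<open>x < y\<close> by auto
    have "\<not> (- y < z \<and> z < - x)" if "z \<in> F" for z using bspec[OF no, of "- z"] that by (simp add: F_uminus) linarith
    then have "- x = real_of_int (- b + 1) * p2 (e' - int M)"
      by (intro adjacent_aux[OF neg(1) b(2) neg(2,3) a(3) neg(4-6)]) blast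
    then have "x = real_of_int (b - 1) * p2 (e' - int M)" by (simp add: algebra_simps)
    then show ?thesis using that[of "b - 1" "e' - int M"] b by auto
  qed
qed

text \<open>Finiteness gives a nearest float. In a tie the two nearest floats are neighbours, hence
  consecutive integers on one grid, and one of them is even.\<close>

lemma rnd_exists: "\<exists>y. is_rnd_nearest_even E M x y"
proof -
  have fin: "finite ((\<lambda>z. \<bar>x - z\<bar>) ` F)" "(\<lambda>z. \<bar>x - z\<bar>) ` F \<noteq> {}"
    using F_finite F_0 by (auto simp del: F_0)
  obtain y where y: "y \<in> F" "\<And>z. z \<in> F \<Longrightarrow> \<bar>x - y\<bar> \<le> \<bar>x - z\<bar>"
  proof -
    obtain y where "y \<in> F" "Min ((\<lambda>z. \<bar>x - z\<bar>) ` F) = \<bar>x - y\<bar>" using Min_in[OF fin] by auto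
    then show ?thesis using that Min_le[OF fin(1)] by force
  qed
  have main: "fl_even E M a \<or> fl_even E M b"
    if ab: "a \<in> F" "b \<in> F" "a < b" "\<bar>x - a\<bar> = \<bar>x - b\<bar>" "\<And>z. z \<in> F \<Longrightarrow> \<bar>x - a\<bar> \<le> \<bar>x - z\<bar>" for a b
  proof -
    have "x = (a + b) / 2" using ab(3,4) by (auto simp: abs_if split: if_splits)
    then have no: "\<forall>z\<in>F. \<not> (a < z \<and> z < b)"
      using ab(5) by (fastforce simp: abs_if field_simps split: if_splits)
    obtain m k where mk_layer: "a = real_of_int m * p2 k" "b = real_of_int (m + 1) * p2 k"
      "\<bar>m\<bar> \<le> 2 ^ (M + 1)" "\<bar>m + 1\<bar> \<le> 2 ^ (M + 1)" "lo \<le> k" "k \<le> e1 - int M"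
      using adjacent[OF ab(1,2,3) no] by metis
    have even: "fl_even E M (real_of_int n * p2 k)"
      if "even n" "\<bar>n\<bar> \<le> 2 ^ (M + 1)" "real_of_int n * p2 k \<in> F" for n
    proof -
      \<comment> \<open>At the top exponent the significand \<open>2 ^ (M + 1)\<close> cannot be
        renormalised, but it is excluded because floats stay below
        \<open>p2 (e1 + 1)\<close>.\<close>
      have "\<bar>n\<bar> < 2 ^ (M + 1)" if k: "k + int M = e1"
      proof (rule ccontr)
        assume "\<not> \<bar>n\<bar> < 2 ^ (M + 1)"
        then have "\<bar>n\<bar> = 2 ^ (M + 1)" using \<open>\<bar>n\<bar> \<le> 2 ^ (M + 1)\<close> by simp
        then have "\<bar>real_of_int n\<bar> = p2 (int (M + 1))"
          unfolding p2_of_nat by (metis of_int_abs of_int_numeral of_int_power)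
        then have "\<bar>real_of_int n * p2 k\<bar> = p2 (int (M + 1)) * p2 k" by (simp add: abs_mult)
        also have "\<dots> = p2 (e1 + 1)" using k by (simp flip: p2_add add: algebra_simps)
        finally show False using F_le_max[OF \<open>real_of_int n * p2 k \<in> F\<close>] by simp
      qed
      then show ?thesis using F_even_rep(2)[of n "k + int M"] that mk_layer(5,6) by force
    qed
    show ?thesis
    proof (cases "even m")
      case True then show ?thesis using even[of m] mk_layer ab(1) by auto
    next
      case False then show ?thesis using even[of "m + 1"] mk_layer ab(2) by auto
    qed
  qed
  show ?thesis
  proof (cases "\<exists>z\<in>F. z \<noteq> y \<and> \<bar>x - z\<bar> = \<bar>x - y\<bar>")
    case True
    then obtain z where z: "z \<in> F" "z \<noteq> y" "\<bar>x - z\<bar> = \<bar>x - y\<bar>" by auto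
    then have "fl_even E M y \<or> fl_even E M z"
      using main[of y z] main[of z y] y by (cases "y < z") force+
    then show ?thesis using y z unfolding is_rnd_nearest_even_def by metis
  next
    case False
    then show ?thesis using y unfolding is_rnd_nearest_even_def by metis
  qed
qed

text \<open>On the finer of the two grids both significands are even, so the one following
  \<open>a\<close> lies strictly between. Hence two even floats never tie for nearest, and the tie
  rule determines the result.\<close>

lemma even_not_adjacent:
  assumes a: "\<bar>a\<bar> < 2 ^ (M + 1)" "e0 \<le> e" "even a" "y = real_of_int a * p2 (e - int M)"
    and b: "e' \<le> e1" "even b" "z = real_of_int b * p2 (e' - int M)" and e: "e \<le> e'" "y < z"
  shows "\<exists>w\<in>F. y < w \<and> w < z"
proof -
  define u where "u = p2 (e - int M)"
  define c where "c = b * 2 ^ nat (e' - e)"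
  have zc: "z = real_of_int c * u"
    using b(3) p2_split[of "e - int M" "e' - int M"] e(1) by (simp add: u_def c_def)
  have ya: "y = real_of_int a * u" using a by (simp add: u_def)
  have upos: "0 < u" by (simp add: u_def)
  have "a < c" using e(2) upos unfolding ya zc by simp
  moreover have "even c" using b by (simp add: c_def)
  ultimately have "a + 1 < c" using a(3) by presburger
  then have "real_of_int (a + 1) * u < z" using upos unfolding zc by simp
  moreover have "y < real_of_int (a + 1) * u" using upos unfolding ya by simp
  moreover have "even ((2::int) ^ (M + 1))" by simp
  then have "a + 1 \<noteq> 2 ^ (M + 1)" using a(3) by (metis even_plus_one_iff)
  then have "\<bar>a + 1\<bar> < 2 ^ (M + 1)" using a(1) by linarith
  then have "real_of_int (a + 1) * u \<in> F" unfolding u_def using a(2) b(1) e(1) by (intro F_rep) auto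
  ultimately show ?thesis by blast
qed

lemma rnd_unique:
  assumes y: "is_rnd_nearest_even E M x y" and z: "is_rnd_nearest_even E M x z"
  shows "y = z"
proof -
  have main: False
    if y: "is_rnd_nearest_even E M x y" and z: "is_rnd_nearest_even E M x z" and "y < z" for y z
  proof -
    have eq: "\<bar>x - y\<bar> = \<bar>x - z\<bar>" and ev: "fl_even E M y" "fl_even E M z"
      using y z \<open>y < z\<close> unfolding is_rnd_nearest_even_def by (smt (verit))+
    have xm: "x = (y + z) / 2" using eq \<open>y < z\<close> by (auto simp: abs_if split: if_splits)
    have no: "False" if "w \<in> F" "y < w" "w < z" for w
    proof -
      have "\<bar>x - y\<bar> \<le> \<bar>x - w\<bar>" using that(1) y unfolding is_rnd_nearest_even_def by auto
      then show False using xm that(2,3) by (auto simp: abs_if field_simps split: if_splits)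
    qed
    obtain a e where a: "\<bar>a\<bar> < 2 ^ (M + 1)" "e0 \<le> e" "e \<le> e1" "even a" "y = real_of_int a * p2 (e - int M)"
      using ev(1) by (auto simp: even_iff)
    obtain b e' where b: "\<bar>b\<bar> < 2 ^ (M + 1)" "e0 \<le> e'" "e' \<le> e1" "even b" "z = real_of_int b * p2 (e' - int M)"
      using ev(2) by (auto simp: even_iff)
    show False
    proof (cases "e \<le> e'")
      case True
      then show False using even_not_adjacent[OF a(1,2,4,5) b(3-5) True \<open>y < z\<close>] no by blast
    next
      case False
      then obtain w where "w \<in> F" "- z < w" "w < - y"
        using even_not_adjacent[of "- b" e' "- z" e "- a" "- y"] a b \<open>y < z\<close> by auto
      then show False using no[of "- w"] by (simp add: F_uminus)
    qed
  qed
  show ?thesis using main[OF y z] main[OF z y] by (meson linorder_neqE)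
qed

text \<open>Rounding as a total function on the reals, without overflow; it agrees with
  \<open>rnd\<close> for arguments of magnitude at most \<open>Omega\<close>.\<close>

definition fr :: "real \<Rightarrow> real" where
  "fr x = (THE y. is_rnd_nearest_even E M x y)"

lemma fr_rnd: "is_rnd_nearest_even E M x (fr x)"
  unfolding fr_def using rnd_exists rnd_unique by (metis theI)

lemma fr_F [simp]: "fr x \<in> F"
  using fr_rnd unfolding is_rnd_nearest_even_def by blast

lemma fr_near: "z \<in> F \<Longrightarrow> \<bar>x - fr x\<bar> \<le> \<bar>x - z\<bar>"
  using fr_rnd unfolding is_rnd_nearest_even_def by blast

lemma fr_tie: "z \<in> F \<Longrightarrow> z \<noteq> fr x \<Longrightarrow> \<bar>x - z\<bar> = \<bar>x - fr x\<bar> \<Longrightarrow> fl_even E M (fr x)"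
  using fr_rnd unfolding is_rnd_nearest_even_def by blast

lemma fr_id [simp]: "x \<in> F \<Longrightarrow> fr x = x"
  using fr_near[of x x] by simp

lemma fr_mono: "x \<le> y \<Longrightarrow> fr x \<le> fr y"
proof (rule ccontr)
  assume xy: "x \<le> y" and "\<not> fr x \<le> fr y"
  then have lt: "fr y < fr x" by simp
  have n: "\<bar>x - fr x\<bar> \<le> \<bar>x - fr y\<bar>" "\<bar>y - fr y\<bar> \<le> \<bar>y - fr x\<bar>" using fr_near by auto
  have "x \<ge> (fr x + fr y) / 2" using n(1) lt by (auto simp: abs_if field_simps split: if_splits)
  moreover have "y \<le> (fr x + fr y) / 2" using n(2) lt by (auto simp: abs_if field_simps split: if_splits)
  ultimately have "x = y" using xy by linarith
  then show False using lt by simp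
qed

lemma fr_le: "x \<le> y \<Longrightarrow> y \<in> F \<Longrightarrow> fr x \<le> y"
  using fr_mono[of x y] by simp

lemma fr_ge: "y \<le> x \<Longrightarrow> y \<in> F \<Longrightarrow> y \<le> fr x"
  using fr_mono[of y x] by simp

lemma fr_abs_le: "\<bar>x\<bar> \<le> y \<Longrightarrow> y \<in> F \<Longrightarrow> \<bar>fr x\<bar> \<le> y"
  using fr_le[of x y] fr_ge[of "- y" x] by (simp add: abs_le_iff)

lemma fl_even_uminus: "fl_even E M (- x) \<longleftrightarrow> fl_even E M x"
proof -
  have "fl_even E M (- x)" if ev: "fl_even E M x" for x
  proof -
    obtain m e where "\<bar>m\<bar> < 2 ^ (M + 1)" "e0 \<le> e" "e \<le> e1" "even m" "x = real_of_int m * p2 (e - int M)"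
      using ev unfolding even_iff by blast
    then show ?thesis unfolding even_iff by - (rule exI[of _ "- m"], rule exI[of _ e], auto)
  qed
  from this[of x] this[of "- x"] show ?thesis by auto
qed

lemma fr_minus [simp]: "fr (- x) = - fr x"
proof -
  have "is_rnd_nearest_even E M (- x) (- fr x)"
    unfolding is_rnd_nearest_even_def
  proof (intro conjI ballI impI)
    show "- fr x \<in> F" by simp
    fix z assume z: "z \<in> F"
    then show "\<bar>- x - - fr x\<bar> \<le> \<bar>- x - z\<bar>" using fr_near[of "- z" x] by simp
    assume "z \<noteq> - fr x \<and> \<bar>- x - z\<bar> = \<bar>- x - - fr x\<bar>"
    then show "fl_even E M (- fr x)"
      using fr_tie[of "- z" x] z by (simp add: fl_even_uminus) (metis abs_minus_commute add.commute diff_minus_eq_add minus_diff_eq)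
  qed
  then show ?thesis using rnd_unique fr_rnd by blast
qed

lemma Omega_p2: "Omega E M = 2 * p2 e1 - p2 (e1 - int M)"
  unfolding Omega_def p2_diff p2_of_nat
  by (simp add: p2_def powr_minus powr_realpow algebra_simps divide_inverse)

lemma Omega_ge: "3 / 2 * p2 e1 \<le> Omega E M"
proof -
  have "p2 (e1 - int M) \<le> p2 (e1 - 1)" using exponent_bounds by simp
  then show ?thesis unfolding Omega_p2 using p2_diff[of e1 1] by simp
qed

lemma F_le_Omega: assumes "x \<in> F" shows "\<bar>x\<bar> \<le> Omega E M"
proof -
  have eq: "Omega E M = real_of_int (2 ^ (M + 1) - 1) * p2 (e1 - int M)"
    unfolding Omega_p2 p2_diff p2_of_nat by (simp add: field_simps)
  obtain m e where *: "\<bar>m\<bar> < 2 ^ (M + 1)" "e0 \<le> e" "e \<le> e1" "x = real_of_int m * p2 (e - int M)"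
    using assms by (auto simp: F_iff)
  have "\<bar>x\<bar> = real_of_int \<bar>m\<bar> * p2 (e - int M)" using * by (simp add: abs_mult)
  also have "\<dots> \<le> real_of_int (2 ^ (M + 1) - 1) * p2 (e1 - int M)"
    using *(1,3) by (intro mult_mono) (simp_all del: of_int_diff of_int_abs)
  finally show ?thesis using eq by simp
qed

lemma rnd_fr: "\<bar>x\<bar> \<le> Omega E M \<Longrightarrow> rnd E M x = Num (fr x)"
proof -
  assume x: "\<bar>x\<bar> \<le> Omega E M"
  have "0 < 2 powr of_int e1 * eps M" by (simp add: eps_def)
  then show ?thesis using x unfolding rnd_def Let_def fr_def by auto
qed

lemma fr_err:
  assumes "\<bar>x\<bar> \<le> p2 (k + 1)" "e0 \<le> k" "k < e1"
  shows "\<bar>fr x - x\<bar> \<le> p2 (k - int M) / 2"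
proof -
  define u where "u = p2 (k - int M)"
  have upos: "0 < u" by (simp add: u_def)
  define n where "n = round (x / u)"
  have "\<bar>real_of_int n - x / u\<bar> \<le> 1 / 2" unfolding n_def by (rule of_int_round_abs_le)
  then have "\<bar>real_of_int n - x / u\<bar> * u \<le> 1 / 2 * u" using upos by (intro mult_right_mono) auto
  moreover have "\<bar>real_of_int n - x / u\<bar> * u = \<bar>real_of_int n * u - x\<bar>"
  proof -
    have "real_of_int n * u - x = (real_of_int n - x / u) * u" using upos by (simp add: left_diff_distrib)
    then show ?thesis using upos by (simp add: abs_mult)
  qed
  ultimately have d: "\<bar>real_of_int n * u - x\<bar> \<le> u / 2" by simp
  have "\<bar>x / u\<bar> \<le> 2 ^ (M + 1)"
  proof -
    have "p2 (k + 1) = p2 (int (M + 1)) * u" unfolding u_def by (simp flip: p2_add)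
    then have "\<bar>x\<bar> \<le> 2 ^ (M + 1) * u" using assms(1) p2_of_nat[of "M + 1"] by simp
    then show ?thesis using upos by (simp add: pos_divide_le_eq)
  qed
  then have "- (2 ^ (M + 1)) \<le> x / u" "x / u \<le> 2 ^ (M + 1)" by linarith+
  then have "round (- (2 ^ (M + 1)) :: real) \<le> n" "n \<le> round (2 ^ (M + 1) :: real)"
    unfolding n_def by (auto intro: round_mono)
  moreover have "round (- (2 ^ (M + 1)) :: real) = - (2 ^ (M + 1))" "round (2 ^ (M + 1) :: real) = 2 ^ (M + 1)"
    using round_of_int[where 'a=real, of "- (2 ^ (M + 1))"] round_of_int[where 'a=real, of "2 ^ (M + 1)"] by simp_all
  ultimately have "\<bar>n\<bar> \<le> 2 ^ (M + 1)" by linarith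
  then have "real_of_int n * u \<in> F"
    unfolding u_def using F_even_rep(1)[of n k] assms by simp
  then show ?thesis using fr_near[of "real_of_int n * u" x] d unfolding u_def by linarith
qed

text \<open>The float \<open>y\<close> is a candidate for rounding, so the error is at most
  \<open>\<bar>v\<bar>\<close>. This crude bound needs no knowledge of the exponent of
  \<open>y\<close>.\<close>

lemma fr_near_F: "y \<in> F \<Longrightarrow> \<bar>fr (y + v) - y\<bar> \<le> 2 * \<bar>v\<bar>"
  using fr_near[of y "y + v"] by linarith

text \<open>\<open>fl_even\<close> accepts any representation with even significand, so all of them
  must be excluded: a grid at least as coarse would make \<open>m\<close> even, a finer one would
  need a significand of at least \<open>2 ^ (M + 1)\<close>.\<close>

lemma not_even:
  assumes "odd m" "2 ^ M \<le> m"
  shows "\<not> fl_even E M (real_of_int m * p2 k)"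
proof
  assume "fl_even E M (real_of_int m * p2 k)"
  then obtain n e where n: "\<bar>n\<bar> < 2 ^ (M + 1)" "even n" "real_of_int m * p2 k = real_of_int n * p2 (e - int M)"
    unfolding even_iff by auto
  show False
  proof (cases "k \<le> e - int M")
    case True
    then have "real_of_int m * p2 k = real_of_int (n * 2 ^ nat (e - int M - k)) * p2 k"
      using n(3) p2_split[OF True] by simp
    then have "m = n * 2 ^ nat (e - int M - k)" by (simp only: mult_cancel_right p2_pos of_int_eq_iff) simp
    then show False using n(2) assms(1) by simp
  next
    case False
    then have k: "e - int M \<le> k" by simp
    then have "real_of_int (m * 2 ^ nat (k - (e - int M))) * p2 (e - int M) = real_of_int n * p2 (e - int M)"
      using n(3) p2_split[OF k] by simp
    then have "n = m * 2 ^ nat (k - (e - int M))" by (simp only: mult_cancel_right p2_pos of_int_eq_iff) simp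
    moreover have "(2::int) ^ 1 \<le> 2 ^ nat (k - (e - int M))" using False by (intro power_increasing) auto
    moreover have "0 \<le> m" using assms(2) by (rule order_trans[rotated]) simp
    ultimately have "2 ^ M * 2 \<le> n" using assms(2) mult_mono[of "2 ^ M" m 2 "2 ^ nat (k - (e - int M))"] by simp
    then show False using n(1) by simp
  qed
qed

end

section \<open>Thresholding by repeated rounding\<close>

context fp
begin

text \<open>The next float above a power of two has the odd significand \<open>2 ^ M + 1\<close>, so
  even the tie at half a step falls back.\<close>

lemma fr_p2_up:
  assumes "e0 \<le> k" "0 \<le> x" "x \<le> p2 (k - int M) / 2"
  shows "fr (p2 k + x) \<le> p2 k"
proof (rule ccontr)
  define u where "u = p2 (k - int M)"
  define y where "y = fr (p2 k + x)"
  have pk: "p2 k = 2 ^ M * u" unfolding u_def by (simp add: p2_diff p2_of_nat)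
  assume "\<not> fr (p2 k + x) \<le> p2 k"
  then have gt: "p2 k < y" by (simp add: y_def)
  have "p2 k \<in> F \<or> e1 < k" using assms(1) F_p2[of k] by force
  moreover have "\<not> e1 < k"
  proof
    assume "e1 < k"
    then have "p2 (e1 + 1) \<le> p2 k" by simp
    then show False using gt F_le_max[OF fr_F, of "p2 k + x"] unfolding y_def by linarith
  qed
  ultimately have pF: "p2 k \<in> F" by simp
  have "p2 k \<le> \<bar>y\<bar>" using gt p2_pos(2)[of k] by linarith
  then obtain m where m: "y = real_of_int m * u"
    using F_multiple[of y k] unfolding y_def u_def by (metis fr_F)
  have "2 ^ M < m"
  proof -
    have "2 ^ M * u < real_of_int m * u" using gt m pk by simp
    then have "real_of_int (2 ^ M) < real_of_int m" by (simp add: u_def)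
    then show ?thesis by (simp only: of_int_less_iff)
  qed
  then have "real_of_int (2 ^ M + 1) \<le> real_of_int m" by (simp only: of_int_le_iff)
  then have "(2 ^ M + 1) * u \<le> y" unfolding m by (intro mult_right_mono) (auto simp: u_def)
  then have ge: "p2 k + u \<le> y" using pk by (simp add: algebra_simps)
  have near: "\<bar>(p2 k + x) - y\<bar> \<le> \<bar>(p2 k + x) - p2 k\<bar>" unfolding y_def by (rule fr_near[OF pF])
  have yx: "y = p2 k + u" "x = u / 2" using near ge assms(2,3) unfolding u_def by linarith+
  have "fl_even E M y" unfolding y_def
    by (rule fr_tie[OF pF]) (use gt near yx assms(2) in \<open>auto simp: y_def[symmetric]\<close>)
  moreover have "y = real_of_int (2 ^ M + 1) * u" using yx pk by (simp add: algebra_simps)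
  moreover have "odd (2 ^ M + 1 :: int)" using M3 by simp
  ultimately show False using not_even[of "2 ^ M + 1" "k - int M"] unfolding u_def by simp
qed

text \<open>Below a power of two the grid is twice as fine, hence a quarter in place of a half. The
  neighbour below has the odd significand \<open>2 ^ (M + 1) - 1\<close>, so the tie goes
  up.\<close>

lemma fr_p2_down:
  assumes "e0 < k" "k \<le> e1" "- p2 (k - int M) / 4 \<le> x" "x \<le> 0"
  shows "p2 k \<le> fr (p2 k + x)"
proof (rule ccontr)
  define u where "u = p2 (k - 1 - int M)"
  define y where "y = fr (p2 k + x)"
  have u2: "p2 (k - int M) = 2 * u" unfolding u_def using p2_Suc[of "k - int M - 1"] by (simp add: algebra_simps)
  have upos: "0 < u" by (simp add: u_def)
  have pk: "p2 k = real_of_int (2 ^ (M + 1)) * u" unfolding u_def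
    using p2_add[of "int (M + 1)" "k - 1 - int M"] p2_of_nat[of "M + 1"] by simp
  assume "\<not> p2 k \<le> fr (p2 k + x)"
  then have lt: "y < p2 k" by (simp add: y_def)
  have pF: "p2 k \<in> F" using assms F_p2[of k] by simp
  have near: "\<bar>(p2 k + x) - y\<bar> \<le> \<bar>(p2 k + x) - p2 k\<bar>" unfolding y_def by (rule fr_near[OF pF])
  have "p2 k = 2 * p2 (k - 1)" using p2_Suc[of "k - 1"] by simp
  moreover have "u \<le> p2 (k - 1)" unfolding u_def by simp
  ultimately have "p2 (k - 1) \<le> \<bar>y\<bar>" using near assms(3,4) u2 lt upos by linarith
  then obtain m where m: "y = real_of_int m * u"
    using F_multiple[of y "k - 1"] unfolding y_def u_def by (metis fr_F)
  have "m < 2 ^ (M + 1)" using lt upos unfolding m pk by (simp only: mult_less_cancel_right of_int_less_iff)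
  then have "real_of_int m \<le> real_of_int (2 ^ (M + 1) - 1)" by (simp only: of_int_le_iff)
  then have "real_of_int m * u \<le> real_of_int (2 ^ (M + 1) - 1) * u" by (intro mult_right_mono) (auto simp: u_def)
  then have le: "y \<le> p2 k - u" unfolding m pk by (simp add: algebra_simps)
  have yx: "y = p2 k - u" "x = - u / 2" using near le assms(3,4) u2 by linarith+
  have "p2 k \<noteq> y" "\<bar>p2 k + x - p2 k\<bar> = \<bar>p2 k + x - y\<bar>" using yx upos by auto
  then have "fl_even E M y" using fr_tie[OF pF, of "p2 k + x"] unfolding y_def[symmetric] by blast
  moreover have "y = real_of_int (2 ^ (M + 1) - 1) * u" using yx pk by (simp add: algebra_simps)
  moreover have "odd (2 ^ (M + 1) - 1 :: int)" by simp
  moreover have "(2::int) ^ M \<le> 2 ^ (M + 1) - 1" using one_le_power[of "2::int" M] by simp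
  ultimately show False using not_even[of "2 ^ (M + 1) - 1" "k - 1 - int M"] unfolding u_def by simp
qed

text \<open>Odd multiple of the grid width \<^term>\<open>p2 k\<close>: the ties on both sides of it are rounded away from it.\<close>
definition Cc :: "int \<Rightarrow> real" where
  "Cc k = (2 ^ M + 1) * p2 k"

lemma Cc_split: "Cc k = p2 (k + int M) + p2 k"
  by (simp add: Cc_def p2_add p2_of_nat algebra_simps)

lemma Cc_pos: "0 < Cc k" by (simp add: Cc_split add_pos_pos)

lemma Cc_F: "lo \<le> k \<Longrightarrow> k + int M < e1 \<Longrightarrow> Cc k \<in> F"
  using F_I[of "2 ^ M + 1" k] one_le_power[of "2::int" M] by (simp add: Cc_def)

lemma F_grid_above:
  assumes "y \<in> F" "lo \<le> k" "p2 (k + int M) \<le> y" "real_of_int m * p2 k < y"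
  shows "real_of_int (m + 1) * p2 k \<le> y"
proof -
  have "p2 (k + int M) \<le> \<bar>y\<bar>" using assms(3) by linarith
  then obtain n where n: "y = real_of_int n * p2 k"
    using F_multiple[OF assms(1), of "k + int M"] by auto
  then have "m < n" using assms(4) by simp
  then have "real_of_int (m + 1) \<le> real_of_int n" by (simp only: of_int_le_iff)
  then show ?thesis unfolding n by (intro mult_right_mono) auto
qed

lemma Cc_gap:
  assumes "y \<in> F" "lo \<le> k"
  shows "Cc k < y \<Longrightarrow> Cc k + p2 k \<le> y" and "p2 (k + int M) < y \<Longrightarrow> Cc k \<le> y"
proof -
  have eq: "Cc k = real_of_int (2 ^ M + 1) * p2 k" "p2 (k + int M) = real_of_int (2 ^ M) * p2 k"
    by (auto simp: Cc_def p2_add p2_of_nat)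
  show "Cc k < y \<Longrightarrow> Cc k + p2 k \<le> y"
  proof -
    assume "Cc k < y"
    moreover from this have "p2 (k + int M) \<le> y" using Cc_split[of k] p2_pos(1)[of k] by linarith
    ultimately have "real_of_int (2 ^ M + 1 + 1) * p2 k \<le> y" using eq by (intro F_grid_above assms) auto
    then show ?thesis by (simp add: Cc_def algebra_simps)
  qed
  show "p2 (k + int M) < y \<Longrightarrow> Cc k \<le> y"
    using F_grid_above[OF assms, of "2 ^ M"] eq by simp
qed

text \<open>A result below the upper neighbour would have to be \<open>Cc k\<close>, and the tie
  rule would make it even, against its odd significand \<open>2 ^ M + 1\<close>.\<close>

lemma fr_Cc_tie:
  assumes "lo \<le> k" "k + int M < e1"
  shows "Cc k + p2 k \<le> fr (Cc k + p2 k / 2)"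
proof (rule ccontr)
  define y where "y = fr (Cc k + p2 k / 2)"
  assume "\<not> Cc k + p2 k \<le> fr (Cc k + p2 k / 2)"
  then have lt: "y < Cc k + p2 k" by (simp add: y_def)
  have CF: "Cc k \<in> F" using Cc_F assms by simp
  have "(2::int) ^ 1 \<le> 2 ^ M" using M3 by (intro power_increasing) auto
  then have "real_of_int (2 ^ M + 2) * p2 k \<in> F" using assms by (intro F_I) auto
  then have CF': "Cc k + p2 k \<in> F" by (simp add: Cc_def algebra_simps)
  have "Cc k \<le> y" unfolding y_def by (rule fr_ge) (use CF in auto)
  then have y: "y = Cc k" using Cc_gap(1)[of y k] lt assms(1) unfolding y_def by force
  have "fl_even E M y" unfolding y_def
    by (rule fr_tie[OF CF']) (use lt y in \<open>auto simp: y_def[symmetric]\<close>)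
  then show False using y not_even[of "2 ^ M + 1" k] M3 by (simp add: Cc_def)
qed

lemma fr_Cc_near:
  assumes "lo \<le> k" "k + int M < e1" "\<bar>x\<bar> < p2 k / 2"
  shows "fr (Cc k + x) = Cc k"
proof -
  define y where "y = fr (Cc k + x)"
  have CF: "Cc k \<in> F" using Cc_F assms by simp
  have near: "\<bar>(Cc k + x) - y\<bar> \<le> \<bar>(Cc k + x) - Cc k\<bar>" unfolding y_def by (rule fr_near[OF CF])
  have "\<not> Cc k < y" using Cc_gap(1)[of y k] near assms by (auto simp: y_def)
  moreover have "\<not> y < Cc k"
  proof
    assume lt: "y < Cc k"
    then have "y \<le> p2 (k + int M)" using Cc_gap(2)[of y k] assms(1) unfolding y_def by force
    then show False using near assms(3) Cc_split[of k] by linarith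
  qed
  ultimately show ?thesis unfolding y_def by simp
qed

text \<open>Rounds \<open>v\<close> to the grid of width \<^term>\<open>p2 k\<close>, with the ties next to 0 going away from 0.\<close>
definition round_step :: "int \<Rightarrow> real \<Rightarrow> real" where
  "round_step k v = fr (fr (v + Cc k) - Cc k)"

lemma round_step_F [simp]: "round_step k v \<in> F" by (simp add: round_step_def)

lemma round_step_mono: "v \<le> w \<Longrightarrow> round_step k v \<le> round_step k w"
  unfolding round_step_def by (intro fr_mono diff_right_mono) auto

lemma round_step_neg:
  assumes "lo \<le> k" "k + int M < e1" "v \<le> 0" shows "round_step k v \<le> 0"
proof -
  have "fr (v + Cc k) \<le> Cc k" using fr_le[of "v + Cc k" "Cc k"] assms Cc_F by simp
  then show ?thesis unfolding round_step_def by (intro fr_le) auto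
qed

text \<open>Half a step becomes a full step: this is the doubling that a chain of such steps
  iterates.\<close>

lemma round_step_pos:
  assumes "lo \<le> k" "k + int M < e1" "p2 k / 2 \<le> v" shows "p2 k \<le> round_step k v"
proof -
  have "Cc k + p2 k \<le> fr (Cc k + p2 k / 2)" using fr_Cc_tie assms by simp
  also have "\<dots> \<le> fr (v + Cc k)" using assms by (intro fr_mono) auto
  finally show ?thesis unfolding round_step_def using assms by (intro fr_ge F_p2) auto
qed

text \<open>Powers of two are preserved as bounds; otherwise magnitudes could drift upwards along a
  long chain. By monotonicity only the inputs \<open>p2 p\<close> and \<open>- p2 p\<close>
  matter.\<close>

lemma round_step_bound:
  assumes k: "lo \<le> k" "k + int M < e1" and p: "k \<le> p" "p < e1" and v: "\<bar>v\<bar> \<le> p2 p"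
  shows "\<bar>round_step k v\<bar> \<le> p2 p"
proof -
  have e0p: "e0 \<le> k + int M" using k by simp
  have pF: "p2 p \<in> F" using p k F_p2 by simp
  have Cle: "Cc k \<le> p2 p" if "k + int M < p"
  proof -
    have "Cc k \<le> p2 (k + int M) + p2 (k + int M)" unfolding Cc_split by simp
    also have "\<dots> = p2 (k + int M + 1)" by (simp add: p2_Suc)
    also have "\<dots> \<le> p2 p" using that by simp
    finally show ?thesis .
  qed
  define j where "j = (2::int) ^ nat (p - k)"
  have pj: "p2 p = real_of_int j * p2 k" unfolding j_def by (rule p2_split) (use p in auto)
  have jle: "j \<le> 2 ^ M" if "p \<le> k + int M"
    unfolding j_def by (rule power_increasing) (use that in auto)
  have j1: "1 \<le> j" unfolding j_def by simp
  have up: "round_step k (p2 p) \<le> p2 p"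
  \<comment> \<open>Either \<open>p2 p\<close> dominates \<open>Cc k\<close> and the rounding error
    is absorbed at the power of two, or \<open>p2 p\<close> is \<open>j\<close> grid steps with
    \<open>j \<le> 2 ^ M\<close>, and the sum is a float unless \<open>j = 2 ^ M\<close>.\<close>
  proof (cases "k + int M < p")
    case True
    have "\<bar>fr (p2 p + Cc k) - (p2 p + Cc k)\<bar> \<le> p2 (p - int M) / 2"
      using Cle[OF True] Cc_pos[of k] True p e0p p2_Suc[of p] by (intro fr_err) auto
    then have "fr (p2 p + Cc k) - Cc k \<le> p2 p + p2 (p - int M) / 2" by linarith
    then have "round_step k (p2 p) \<le> fr (p2 p + p2 (p - int M) / 2)" unfolding round_step_def by (rule fr_mono)
    also have "\<dots> \<le> p2 p" using True e0p by (intro fr_p2_up) auto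
    finally show ?thesis .
  next
    case False
    show ?thesis
    proof (cases "j < 2 ^ M")
      case True
      have "real_of_int (2 ^ M + 1 + j) * p2 k \<in> F" using True j1 k by (intro F_I) auto
      moreover have "real_of_int (2 ^ M + 1 + j) * p2 k = p2 p + Cc k" using pj by (simp add: Cc_def algebra_simps)
      ultimately show ?thesis unfolding round_step_def using pF by simp
    next
      case j: False
      then have "j = 2 ^ M" using jle False by simp
      then have "p2 p = p2 (k + int M)" using pj by (simp add: p2_add p2_of_nat)
      then have pk: "p = k + int M" by simp
      \<comment> \<open>The sum has the significand \<open>2 ^ (M + 1) + 1\<close>: a tie just above
        a power of two, which falls back to it.\<close>
      have "p2 p + Cc k = p2 (p + 1) + p2 k" unfolding Cc_split pk by (simp add: p2_Suc)
      moreover have "fr (p2 (p + 1) + p2 k) \<le> p2 (p + 1)"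
        by (rule fr_p2_up) (use pk e0p p2_Suc[of k] in \<open>simp_all add: algebra_simps\<close>)
      ultimately have "fr (p2 p + Cc k) \<le> p2 (p + 1)" by simp
      also have "\<dots> \<le> p2 p + Cc k" unfolding Cc_split pk by (simp add: p2_Suc)
      finally show ?thesis unfolding round_step_def by (intro fr_le pF) simp
    qed
  qed
  have dn: "- p2 p \<le> round_step k (- p2 p)"
  proof (cases "k + int M < p")
    case True
    have pp: "p2 p = p2 (p - 1 + 1)" by simp
    have "\<bar>fr (- p2 p + Cc k) - (- p2 p + Cc k)\<bar> \<le> p2 (p - 1 - int M) / 2"
      using Cle[OF True] Cc_pos[of k] True p e0p by (intro fr_err) auto
    moreover have "p2 (p - 1 - int M) \<le> p2 (p - int M)" by simp
    ultimately have "- (p2 p + p2 (p - int M) / 2) \<le> fr (- p2 p + Cc k) - Cc k" by linarith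
    then have "fr (- (p2 p + p2 (p - int M) / 2)) \<le> round_step k (- p2 p)" unfolding round_step_def by (rule fr_mono)
    moreover have "fr (p2 p + p2 (p - int M) / 2) \<le> p2 p" using True e0p by (intro fr_p2_up) auto
    ultimately show ?thesis unfolding fr_minus by linarith
  next
    case False
    have "real_of_int (2 ^ M + 1 - j) * p2 k \<in> F" using jle False j1 k by (intro F_I) auto
    moreover have "real_of_int (2 ^ M + 1 - j) * p2 k = - p2 p + Cc k" using pj by (simp add: Cc_def algebra_simps)
    ultimately show ?thesis unfolding round_step_def using pF by simp
  qed
  have "round_step k v \<le> round_step k (p2 p)" "round_step k (- p2 p) \<le> round_step k v" using v by (auto intro!: round_step_mono)
  then show ?thesis using up dn by linarith
qed

section \<open>Left-to-right sums without overflow\<close>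

fun run :: "real \<Rightarrow> real list \<Rightarrow> real \<Rightarrow> bool" where
  "run a [] b \<longleftrightarrow> b = a"
| "run a (t # ts) b \<longleftrightarrow> \<bar>a + t\<bar> \<le> Omega E M \<and> run (fr (a + t)) ts b"

lemma run_append: "run a (xs @ ys) c \<longleftrightarrow> (\<exists>b. run a xs b \<and> run b ys c)"
  by (induction xs arbitrary: a) auto

lemma run_uminus: "run a ts b \<Longrightarrow> run (- a) (map uminus ts) (- b)"
proof (induction ts arbitrary: a)
  case (Cons t ts)
  have "- a + - t = - (a + t)" by simp
  then show ?case using Cons by (simp only: list.map run.simps fr_minus abs_minus_cancel)
qed simp

lemma run_F: "run a ts b \<Longrightarrow> a \<in> F \<Longrightarrow> b \<in> F"
  by (induction ts arbitrary: a) auto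

lemma run_zeros: "a \<in> F \<Longrightarrow> \<forall>t \<in> set ts. t = 0 \<Longrightarrow> run a ts a"
  by (induction ts) (auto simp: F_le_Omega)

text \<open>\<open>run\<close> carries the absence of overflow at every partial sum, so
  \<open>rnd\<close> agrees with \<open>fr\<close> throughout and the extended-float sum is the real
  one.\<close>

lemma run_xadd: "run a ts b \<Longrightarrow> foldl (xadd E M) (Num a) (map Num ts) = Num b"
  by (induction ts arbitrary: a) (auto simp: rnd_fr)

lemma p2_e1_margin: "p2 (e1 - 1) + 4 \<le> p2 e1" "x \<le> p2 e1 + 4 \<Longrightarrow> x \<le> Omega E M"
proof -
  have "p2 3 \<le> p2 (e1 - 1)" using exponent_bounds by (simp del: p2_numeral)
  then have 8: "8 \<le> p2 (e1 - 1)" by simp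
  have 2: "p2 e1 = 2 * p2 (e1 - 1)" using p2_Suc[of "e1 - 1"] by simp
  show "p2 (e1 - 1) + 4 \<le> p2 e1" using 8 2 by linarith
  show "x \<le> p2 e1 + 4 \<Longrightarrow> x \<le> Omega E M" using 8 2 Omega_ge by linarith
qed

lemma Cc_le: "k \<le> 1 - int M \<Longrightarrow> Cc k \<le> 4"
proof -
  assume k: "k \<le> 1 - int M"
  then have "p2 (k + int M) \<le> p2 1" "p2 k \<le> p2 1" using M3' by (simp_all del: p2_1)
  then show ?thesis unfolding Cc_split by simp
qed

lemma run_round_step:
  assumes k: "lo \<le> k" "k \<le> 1 - int M" and v: "\<bar>v\<bar> \<le> p2 (e1 - 1)"
  shows "run v [Cc k, - Cc k] (round_step k v)"
proof -
  have C: "0 < Cc k" "Cc k \<le> 4" using Cc_pos Cc_le k by auto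
  have 1: "\<bar>v + Cc k\<bar> \<le> p2 e1" using v C p2_e1_margin(1) by linarith
  then have "\<bar>fr (v + Cc k)\<bar> \<le> p2 e1" using exponent_bounds by (intro fr_abs_le F_p2) auto
  then have "\<bar>fr (v + Cc k) - Cc k\<bar> \<le> p2 e1 + 4" using C by linarith
  then show ?thesis using 1 p2_e1_margin(2) by (simp add: round_step_def)
qed

text \<open>The grid exponents increase from \<open>lo + 1\<close> to \<open>lo + n\<close>, so each
  step doubles the gap left by the previous one.\<close>

primrec chain :: "nat \<Rightarrow> real list" where
  "chain 0 = []"
| "chain (Suc n) = chain n @ [Cc (lo + int n + 1), - Cc (lo + int n + 1)]"

lemma run_chain:
  assumes "lo + int n \<le> p" "p < e1" "lo + int n \<le> 1 - int M" "\<bar>v\<bar> \<le> p2 p" "v \<in> F"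
  shows "\<exists>v'. run v (chain n) v' \<and> \<bar>v'\<bar> \<le> p2 p \<and> v' \<in> F \<and> (v \<le> 0 \<longrightarrow> v' \<le> 0) \<and>
    (ul \<le> v \<longrightarrow> p2 (lo + int n) \<le> v')"
  using assms
proof (induction n)
  case 0
  then show ?case by (auto simp: ul_def)
next
  case (Suc n)
  then obtain v' where v': "run v (chain n) v'" "\<bar>v'\<bar> \<le> p2 p" "v' \<in> F" "v \<le> 0 \<longrightarrow> v' \<le> 0"
    "ul \<le> v \<longrightarrow> p2 (lo + int n) \<le> v'" by auto
  define k where "k = lo + int n + 1"
  have k: "lo \<le> k" "k \<le> 1 - int M" "k + int M < e1" "k \<le> p" using Suc.prems exponent_bounds by (auto simp: k_def)
  have "p2 p \<le> p2 (e1 - 1)" using Suc.prems by simp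
  then have "run v' [Cc k, - Cc k] (round_step k v')" using v'(2) by (intro run_round_step k) linarith
  then have "run v (chain (Suc n)) (round_step k v')" using v'(1) unfolding chain.simps run_append k_def by blast
  moreover have "\<bar>round_step k v'\<bar> \<le> p2 p" using round_step_bound[OF k(1,3,4)] Suc.prems v' by simp
  moreover have "v \<le> 0 \<longrightarrow> round_step k v' \<le> 0" using round_step_neg[OF k(1,3)] v' by simp
  moreover have "ul \<le> v \<longrightarrow> p2 k \<le> round_step k v'" using round_step_pos[OF k(1,3)] v' p2_Suc[of "lo + int n"] by (simp add: k_def)
  ultimately show ?case by (auto simp: k_def algebra_simps)
qed

text \<open>The 0 occupies the place of the offset in the thresholding sum, so that both kinds of
  layer have sums of the same shape and can share their constant neurons.\<close>

lemma run_chain_st: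
  assumes "kh = lo + int n + 1" "kh \<le> p" "p < e1" "kh \<le> 1 - int M" "\<bar>v\<bar> \<le> p2 p" "v \<in> F"
  shows "\<exists>v'. run v (chain n @ [0, Cc kh, - Cc kh]) v' \<and> \<bar>v'\<bar> \<le> p2 p \<and> v' \<in> F \<and> (v \<le> 0 \<longrightarrow> v' \<le> 0) \<and>
    (ul \<le> v \<longrightarrow> p2 kh \<le> v')"
proof -
  obtain v' where v': "run v (chain n) v'" "\<bar>v'\<bar> \<le> p2 p" "v' \<in> F" "v \<le> 0 \<longrightarrow> v' \<le> 0"
    "ul \<le> v \<longrightarrow> p2 (lo + int n) \<le> v'" using run_chain[of n p v] assms by auto
  have k: "lo \<le> kh" "kh + int M < e1" using assms exponent_bounds by auto
  have "p2 p \<le> p2 (e1 - 1)" using assms by simp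
  then have "run v' [Cc kh, - Cc kh] (round_step kh v')" using v'(2) assms(4) by (intro run_round_step k) linarith+
  then have "run v' [0, Cc kh, - Cc kh] (round_step kh v')" using F_le_Omega[OF v'(3)] v'(3) by simp
  then have "run v (chain n @ [0, Cc kh, - Cc kh]) (round_step kh v')" using v'(1) unfolding run_append by blast
  moreover have "\<bar>round_step kh v'\<bar> \<le> p2 p" using round_step_bound[OF k] assms v' by simp
  moreover have "v \<le> 0 \<longrightarrow> round_step kh v' \<le> 0" using round_step_neg[OF k] v' by simp
  moreover have "ul \<le> v \<longrightarrow> p2 kh \<le> round_step kh v'" using round_step_pos[OF k] v' p2_Suc[of "lo + int n"] assms(1) by simp
  ultimately show ?thesis by auto
qed

text \<open>Write \<open>h\<close> for \<open>p2 kh\<close>. After the chain the value lies in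
  [-h/2, 0] or [h/2, h]. The offset moves these ranges into [-5/4 h, -9/16 h] and [-h/4, 7/16 h].
  Adding \<open>Cc kh\<close> rounds the first range to \<open>Cc kh - h\<close> and the second to
  \<open>Cc kh\<close>, so the final subtraction leaves exactly \<open>- h\<close> or 0.\<close>

lemma run_threshold:
  assumes kh: "kh = lo + int n + 1" "lo + 4 \<le> kh" "kh \<le> 1 - int M"
    and b: "- (3 / 4) * p2 kh \<le> b" "b \<le> - (9 / 16) * p2 kh" and v: "v \<in> F"
  shows "- p2 kh / 2 \<le> v \<Longrightarrow> v \<le> 0 \<Longrightarrow> run v (chain n @ [b, Cc kh, - Cc kh]) (- p2 kh)"
    and "ul \<le> v \<Longrightarrow> v \<le> p2 kh \<Longrightarrow> run v (chain n @ [b, Cc kh, - Cc kh]) 0"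
proof -
  define h where "h = p2 kh"
  define C where "C = Cc kh"
  have hpos: "0 < h" by (simp add: h_def)
  have k: "lo \<le> kh" "kh + int M < e1" using assms exponent_bounds by auto
  have C: "0 < C" "C \<le> 4" "C \<in> F" unfolding C_def using Cc_pos Cc_le Cc_F kh k by auto
  \<comment> \<open>The range ends after adding \<open>b\<close> must be floats, so that rounding
    cannot leave the ranges; \<open>lo + 4 \<le> kh\<close> provides the sixteenths of
    \<open>h\<close>.\<close>
  have sc: "p2 (kh - 2) = h / 4" "p2 (kh - 4) = h / 16"
    unfolding h_def using p2_add[of "kh - 4" 4] p2_add[of "kh - 2" 2] by simp_all
  have "(2::int) ^ 4 \<le> 2 ^ (M + 1)" using M3 by (intro power_increasing) auto
  then have "real_of_int 5 * p2 (kh - 2) \<in> F" "real_of_int 9 * p2 (kh - 4) \<in> F"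
    "real_of_int 7 * p2 (kh - 4) \<in> F" "real_of_int 1 * p2 (kh - 2) \<in> F"
    using kh exponent_bounds F_I[of 5 "kh - 2"] F_I[of 9 "kh - 4"] F_I[of 7 "kh - 4"] F_I[of 1 "kh - 2"] by simp_all
  then have gF: "- (5 / 4 * h) \<in> F" "- (9 / 16 * h) \<in> F" "7 / 16 * h \<in> F" "- (h / 4) \<in> F"
    unfolding F_uminus sc by simp_all
  have h2: "p2 (kh - 1) = h / 2" unfolding h_def using p2_Suc[of "kh - 1"] by simp
  have h1: "h \<le> 1" unfolding h_def using kh(3) M3' p2_le_iff[of kh 0] by simp
  have pk: "p2 (kh + int M) = 2 ^ M * h" unfolding h_def by (simp only: p2_add p2_of_nat mult.commute)
  have "p2 kh \<in> F" "p2 (kh + int M) \<in> F" using k exponent_bounds by (auto intro!: F_p2)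
  then have hF: "h \<in> F" "2 ^ M * h \<in> F" unfolding pk h_def .
  have Ch: "C = 2 ^ M * h + h" unfolding C_def h_def Cc_def by (simp add: algebra_simps)
  have big4: "16 \<le> p2 e1" using exponent_bounds p2_le_iff[of 4 e1] by (simp del: p2_le_iff)
  have Om: "x \<le> Omega E M" if "x \<le> 8" for x using p2_e1_margin(2)[of x] big4 that by linarith
  have fin: "run v (chain n @ [b, Cc kh, - Cc kh]) (fr (y - C))"
    if v': "run v (chain n) v'" "v' \<in> F" "\<bar>v'\<bar> \<le> h" and y: "fr (fr (v' + b) + C) = y" "y \<in> F" "\<bar>y\<bar> \<le> 4"
    and y': "\<bar>fr (v' + b)\<bar> \<le> 4" for v' y
  proof -
    have "\<bar>v' + b\<bar> \<le> Omega E M" using v' b h1 hpos unfolding h_def[symmetric] by (intro Om) linarith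
    moreover have "\<bar>fr (v' + b) + C\<bar> \<le> Omega E M" using y' C by (intro Om) linarith
    moreover have "\<bar>y - C\<bar> \<le> Omega E M" using y C by (intro Om) linarith
    ultimately have "run v' [b, C, - C] (fr (y - C))" using y(1) by simp
    then show ?thesis using v'(1) unfolding run_append C_def by blast
  qed
  show "run v (chain n @ [b, Cc kh, - Cc kh]) (- p2 kh)" if v0: "- p2 kh / 2 \<le> v" "v \<le> 0"
  proof -
    obtain v' where v': "run v (chain n) v'" "\<bar>v'\<bar> \<le> p2 (kh - 1)" "v' \<in> F" "v' \<le> 0"
      using run_chain[of n "kh - 1" v] kh k v0 v h2 exponent_bounds unfolding h_def by auto
    define y where "y = fr (v' + b)"
    have "- (5 / 4 * h) \<le> v' + b" "v' + b \<le> - (9 / 16 * h)"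
      using v'(2,4) b h2 unfolding h_def[symmetric] by linarith+
    then have y: "- (5 / 4 * h) \<le> y" "y \<le> - (9 / 16 * h)" unfolding y_def
      using fr_ge[OF _ gF(1)] fr_le[OF _ gF(2)] by blast+
    have "fr (y + C) = C - h"
    proof (rule antisym)
      define z where "z = fr (y + C)"
      have near: "\<bar>(y + C) - z\<bar> \<le> \<bar>(y + C) - (C - h)\<bar>" unfolding z_def by (rule fr_near) (use Ch hF in simp)
      show "fr (y + C) \<le> C - h"
      proof (rule ccontr)
        assume "\<not> fr (y + C) \<le> C - h"
        then have "p2 (kh + int M) < z" using Ch pk by (simp add: z_def)
        then have "C \<le> z" using Cc_gap(2)[of z kh] k unfolding z_def C_def by simp
        then show False using near y hpos by linarith
      qed
      have "y + C = 2 ^ M * h + (y + h)" using Ch by simp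
      show "C - h \<le> fr (y + C)"
      proof (cases "- h \<le> y")
        case True
        then show ?thesis using Ch hF by (intro fr_ge) auto
      next
        case False
        \<comment> \<open>\<open>Cc kh - h\<close> is a power of two with a finer grid below it. The
          extreme value \<open>- (5 / 4 * h)\<close> produces exactly a tie there, a quarter of
          \<open>h\<close> below, and it is resolved upwards.\<close>
        have "p2 (kh + int M) \<le> fr (p2 (kh + int M) + (y + h))"
        proof (rule fr_p2_down)
          show "e0 < kh + int M" "kh + int M \<le> e1" using kh k by auto
          show "- p2 (kh + int M - int M) / 4 \<le> y + h" using y(1) by (simp add: h_def)
          show "y + h \<le> 0" using False by simp
        qed
        then show ?thesis using Ch pk by (simp add: algebra_simps)
      qed
    qed
    moreover have "C - h \<in> F" using Ch hF by simp
    moreover have "\<bar>C - h\<bar> \<le> 4" using C Ch hpos h1 by (simp add: abs_le_iff)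
    moreover have "\<bar>y\<bar> \<le> 4" using y h1 hpos by linarith
    ultimately have "run v (chain n @ [b, Cc kh, - Cc kh]) (fr (C - h - C))"
      using v' h2 hpos unfolding y_def by (intro fin) auto
    then show ?thesis using hF by (simp add: h_def)
  qed
  show "run v (chain n @ [b, Cc kh, - Cc kh]) 0" if v0: "ul \<le> v" "v \<le> p2 kh"
  proof -
    obtain v' where v': "run v (chain n) v'" "\<bar>v'\<bar> \<le> h" "v' \<in> F" "p2 (kh - 1) \<le> v'"
    proof -
      have kn: "kh - 1 = lo + int n" using kh by simp
      have "\<bar>v\<bar> \<le> p2 kh" using v0 ul_pos(1) by linarith
      then show ?thesis using that run_chain[of n kh v] kh k v0 v exponent_bounds unfolding h_def kn by auto
    qed
    define y where "y = fr (v' + b)"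
    have "- (h / 4) \<le> v' + b" "v' + b \<le> 7 / 16 * h"
      using v'(2,4) b h2 unfolding h_def[symmetric] by linarith+
    then have y: "- (h / 4) \<le> y" "y \<le> 7 / 16 * h" unfolding y_def
      using fr_ge[OF _ gF(4)] fr_le[OF _ gF(3)] by blast+
    have "\<bar>y\<bar> < p2 kh / 2" using y hpos unfolding h_def[symmetric] by linarith
    then have "fr (C + y) = C" unfolding C_def using k by (intro fr_Cc_near) auto
    then have "run v (chain n @ [b, Cc kh, - Cc kh]) (fr (C - C))"
      using v' C y h1 hpos unfolding y_def by (intro fin) (auto simp: add.commute)
    then show ?thesis by simp
  qed
qed

text \<open>The exponent is not confined to the range of the format: a subnormal number also gets a
  full significand, at an exponent below \<open>e0\<close>.\<close>

lemma normalize: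
  assumes "t \<in> F" "t \<noteq> 0"
  obtains m e where "2 ^ M \<le> m" "m < 2 ^ (M + 1)" "\<bar>t\<bar> = real_of_int m * p2 (e - int M)"
    "p2 e \<le> \<bar>t\<bar>" "\<bar>t\<bar> < p2 (e + 1)"
proof -
  have "0 < \<bar>t\<bar>" using assms by simp
  then obtain e where e: "p2 e \<le> \<bar>t\<bar>" "\<bar>t\<bar> < p2 (e + 1)" using p2_between by metis
  have "\<exists>m. t = real_of_int m * p2 (e - int M)"
  proof (cases "e0 \<le> e")
    case True
    then show ?thesis using F_multiple[OF assms(1), of e] e by metis
  next
    case False
    obtain m where "t = real_of_int m * ul" using F_multiple_ul[OF assms(1)] .
    moreover have "ul = real_of_int (2 ^ nat (e0 - e)) * p2 (e - int M)"
      unfolding ul_def using p2_split[of "e - int M" lo] False by simp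
    ultimately have "t = real_of_int (m * 2 ^ nat (e0 - e)) * p2 (e - int M)" by simp
    then show ?thesis by blast
  qed
  then obtain m where m: "t = real_of_int m * p2 (e - int M)" by auto
  then have t: "\<bar>t\<bar> = real_of_int \<bar>m\<bar> * p2 (e - int M)" by (simp add: abs_mult)
  have "p2 e = real_of_int (2 ^ M) * p2 (e - int M)" "p2 (e + 1) = real_of_int (2 ^ (M + 1)) * p2 (e - int M)"
    using p2_add[of "int M" "e - int M"] p2_add[of "int (M + 1)" "e - int M"] p2_of_nat[of M] p2_of_nat[of "M + 1"]
    by (simp_all add: add.commute)
  then have "2 ^ M \<le> \<bar>m\<bar>" "\<bar>m\<bar> < 2 ^ (M + 1)"
    using e unfolding t by (simp_all only: mult_le_cancel_right mult_less_cancel_right p2_pos of_int_le_iff of_int_less_iff simp_thms)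
  then show ?thesis using that t e by blast
qed

text \<open>The exact product only has to come within half a grid step of \<open>Cc k\<close>.
  Rounding the ideal weight to the grid \<open>p2 (k - e - 1)\<close> leaves an error of at most
  \<open>m / 2\<close> units of \<open>p2 (k - 1 - int M)\<close>, which is less than half of
  \<open>p2 k\<close> because \<open>m < 2 ^ (M + 1)\<close>.\<close>

lemma Cc_product:
  assumes t: "t \<in> F" "t \<noteq> 0" "p2 e \<le> \<bar>t\<bar>" "\<bar>t\<bar> < p2 (e + 1)"
    and k: "lo \<le> k" "k \<le> 1 - int M" "e0 + 1 + e \<le> k + int M" "k + int M \<le> e1 + e"
  shows "\<exists>w\<in>F. fr (t * w) = Cc k \<and> \<bar>t * w\<bar> \<le> Omega E M"
proof -
  obtain m e' where m: "2 ^ M \<le> m" "m < 2 ^ (M + 1)" "\<bar>t\<bar> = real_of_int m * p2 (e' - int M)"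
    "p2 e' \<le> \<bar>t\<bar>" "\<bar>t\<bar> < p2 (e' + 1)"
    using normalize[OF t(1,2)] .
  have "p2 e < p2 (e' + 1)" "p2 e' < p2 (e + 1)" using t m by linarith+
  then have e': "e' = e" by simp
  have "\<exists>w\<in>F. \<bar>\<bar>t\<bar> * w - Cc k\<bar> < p2 k / 2"
  \<comment> \<open>For this \<open>m\<close> the quotient \<open>x\<close> used below would be
    \<open>2 ^ (M + 1) + 2\<close>, beyond the significand range; but then an exact weight
    exists.\<close>
  proof (cases "m = 2 ^ M")
    case True
    define w where "w = real_of_int (2 ^ M + 1) * p2 (k - e)"
    have "\<bar>(2::int) ^ M + 1\<bar> < 2 ^ (M + 1)" using power_increasing[of 1 M "2::int"] M3 by simp
    then have "w \<in> F" unfolding w_def using k F_rep[of "2 ^ M + 1" "k - e + int M"] by simp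
    moreover have "\<bar>t\<bar> * w = Cc k"
      using m(3) True unfolding e' w_def Cc_def by (simp add: p2_diff p2_of_nat field_simps)
    ultimately show ?thesis by (intro bexI[of _ w]) auto
  next
    case False
    then have m1: "2 ^ M + 1 \<le> m" using m by simp
    define x where "x = real_of_int ((2 ^ M + 1) * 2 ^ (M + 1)) / real_of_int m"
    define n where "n = round x"
    have "0 < m" using m1 zero_le_power[of "2::int" M] by linarith
    then have mpos: "0 < real_of_int m" by simp
    have x0: "0 \<le> x" unfolding x_def using mpos by (intro divide_nonneg_pos) auto
    have "real_of_int ((2 ^ M + 1) * 2 ^ (M + 1)) \<le> real_of_int (m * 2 ^ (M + 1))"
      using m1 by (intro of_int_le_iff[THEN iffD2] mult_right_mono) auto
    then have x1: "x \<le> real_of_int (2 ^ (M + 1))" unfolding x_def using mpos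
      by (simp add: pos_divide_le_eq mult.commute)
    have n: "0 \<le> n" "n \<le> 2 ^ (M + 1)"
      using round_mono[OF x0] round_mono[OF x1] unfolding n_def by (simp_all only: round_0 round_of_int)
    define w where "w = real_of_int n * p2 (k - e - 1)"
    have "w \<in> F" unfolding w_def using n k by (intro F_I) auto
    moreover have "\<bar>\<bar>t\<bar> * w - Cc k\<bar> < p2 k / 2"
    proof -
      have d: "\<bar>real_of_int n - x\<bar> \<le> 1 / 2" unfolding n_def by (rule of_int_round_abs_le)
      define u where "u = p2 (k - 1 - int M)"
      have upos: "0 < u" by (simp add: u_def)
      have "p2 (e - int M) * p2 (k - e - 1) = u" unfolding u_def by (simp flip: p2_add add: algebra_simps)
      then have tw: "\<bar>t\<bar> * w = real_of_int m * real_of_int n * u" unfolding m(3) e' w_def by (simp add: algebra_simps)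
      have k2: "p2 k = 2 ^ (M + 1) * u" unfolding u_def
        using p2_add[of "int (M + 1)" "k - 1 - int M"] p2_of_nat[of "M + 1"] by simp
      have Cx: "Cc k = real_of_int m * x * u" unfolding Cc_def k2 x_def using mpos by simp
      have "\<bar>t\<bar> * w - Cc k = (real_of_int n - x) * (real_of_int m * u)" unfolding tw Cx by (simp add: algebra_simps)
      then have "\<bar>\<bar>t\<bar> * w - Cc k\<bar> = \<bar>real_of_int n - x\<bar> * (real_of_int m * u)" using mpos upos by (simp add: abs_mult)
      also have "\<dots> \<le> 1 / 2 * (real_of_int m * u)" using d mpos upos by (intro mult_right_mono) auto
      also have "\<dots> < 1 / 2 * p2 k"
      proof -
        have "real_of_int m < real_of_int (2 ^ (M + 1))" using m(2) by (simp only: of_int_less_iff)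
        then show ?thesis unfolding k2 using upos by simp
      qed
      finally show ?thesis by simp
    qed
    ultimately show ?thesis by auto
  qed
  then obtain w where w: "w \<in> F" "\<bar>\<bar>t\<bar> * w - Cc k\<bar> < p2 k / 2" by auto
  have kM: "k + int M < e1" using k exponent_bounds by simp
  have fw: "fr (\<bar>t\<bar> * w) = Cc k" using fr_Cc_near[OF k(1) kM w(2)] by simp
  have "p2 k \<le> p2 0" using k(2) M3' by (simp del: p2_0)
  moreover have "0 < Cc k" "Cc k \<le> 4" using Cc_pos Cc_le k by auto
  ultimately have "\<bar>\<bar>t\<bar> * w\<bar> \<le> 5" using w(2) p2_0 by linarith
  moreover have "p2 0 \<le> p2 e1" using exponent_bounds by (simp del: p2_0)
  ultimately have "\<bar>\<bar>t\<bar> * w\<bar> \<le> Omega E M" using p2_0 by (intro p2_e1_margin(2)) linarith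
  then show ?thesis
    using w fw by (cases "0 \<le> t") (auto intro: bexI[of _ w] bexI[of _ "- w"])
qed

end

section \<open>Scaling the output of the activation function\<close>

text \<open>The sign \<open>sg\<close> reduces the case of an activation decreasing at \<open>\<eta>\<close> to the increasing case.\<close>
locale act = fp +
  fixes \<sigma> :: "xfloat \<Rightarrow> xfloat" and c2 s2 \<eta> \<eta>p s s' lam sg :: real
  assumes sigF: "x \<in> F \<Longrightarrow> \<sigma> (Num x) = Num t \<Longrightarrow> t \<in> F"
    and c2: "c2 \<in> F" "\<sigma> (Num c2) = Num s2" "p2 (- int M - 2) \<le> \<bar>s2\<bar>" "\<bar>s2\<bar> < 2"
    and eta: "\<eta> \<in> F" "\<eta>p \<in> F" "\<eta> < \<eta>p" "\<forall>z\<in>F. \<not> (\<eta> < z \<and> z < \<eta>p)" "\<bar>\<eta>\<bar> < 4" "p2 (e0 + 5) \<le> \<bar>\<eta>\<bar>"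
    and s: "\<sigma> (Num \<eta>) = Num s" "\<sigma> (Num \<eta>p) = Num s'" "p2 (e0 + 5) \<le> \<bar>s\<bar>"
      "\<bar>s\<bar> \<le> p2 (e1 - 6) * \<bar>\<eta>\<bar>" "\<bar>s'\<bar> \<le> p2 (e1 - 6) * \<bar>\<eta>\<bar>"
    and sg: "sg = 1 \<or> sg = -1" "sg * s < sg * s'"
    and lam: "0 \<le> lam" "lam \<le> p2 (e1 - 7) * \<bar>s\<bar>" "lam \<le> p2 (e1 - 7) * p2 (int M + 3)"
    and left: "x \<in> F \<Longrightarrow> x \<le> \<eta> \<Longrightarrow> \<exists>t. \<sigma> (Num x) = Num t \<and> sg * t \<le> sg * s \<and> sg * s - lam * (\<eta> - x) \<le> sg * t"
    and right: "x \<in> F \<Longrightarrow> \<eta>p \<le> x \<Longrightarrow> \<exists>t. \<sigma> (Num x) = Num t \<and> sg * s' \<le> sg * t \<and> sg * t \<le> sg * s' + lam * (x - \<eta>p)"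
begin

lemma F_small:
  assumes "\<bar>m\<bar> \<le> 8" "lo \<le> k" "k \<le> e1 - 3" shows "real_of_int m * p2 k \<in> F"
proof (cases "k + int M < e1")
  case True
  have "(2::int) ^ 3 \<le> 2 ^ (M + 1)" using M3 by (intro power_increasing) auto
  then show ?thesis using assms True by (intro F_I) auto
next
  case False
  have "p2 k = real_of_int (2 ^ (M - 3)) * p2 (k + 3 - int M)"
    using p2_split[of "k + 3 - int M" k] M3 by (simp add: nat_diff_distrib)
  then have eq: "real_of_int m * p2 k = real_of_int (m * 2 ^ (M - 3)) * p2 (k + 3 - int M)" by simp
  have "(2::int) ^ M = 8 * 2 ^ (M - 3)" using M3 power_add[of "2::int" 3 "M - 3"] by simp
  then have "\<bar>m * 2 ^ (M - 3)\<bar> \<le> 2 ^ M" using assms(1) by (simp add: abs_mult mult_right_mono)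
  then have "\<bar>m * 2 ^ (M - 3)\<bar> < 2 ^ (M + 1)" using zero_less_power[of "2::int" M] by (simp del: zero_less_power)
  then show ?thesis unfolding eq using assms False exponent_bounds by (intro F_rep) auto
qed

text \<open>The lower bound on \<open>\<bar>\<eta>\<bar>\<close> leaves room for four binary digits
  below the grid width. The bound 4 limits the width: on a coarser grid a step of
  \<open>p2 (1 - int M)\<close> would lead to a float strictly between \<eta> and its
  successor.\<close>

lemma eta_rep:
  obtains m kh where "\<eta> = real_of_int m * p2 kh" "\<eta>p = real_of_int (m + 1) * p2 kh"
    "\<bar>m\<bar> \<le> 2 ^ (M + 1)" "\<bar>m + 1\<bar> \<le> 2 ^ (M + 1)" "lo + 4 \<le> kh" "kh \<le> 1 - int M"
proof -
  obtain m k where mk_layer: "\<eta> = real_of_int m * p2 k" "\<eta>p = real_of_int (m + 1) * p2 k"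
    "\<bar>m\<bar> \<le> 2 ^ (M + 1)" "\<bar>m + 1\<bar> \<le> 2 ^ (M + 1)" "lo \<le> k" "k \<le> e1 - int M"
    using adjacent[OF eta(1-4)] .
  have "real_of_int \<bar>m\<bar> \<le> real_of_int (2 ^ (M + 1))" using mk_layer(3) by (simp only: of_int_le_iff)
  then have "\<bar>\<eta>\<bar> \<le> real_of_int (2 ^ (M + 1)) * p2 k" unfolding mk_layer(1) by (simp add: abs_mult)
  also have "\<dots> = p2 (k + int M + 1)"
    using p2_add[of "int (M + 1)" k] p2_of_nat[of "M + 1"] by (simp add: algebra_simps)
  finally have "p2 (e0 + 5) \<le> p2 (k + int M + 1)" using eta(6) by linarith
  then have k4: "lo + 4 \<le> k" by simp
  have "k \<le> 1 - int M"
  proof (rule ccontr)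
    assume "\<not> k \<le> 1 - int M"
    then have k: "1 - int M < k" by simp
    then have ks: "p2 k = real_of_int (2 ^ nat (k - (1 - int M))) * p2 (1 - int M)" by (intro p2_split) auto
    define j where "j = m * 2 ^ nat (k - (1 - int M))"
    have ej: "\<eta> = real_of_int j * p2 (1 - int M)" unfolding j_def mk_layer(1) ks by simp
    have "\<bar>real_of_int j\<bar> < 2 ^ (M + 1)"
    proof -
      have p: "p2 (1 - int M) * 2 ^ (M + 1) = 4"
        using p2_add[of "1 - int M" "int (M + 1)"] p2_of_nat[of "M + 1"] by simp
      have "\<bar>real_of_int j\<bar> * p2 (1 - int M) < 2 ^ (M + 1) * p2 (1 - int M)"
      proof -
        have "\<bar>\<eta>\<bar> = \<bar>real_of_int j\<bar> * p2 (1 - int M)" unfolding ej by (simp add: abs_mult)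
        moreover have "2 ^ (M + 1) * p2 (1 - int M) = 4" using p by (simp only: mult.commute)
        ultimately show ?thesis using eta(5) by linarith
      qed
      then show ?thesis by (rule mult_right_less_imp_less) simp
    qed
    then have "\<bar>j\<bar> < 2 ^ (M + 1)" by (metis of_int_abs of_int_less_iff of_int_numeral of_int_power)
    then have "real_of_int (j + 1) * p2 (1 - int M) \<in> F" using exponent_bounds by (intro F_I) auto
    moreover have "real_of_int (j + 1) * p2 (1 - int M) = \<eta> + p2 (1 - int M)" unfolding ej by (simp add: algebra_simps)
    moreover have "\<eta>p = \<eta> + p2 k" unfolding mk_layer by (simp add: algebra_simps)
    moreover have "p2 (1 - int M) < p2 k" using k by simp
    ultimately show False using eta(4) by force
  qed
  then show ?thesis using that mk_layer k4 by blast
qed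

definition kh :: int where "kh = (SOME k. \<eta>p - \<eta> = p2 k)"
definition h :: real where "h = p2 kh"
definition mh :: int where "mh = \<lfloor>\<eta> / h\<rfloor>"

lemma kh: "\<eta> = real_of_int mh * h" "\<eta>p = real_of_int (mh + 1) * h" "\<eta>p = \<eta> + h"
  "\<bar>mh\<bar> \<le> 2 ^ (M + 1)" "\<bar>mh + 1\<bar> \<le> 2 ^ (M + 1)" "lo + 4 \<le> kh" "kh \<le> 1 - int M"
proof -
  obtain m k where mk_layer: "\<eta> = real_of_int m * p2 k" "\<eta>p = real_of_int (m + 1) * p2 k"
    "\<bar>m\<bar> \<le> 2 ^ (M + 1)" "\<bar>m + 1\<bar> \<le> 2 ^ (M + 1)" "lo + 4 \<le> k" "k \<le> 1 - int M"
    using eta_rep .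
  have d: "\<eta>p - \<eta> = p2 k" unfolding mk_layer by (simp add: algebra_simps)
  then have "\<eta>p - \<eta> = p2 kh" unfolding kh_def by (rule someI)
  then have k: "kh = k" using d by simp
  have hk: "h = p2 k" by (simp only: h_def k)
  have "\<eta> / h = real_of_int m" using mk_layer(1) hk p2_pos(3)[of k] by (metis nonzero_mult_div_cancel_right)
  then have m: "mh = m" unfolding mh_def by simp
  show "\<eta> = real_of_int mh * h" "\<eta>p = real_of_int (mh + 1) * h"
    "\<bar>mh\<bar> \<le> 2 ^ (M + 1)" "\<bar>mh + 1\<bar> \<le> 2 ^ (M + 1)" "lo + 4 \<le> kh" "kh \<le> 1 - int M"
    unfolding m hk k by (fact mk_layer)+
  show "\<eta>p = \<eta> + h" using d hk by linarith
qed

lemma h_pos: "0 < h" "0 \<le> h" by (auto simp: h_def)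

lemma h_le: "h \<le> 1" "16 * ul \<le> h"
proof -
  show "h \<le> 1" using kh(7) M3' p2_le_iff[of kh 0] unfolding h_def by simp
  have "p2 (lo + 4) \<le> h" using kh(6) unfolding h_def by simp
  then show "16 * ul \<le> h" using p2_add[of lo 4] by (simp add: ul_def)
qed

lemma eta_le: "\<bar>\<eta>\<bar> \<le> p2 (int M + 1) * h" "\<bar>\<eta>\<bar> \<le> 4" "\<bar>\<eta>p\<bar> \<le> 5"
proof -
  have "real_of_int \<bar>mh\<bar> \<le> real_of_int (2 ^ (M + 1))" using kh(4) by (simp only: of_int_le_iff)
  then have "\<bar>real_of_int mh * h\<bar> \<le> p2 (int M + 1) * h"
    using h_pos p2_of_nat[of "M + 1"] by (simp add: abs_mult add.commute)
  moreover have "\<bar>\<eta>\<bar> = \<bar>real_of_int mh * h\<bar>" by (rule arg_cong[OF kh(1)])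
  ultimately show "\<bar>\<eta>\<bar> \<le> p2 (int M + 1) * h" by linarith
  show "\<bar>\<eta>\<bar> \<le> 4" "\<bar>\<eta>p\<bar> \<le> 5" using eta(5) kh(3) h_le(1) h_pos by linarith+
qed

lemma s_F: "s \<in> F" "s' \<in> F" "s2 \<in> F"
  using sigF eta s c2 by auto

lemma sg_cases: "sg * sg = 1" "\<bar>sg\<bar> = 1" "sg \<in> F" "x \<in> F \<Longrightarrow> sg * x \<in> F"
  using sg(1) F_p2[of 0] exponent_bounds by auto

definition S :: real where "S = sg * s"
definition S' :: real where "S' = sg * s'"

lemma S_F: "S \<in> F" "S' \<in> F" and S_less: "S < S'" and abs_S: "\<bar>S\<bar> = \<bar>s\<bar>" "\<bar>S'\<bar> = \<bar>s'\<bar>"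
  unfolding S_def S'_def using s_F sg sg_cases by (auto simp: abs_mult)

text \<open>Distinct floats have a minimal relative distance. The grid one binade below
  \<open>S\<close> is used because \<open>S'\<close> may be smaller in magnitude; if it is smaller
  than that binade, the gap exceeds \<open>p2 (e - 1)\<close>.\<close>

lemma gap_lower: "\<bar>S\<bar> \<le> p2 (int M + 2) * (S' - S)"
proof -
  have "0 < \<bar>S\<bar>" using s(3) abs_S p2_pos(1)[of "e0 + 5"] by linarith
  then have "S \<noteq> 0" by simp
  then obtain m e where m: "2 ^ M \<le> m" "m < 2 ^ (M + 1)" "\<bar>S\<bar> = real_of_int m * p2 (e - int M)"
    "p2 e \<le> \<bar>S\<bar>" "\<bar>S\<bar> < p2 (e + 1)"
    using normalize[OF S_F(1)] by metis
  have "p2 (e0 + 5) < p2 (e + 1)" using s(3) abs_S m(5) by linarith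
  then have e: "e0 \<le> e - 1" by simp
  have ee: "p2 e = 2 * p2 (e - 1)" using p2_Suc[of "e - 1"] by simp
  have "p2 (e - 1 - int M) \<le> S' - S"
  proof (cases "p2 (e - 1) \<le> \<bar>S'\<bar>")
    case True
    obtain a where a: "S' = real_of_int a * p2 (e - 1 - int M)" using F_multiple[OF S_F(2)] True by metis
    have "p2 (e - 1) \<le> \<bar>S\<bar>" using m(4) ee p2_pos(2)[of "e - 1"] by linarith
    then obtain b where b: "S = real_of_int b * p2 (e - 1 - int M)" using F_multiple[OF S_F(1)] by metis
    have "b < a" using S_less unfolding a b by simp
    then have "1 \<le> real_of_int (a - b)" by simp
    then have "1 * p2 (e - 1 - int M) \<le> real_of_int (a - b) * p2 (e - 1 - int M)" by (intro mult_right_mono) auto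
    then show ?thesis unfolding a b by (simp add: algebra_simps)
  next
    case False
    have "p2 (e - 1 - int M) \<le> p2 (e - 1)" by simp
    then show ?thesis using False m(4) ee S_less by linarith
  qed
  then have "p2 (int M + 2) * p2 (e - 1 - int M) \<le> p2 (int M + 2) * (S' - S)" by (intro mult_left_mono) auto
  moreover have "p2 (int M + 2) * p2 (e - 1 - int M) = p2 (e + 1)" by (simp flip: p2_add)
  ultimately show ?thesis using m(5) by linarith
qed

text \<open>For a gap above 1 the least scale \<open>p2 lo\<close> works: the bounds on
  \<open>s\<close>, \<open>s'\<close> relative to \<eta> and the bound on \<open>lam\<close> by
  \<open>p2 (int M + 3)\<close> make all exponents add up to -3. Otherwise the least power of two
  lifting the gap above \<open>ul\<close> is taken, so the scaled gap is at most
  \<open>2 * ul\<close>; here \<open>lam\<close> is controlled through \<open>\<bar>s\<bar>\<close>,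
  which the relative gap bounds. The two members of the minimum in (C3) thus belong to the two
  regimes.\<close>

lemma scale_exists: "\<exists>k. lo \<le> k \<and> k \<le> 0 \<and> ul < (S' - S) * p2 k \<and> (S' - S) * p2 k + ul \<le> 3 / 16 * h \<and> lam * p2 k \<le> 1 / 8"
proof (cases "1 < S' - S")
  case True
  have "\<bar>S' - S\<bar> \<le> p2 (e1 - 5) * \<bar>\<eta>\<bar>"
  proof -
    have "p2 (e1 - 5) * \<bar>\<eta>\<bar> = 2 * (p2 (e1 - 6) * \<bar>\<eta>\<bar>)" using p2_Suc[of "e1 - 6"] by simp
    then show ?thesis using s(4,5) abs_S by linarith
  qed
  also have "\<dots> \<le> p2 (e1 - 5) * (p2 (int M + 1) * h)" using eta_le(1) by (intro mult_left_mono) auto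
  finally have "(S' - S) * p2 lo \<le> p2 (e1 - 5) * (p2 (int M + 1) * h) * p2 lo"
    by (intro mult_right_mono) auto
  also have "\<dots> = p2 (e1 - 5 + (int M + 1) + lo) * h" by (simp only: p2_add mult.assoc mult.commute mult.left_commute)
  also have "e1 - 5 + (int M + 1) + lo = -3" using exponent_bounds by simp
  finally have 1: "(S' - S) * p2 lo \<le> h / 8" using p2_minus[of 3] by simp
  have "lam * p2 lo \<le> p2 (e1 - 7) * p2 (int M + 3) * p2 lo" using lam(3) by (intro mult_right_mono) auto
  also have "\<dots> = p2 (e1 - 7 + (int M + 3) + lo)" by (simp only: p2_add)
  also have "e1 - 7 + (int M + 3) + lo = -3" using exponent_bounds by simp
  finally have 2: "lam * p2 lo \<le> 1 / 8" using p2_minus[of 3] by simp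
  have 3: "ul < (S' - S) * p2 lo" using True by (simp add: ul_def)
  show ?thesis using 1 2 3 h_le exponent_bounds by (intro exI[of _ lo]) auto
next
  case False
  define D where "D = S' - S"
  have D: "0 < D" "D \<le> 1" using False S_less by (auto simp: D_def)
  obtain e where e: "p2 e \<le> ul / D" "ul / D < p2 (e + 1)" using p2_between[of "ul / D"] D by auto
  have e': "p2 e * D \<le> ul" "ul < p2 (e + 1) * D" using e D by (auto simp: pos_le_divide_eq pos_divide_less_eq)
  have g: "\<bar>S\<bar> \<le> p2 (int M + 2) * D" using gap_lower by (simp add: D_def)
  have "p2 (lo + 1) < p2 (e + 1 + 1)"
  proof -
    have "p2 lo = ul" by (simp add: ul_def)
    also have "ul < p2 (e + 1) * D" by (rule e')
    also have "\<dots> \<le> p2 (e + 1) * 1" using D by (intro mult_left_mono) auto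
    finally show ?thesis by simp
  qed
  then have elo: "lo \<le> e + 1" by simp
  have "p2 (e0 + 5) \<le> p2 (int M + 2) * D" using g s(3) abs_S by linarith
  then have "p2 (e0 + 5) * p2 (- (int M + 2)) \<le> p2 (int M + 2) * D * p2 (- (int M + 2))"
    by (intro mult_right_mono) auto
  also have "\<dots> = D" using p2_add[of "int M + 2" "- (int M + 2)"] by simp
  finally have "p2 (e0 + 5) * p2 (- (int M + 2)) \<le> D" .
  moreover have "p2 (e0 + 5) * p2 (- (int M + 2)) = p2 (lo + 3)" by (simp flip: p2_add add: algebra_simps)
  ultimately have D8: "p2 (lo + 3) \<le> D" by simp
  have "p2 e * p2 (lo + 3) \<le> p2 lo"
  proof -
    have "p2 e * p2 (lo + 3) \<le> p2 e * D" using D8 by (intro mult_left_mono) auto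
    then show ?thesis using e'(1) unfolding ul_def by (rule order_trans)
  qed
  then have "p2 (e + (lo + 3)) \<le> p2 lo" by (simp only: p2_add)
  then have e3: "e \<le> -3" by simp
  have "D * p2 (e + 1) \<le> 2 * ul" using e'(1) by (simp add: p2_Suc mult.commute)
  then have 1: "D * p2 (e + 1) + ul \<le> 3 / 16 * h" using h_le by linarith
  have "lam * p2 (e + 1) \<le> p2 (e1 - 7) * (p2 (int M + 2) * D) * p2 (e + 1)"
  proof (intro mult_right_mono)
    have "p2 (e1 - 7) * \<bar>s\<bar> \<le> p2 (e1 - 7) * (p2 (int M + 2) * D)" using g abs_S by (intro mult_left_mono) auto
    then show "lam \<le> p2 (e1 - 7) * (p2 (int M + 2) * D)" using lam(2) by linarith
  qed auto
  also have "\<dots> = p2 (e1 - 7 + (int M + 2)) * (D * p2 (e + 1))" by (simp only: p2_add mult.assoc)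
  also have "\<dots> \<le> p2 (e1 - 7 + (int M + 2)) * (2 * ul)"
    using \<open>D * p2 (e + 1) \<le> 2 * ul\<close> by (intro mult_left_mono) auto
  also have "2 * ul = p2 (lo + 1)" by (simp only: ul_def p2_Suc)
  also have "p2 (e1 - 7 + (int M + 2)) * p2 (lo + 1) = p2 (e1 - 7 + (int M + 2) + (lo + 1))"
    by (simp only: p2_add)
  also have "e1 - 7 + (int M + 2) + (lo + 1) = -3" using exponent_bounds by simp
  finally have 2: "lam * p2 (e + 1) \<le> 1 / 8" using p2_minus[of 3] by simp
  show ?thesis using 1 2 e'(2) elo e3 by (intro exI[of _ "e + 1"]) (auto simp: D_def mult.commute)
qed

text \<open>The scale \<open>w\<close> is small enough to tame the Lipschitz constant and large enough that \<open>\<sigma>(\<eta>)\<close> and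
  \<open>\<sigma>(\<eta>\<^sup>+)\<close> still differ after scaling.\<close>
definition kw :: int where
  "kw = (SOME k. lo \<le> k \<and> k \<le> 0 \<and> ul < (S' - S) * p2 k \<and> (S' - S) * p2 k + ul \<le> 3 / 16 * h \<and> lam * p2 k \<le> 1 / 8)"
definition w :: real where "w = p2 kw"

lemma kw: "lo \<le> kw" "kw \<le> 0" "ul < (S' - S) * w" "(S' - S) * w + ul \<le> 3 / 16 * h" "lam * w \<le> 1 / 8"
  using someI_ex[OF scale_exists] unfolding kw_def[symmetric] w_def by auto

lemma w_F: "w \<in> F" "0 < w" "w \<le> 1" "- w \<in> F" "sg * w \<in> F" "- (sg * w) \<in> F"
proof -
  show "w \<in> F" "- w \<in> F" unfolding w_def using kw exponent_bounds F_p2[of kw] by auto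
  then show "sg * w \<in> F" "- (sg * w) \<in> F" using sg_cases by auto
  show "0 < w" "w \<le> 1" unfolding w_def using kw(2) p2_le_iff[of kw 0] by auto
qed

text \<open>Multiplication by a power of two only shifts the exponent, so it is exact unless the
  product is at most \<open>p2 (e0 + 1)\<close> in magnitude, where the grid width is
  \<open>ul\<close>.\<close>

lemma fr_scale:
  assumes "u \<in> F" shows "\<bar>fr (u * w) - u * w\<bar> \<le> ul / 2"
proof (cases "\<bar>u * w\<bar> \<le> p2 (e0 + 1)")
  case True
  then show ?thesis using fr_err[of "u * w" e0] exponent_bounds by (simp add: ul_def)
next
  case False
  then have "u \<noteq> 0" by auto
  then obtain m e where m: "2 ^ M \<le> m" "m < 2 ^ (M + 1)" "\<bar>u\<bar> = real_of_int m * p2 (e - int M)"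
    "p2 e \<le> \<bar>u\<bar>" "\<bar>u\<bar> < p2 (e + 1)"
    using normalize[OF assms] by metis
  have uw: "\<bar>u * w\<bar> = \<bar>u\<bar> * p2 kw" by (simp add: abs_mult w_def)
  have "\<bar>u * w\<bar> < p2 (e + 1) * p2 kw" unfolding uw using m(5) by (intro mult_strict_right_mono) auto
  then have "p2 (e0 + 1) < p2 (e + 1 + kw)" using False p2_add[of "e + 1" kw] by linarith
  then have 1: "e0 \<le> e + kw" by simp
  have "p2 e < p2 (e1 + 1)" using m(4) F_le_max[OF assms] by linarith
  then have 2: "e + kw \<le> e1" using kw(2) by simp
  have "2 ^ M \<le> \<bar>m\<bar>" "\<bar>m\<bar> < 2 ^ (M + 1)" using m zero_le_power[of "2::int" M] by auto
  have "real_of_int m * p2 (e + kw - int M) \<in> F" using \<open>\<bar>m\<bar> < 2 ^ (M + 1)\<close> 1 2 by (intro F_rep)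
  moreover have "real_of_int m * p2 (e + kw - int M) = \<bar>u * w\<bar>"
    unfolding uw m(3) using p2_add[of "e - int M" kw] by (simp add: algebra_simps)
  ultimately have "\<bar>u * w\<bar> \<in> F" by simp
  then have "u * w \<in> F" by (cases "0 \<le> u * w") auto
  then show ?thesis by simp
qed

lemma scale_Omega: assumes "u \<in> F" shows "\<bar>u * w\<bar> \<le> Omega E M"
proof -
  have "\<bar>u * w\<bar> \<le> \<bar>u\<bar> * 1" unfolding abs_mult using w_F by (intro mult_left_mono) auto
  then show ?thesis using F_le_Omega[OF assms] by linarith
qed

definition B :: real where "B = fr (S * w)"
definition A :: real where "A = fr (S' * w)"

text \<open>The exact scaled gap exceeds \<open>ul\<close> and the two roundings lose at most
  \<open>ul / 2\<close> each, so the rounded values remain distinct.\<close>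

lemma AB: "B + ul \<le> A" "A - B \<le> 3 / 16 * h" "A \<in> F" "B \<in> F"
proof -
  have a: "\<bar>B - S * w\<bar> \<le> ul / 2" "\<bar>A - S' * w\<bar> \<le> ul / 2" unfolding A_def B_def using fr_scale S_F by auto
  have k: "ul < S' * w - S * w" "S' * w - S * w + ul \<le> 3 / 16 * h" using kw by (auto simp: algebra_simps)
  show "A \<in> F" "B \<in> F" by (auto simp: A_def B_def)
  moreover have "B < A" using a k by linarith
  ultimately show "B + ul \<le> A" by (intro F_less_ul)
  show "A - B \<le> 3 / 16 * h" using a k by linarith
qed

text \<open>Truth values after the activation, oriented by \<open>sg\<close>. \<open>R\<close>
  measures the deviation before the activation; for \<open>R = 0\<close> only \<open>S\<close> and
  \<open>S'\<close> remain.\<close>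

definition near :: "real \<Rightarrow> bool \<Rightarrow> real \<Rightarrow> bool" where
  "near R b U \<longleftrightarrow> (if b then S' \<le> U \<and> U \<le> S' + lam * R else S - lam * R \<le> U \<and> U \<le> S)"

lemma p2_e1_big: "16 \<le> p2 (e1 - 1)" "p2 e1 = 2 * p2 (e1 - 1)"
proof -
  have "p2 4 \<le> p2 (e1 - 1)" using exponent_bounds by (simp del: p2_numeral)
  then show "16 \<le> p2 (e1 - 1)" by simp
  show "p2 e1 = 2 * p2 (e1 - 1)" using p2_Suc[of "e1 - 1"] by simp
qed

text \<open>\<open>lam * w \<le> 1 / 8\<close> turns a deviation \<open>R\<close> into at most
  \<open>R / 8\<close>. The outer bounds are stated against floats \<open>P\<close> because rounding
  respects those without loss.\<close>

lemma run_literal: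
  assumes U: "U \<in> F" "near R b U" and R: "0 \<le> R" "R \<le> p2 (e1 + 1)"
  shows "\<exists>v\<in>F. run 0 [fr (U * w), - B] v \<and>
    (if b then ul \<le> v \<and> (\<forall>P\<in>F. 3 / 16 * h + R / 8 \<le> P \<longrightarrow> v \<le> P)
     else v \<le> 0 \<and> (\<forall>P\<in>F. R / 8 + ul \<le> P \<longrightarrow> - P \<le> v))"
proof -
  have lR: "lam * R * w \<le> R / 8" using mult_right_mono[OF kw(5) R(1)] by (simp add: algebra_simps)
  have a: "\<bar>fr (U * w) - U * w\<bar> \<le> ul / 2" "\<bar>B - S * w\<bar> \<le> ul / 2"
    unfolding B_def using fr_scale U S_F by auto
  have k: "S' * w - S * w + ul \<le> 3 / 16 * h" using kw by (auto simp: algebra_simps)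
  define d where "d = fr (U * w) - B"
  have d: "if b then ul \<le> d \<and> d \<le> 3 / 16 * h + R / 8 else d \<le> 0 \<and> - (R / 8 + ul) \<le> d"
  proof (cases b)
    case True
    then have "S' * w \<le> U * w" "U * w \<le> (S' + lam * R) * w"
      using U(2) w_F by (auto simp: near_def intro!: mult_right_mono)
    then have "A \<le> fr (U * w)" "U * w \<le> S' * w + lam * R * w"
      unfolding A_def by (auto intro: fr_mono simp: algebra_simps)
    then show ?thesis using True AB(1) a k lR unfolding d_def by (auto; linarith)
  next
    case False
    then have "U * w \<le> S * w" "(S - lam * R) * w \<le> U * w"
      using U(2) w_F by (auto simp: near_def intro!: mult_right_mono)
    then have "fr (U * w) \<le> B" "S * w - lam * R * w \<le> U * w"
      unfolding B_def by (auto intro: fr_mono simp: algebra_simps)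
    then show ?thesis using False a lR unfolding d_def by (auto; linarith)
  qed
  have "\<bar>d\<bar> \<le> p2 e1"
  proof -
    have "p2 (e1 + 1) = 4 * p2 (e1 - 1)" using p2_Suc[of e1] p2_e1_big by simp
    moreover have "- (R / 8 + 1) \<le> d" "d \<le> R / 8 + 1"
      using d R h_le h_pos ul_pos by (cases b; simp; linarith)+
    ultimately show ?thesis using R p2_e1_big by linarith
  qed
  then have "\<bar>d\<bar> \<le> Omega E M" using p2_e1_margin(2) by simp
  then have "run 0 [fr (U * w), - B] (fr d)" by (simp add: F_le_Omega d_def)
  moreover have "fr d \<in> F" by simp
  moreover have "if b then ul \<le> fr d \<and> (\<forall>P\<in>F. 3 / 16 * h + R / 8 \<le> P \<longrightarrow> fr d \<le> P)
     else fr d \<le> 0 \<and> (\<forall>P\<in>F. R / 8 + ul \<le> P \<longrightarrow> - P \<le> fr d)"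
  proof -
    have ulF: "ul \<in> F" unfolding ul_def using exponent_bounds by (intro F_p2) auto
    show ?thesis using d by (auto intro!: fr_le fr_ge ulF simp: F_uminus split: if_splits)
  qed
  ultimately show ?thesis by blast
qed

end

section \<open>Threshold gates\<close>

context act
begin

lemma scaled_h_F: "real_of_int m * p2 (kh - 4) \<in> F" if "\<bar>m\<bar> \<le> 16"
proof -
  have "(2::int) ^ 4 \<le> 2 ^ (M + 1)" using M3 by (intro power_increasing) auto
  then show ?thesis using that kh(6,7) exponent_bounds by (intro F_I) auto
qed

lemma h_F: "h \<in> F" "- h \<in> F" "h / 2 \<in> F" "3 / 16 * h \<in> F" "3 / 8 * h \<in> F" "9 / 16 * h \<in> F"
proof -
  have e: "p2 (kh - 4) = h / 16" unfolding h_def using p2_add[of "kh - 4" 4] by simp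
  show "h \<in> F" "h / 2 \<in> F" "3 / 16 * h \<in> F" "3 / 8 * h \<in> F" "9 / 16 * h \<in> F"
    using scaled_h_F[of 16] scaled_h_F[of 8] scaled_h_F[of 3] scaled_h_F[of 6] scaled_h_F[of 9]
    unfolding e by simp_all
  then show "- h \<in> F" by simp
qed

lemma ul_F: "ul \<in> F" unfolding ul_def using exponent_bounds by (intro F_p2) auto

lemma Omega_8: "x \<le> 8 \<Longrightarrow> x \<le> Omega E M"
  using p2_e1_margin(2)[of x] p2_e1_big by linarith

definition offset_terms :: "real \<Rightarrow> real list" where
  "offset_terms U = [fr (U * w), - B]"

text \<open>Consequently \<open>X + fr (Y - X)\<close> is nearer to \<open>Y\<close> than to
  \<open>X\<close>. The error is at most half a grid step, while the rounded difference is at least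
  \<open>ul\<close>, respectively the leading power of two.\<close>

lemma fr_diff_close:
  assumes "X \<in> F" "Y \<in> F" "X < Y" "Y - X \<le> 1"
  shows "\<bar>fr (Y - X) - (Y - X)\<bar> < fr (Y - X)" "ul \<le> fr (Y - X)"
proof -
  define D where "D = Y - X"
  have D: "ul \<le> D" "D \<le> 1" using F_less_ul[OF assms(1-3)] assms(4) by (auto simp: D_def)
  show *: "ul \<le> fr (Y - X)" using D(1) ul_F unfolding D_def by (intro fr_ge)
  show "\<bar>fr (Y - X) - (Y - X)\<bar> < fr (Y - X)"
  proof (cases "D \<le> p2 (e0 + 1)")
    case True
    have "\<bar>fr D - D\<bar> \<le> p2 (e0 - int M) / 2"
      using True D(1) ul_pos(1) exponent_bounds by (intro fr_err) linarith+
    then have "\<bar>fr D - D\<bar> \<le> ul / 2" by (simp add: ul_def)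
    then show ?thesis using * ul_pos(1) unfolding D_def by linarith
  next
    case False
    have "0 < D" using D ul_pos(1) by linarith
    then obtain k where k: "p2 k \<le> D" "D < p2 (k + 1)" using p2_between by metis
    have "p2 (e0 + 1) < p2 (k + 1)" using False k by linarith
    then have k1: "e0 \<le> k" by simp
    have "p2 k \<le> p2 0" using k(1) D(2) by simp
    then have k2: "k \<le> 0" by (simp del: p2_0)
    have "\<bar>fr D - D\<bar> \<le> p2 (k - int M) / 2"
      using k k1 k2 exponent_bounds \<open>0 < D\<close> by (intro fr_err) auto
    moreover have "p2 (k - int M) \<le> p2 k" by simp
    moreover have "p2 k \<le> fr D" using k k1 k2 exponent_bounds by (intro fr_ge F_p2) auto
    ultimately show ?thesis using p2_pos(1)[of k] unfolding D_def by linarith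
  qed
qed

lemma A_B_bounds: "\<bar>B\<bar> \<le> Omega E M" "\<bar>A\<bar> \<le> Omega E M"
  using AB F_le_Omega by auto

lemma run_one:
  assumes "U = (if b then S' else S)"
  shows "\<exists>v\<in>F. run 0 (offset_terms U) v \<and> (if b then ul \<le> v \<and> v \<le> 3 / 16 * h else v = 0)"
proof -
  have "U \<in> F" "near 0 b U" using assms S_F by (auto simp: near_def)
  then obtain v where v: "v \<in> F" "run 0 (offset_terms U) v"
    "if b then ul \<le> v \<and> (\<forall>P\<in>F. 3 / 16 * h + 0 / 8 \<le> P \<longrightarrow> v \<le> P)
     else v \<le> 0 \<and> (\<forall>P\<in>F. 0 / 8 + ul \<le> P \<longrightarrow> - P \<le> v)"
    using run_literal[of U 0 b] unfolding offset_terms_def by auto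
  show ?thesis
  proof (cases b)
    case True
    then have "ul \<le> v" "v \<le> 3 / 16 * h" using v(3) h_F(4) by auto
    then show ?thesis using v True by (intro bexI[of _ v]) auto
  next
    case False
    then have "run 0 (offset_terms U) 0" using assms AB(4) A_B_bounds by (auto simp: offset_terms_def B_def F_le_Omega)
    then show ?thesis using False by auto
  qed
qed

text \<open>The danger is absorption: after a true first input the sum holds
  \<open>fr (A - B)\<close>, possibly tiny against \<open>B\<close>, and adding \<open>B\<close> for
  a false second input might swallow it. Since that sum is nearer to the float \<open>A\<close> than
  to \<open>B\<close>, it is rounded to a float above \<open>B\<close>, which leaves at least
  \<open>ul\<close> after the subtraction.\<close>

lemma run_two:
  assumes "U1 = (if b1 then S' else S)" "U2 = (if b2 then S' else S)"
  shows "\<exists>v\<in>F. run 0 (offset_terms U1 @ offset_terms U2) v \<and> (if b1 \<or> b2 then ul \<le> v \<and> v \<le> h else v = 0)"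
proof -
  obtain v1 where v1: "v1 \<in> F" "run 0 (offset_terms U1) v1" "if b1 then ul \<le> v1 \<and> v1 \<le> 3 / 16 * h else v1 = 0"
    using run_one[OF assms(1)] by auto
  show ?thesis
  proof (cases b1)
    case False
    then have "run 0 (offset_terms U1 @ offset_terms U2) v \<longleftrightarrow> run 0 (offset_terms U2) v" if "v1 = 0" for v
      using v1 that assms AB(4) A_B_bounds by (auto simp: run_append offset_terms_def B_def F_le_Omega)
    moreover have "v1 = 0" using False v1 by simp
    moreover have "3 / 16 * h \<le> h" using h_pos by simp
    ultimately show ?thesis using run_one[OF assms(2)] False by (fastforce split: if_splits)
  next
    case True
    define X where "X = fr (U2 * w)"
    have X: "X = (if b2 then A else B)" unfolding X_def A_def B_def assms(2) by simp
    have XF: "X \<in> F" by (simp add: X_def)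
    have d: "B < A" "A - B \<le> 1" using AB(1,2) ul_pos(1) h_le h_pos by linarith+
    have v1v: "v1 = fr (A - B)"
      using v1(2) True AB A_B_bounds unfolding offset_terms_def assms(1) by (auto simp: A_def)
    define y where "y = fr (v1 + X)"
    have v1h: "ul \<le> v1" "v1 \<le> 3 / 16 * h" using v1(3) True by auto
    have y1: "\<bar>y - X\<bar> \<le> 2 * v1"
      using fr_near_F[OF XF, of v1] v1h ul_pos(1) unfolding y_def by (simp add: add.commute)
    have yB: "B < y"
    proof (cases b2)
      case True
      moreover have "0 \<le> v1" using v1h(1) ul_pos(1) by linarith
      ultimately have "A \<le> y" unfolding y_def using AB X by (intro fr_ge) auto
      then show ?thesis using d by linarith
    next
      case False
      have "\<bar>v1 - (A - B)\<bar> < v1" using fr_diff_close(1)[OF AB(4,3) d] unfolding v1v .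
      moreover have "\<bar>(v1 + B) - y\<bar> \<le> \<bar>(v1 + B) - A\<bar>" unfolding y_def X using False AB fr_near by auto
      ultimately show ?thesis by (auto simp: abs_if split: if_splits)
    qed
    have yF: "y \<in> F" by (simp add: y_def)
    have lo': "ul \<le> y - B" using F_less_ul[OF AB(4) yF yB] by simp
    \<comment> \<open>Twice the bound \<open>3 / 16 * h\<close> on \<open>v1\<close> for the rounded
      addition, plus one gap \<open>A - B\<close>.\<close>
    have up: "y - B \<le> 9 / 16 * h" using y1 v1h X AB(2) h_pos by (auto split: if_splits)
    have "\<bar>y - B\<bar> \<le> 8" using lo' up h_le h_pos ul_pos(1) by linarith
    moreover have "\<bar>v1 + X\<bar> \<le> Omega E M"
    proof -
      have "\<bar>S * w\<bar> \<le> p2 e1" "\<bar>S' * w\<bar> \<le> p2 e1"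
      proof -
        have "\<bar>t * w\<bar> \<le> p2 e1" if "\<bar>t\<bar> \<le> p2 (e1 - 6) * \<bar>\<eta>\<bar>" for t
        proof -
          have "\<bar>t * w\<bar> \<le> \<bar>t\<bar> * 1" unfolding abs_mult using w_F by (intro mult_left_mono) auto
          also have "\<bar>t\<bar> * 1 \<le> p2 (e1 - 6) * \<bar>\<eta>\<bar>" using that by simp
          also have "\<dots> \<le> p2 (e1 - 6) * 4" using eta_le(2) by (intro mult_left_mono) auto
          also have "\<dots> = p2 (e1 - 4)" using p2_add[of "e1 - 6" 2] by simp
          also have "\<dots> \<le> p2 e1" by simp
          finally show ?thesis .
        qed
        then show "\<bar>S * w\<bar> \<le> p2 e1" "\<bar>S' * w\<bar> \<le> p2 e1" using s(4,5) abs_S by auto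
      qed
      then have "\<bar>A\<bar> \<le> p2 e1" "\<bar>B\<bar> \<le> p2 e1" unfolding A_def B_def using exponent_bounds by (auto intro!: fr_abs_le F_p2)
      then have "\<bar>X\<bar> \<le> p2 e1" using X by auto
      then show ?thesis using v1h h_le h_pos ul_pos(1) by (intro p2_e1_margin(2)) linarith
    qed
    ultimately have "run v1 (offset_terms U2) (fr (y - B))"
      unfolding offset_terms_def using Omega_8 by (simp add: X_def[symmetric] y_def[symmetric])
    then have "run 0 (offset_terms U1 @ offset_terms U2) (fr (y - B))" using v1(2) unfolding run_append by blast
    moreover have "ul \<le> fr (y - B)" using lo' by (intro fr_ge ul_F)
    moreover have "fr (y - B) \<le> h" using up h_pos by (intro fr_le h_F) linarith
    ultimately show ?thesis using True by auto
  qed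
qed

definition q :: nat where "q = nat (kh - lo - 1)"

lemma q: "kh = lo + int q + 1" using kh(6) by (simp add: q_def)

text \<open>The offset \<open>b\<close> makes the last rounding asymmetric, so that all values on one side of the
  threshold collapse to a single float.\<close>
definition threshold_terms :: "real \<Rightarrow> real list" where "threshold_terms b = chain q @ [b, Cc kh, - Cc kh]"

lemma run_threshold_terms:
  assumes b: "- (3 / 4) * h \<le> b" "b \<le> - (9 / 16) * h" and v: "v \<in> F"
    and vr: "if t then ul \<le> v \<and> v \<le> h else - h / 2 \<le> v \<and> v \<le> 0"
  shows "run v (threshold_terms b) (if t then 0 else - h)"
  unfolding threshold_terms_def h_def using run_threshold[OF q kh(6,7) b[unfolded h_def] v] vr unfolding h_def by auto

lemma out_true: "fr (0 + \<eta>p) = \<eta>p" "fr (- h + \<eta>p) = \<eta>" "fr (h + \<eta>) = \<eta>p" "fr (0 + \<eta>) = \<eta>"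
proof -
  have "- h + \<eta>p = \<eta>" "h + \<eta> = \<eta>p" using kh(3) by linarith+
  then show "fr (0 + \<eta>p) = \<eta>p" "fr (- h + \<eta>p) = \<eta>" "fr (h + \<eta>) = \<eta>p" "fr (0 + \<eta>) = \<eta>"
    using eta(1,2) by (simp_all only: fr_id add_0_left)
qed

lemma out_Omega: "\<bar>0 + \<eta>p\<bar> \<le> Omega E M" "\<bar>- h + \<eta>p\<bar> \<le> Omega E M" "\<bar>h + \<eta>\<bar> \<le> Omega E M" "\<bar>0 + \<eta>\<bar> \<le> Omega E M"
  using eta_le h_le h_pos by (auto intro!: Omega_8)

text \<open>As \<open>\<eta>p = \<eta> + h\<close>, the values 0 and \<open>- h\<close> become exact
  truth values by adding \<open>\<eta>p\<close>. Rounding is odd, so negating all terms and adding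
  \<eta> instead exchanges the two: negation is free.\<close>

lemma run_threshold_layer:
  assumes b: "- (3 / 4) * h \<le> b" "b \<le> - (9 / 16) * h" and v: "v \<in> F" "run 0 ts v"
    and vr: "if t then ul \<le> v \<and> v \<le> h else - h / 2 \<le> v \<and> v \<le> 0"
  shows "run 0 (ts @ threshold_terms b @ [\<eta>p]) (if t then \<eta>p else \<eta>)"
    and "run 0 (map uminus (ts @ threshold_terms b) @ [\<eta>]) (if t then \<eta> else \<eta>p)"
proof -
  have r: "run 0 (ts @ threshold_terms b) (if t then 0 else - h)" using run_threshold_terms[OF b v(1) vr] v(2) unfolding run_append by blast
  then show "run 0 (ts @ threshold_terms b @ [\<eta>p]) (if t then \<eta>p else \<eta>)"
    unfolding append_assoc[symmetric] run_append[of _ "ts @ threshold_terms b"]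
    by (rule_tac exI[of _ "if t then 0 else - h"]) (use out_true out_Omega in auto)
  have "run 0 (map uminus (ts @ threshold_terms b)) (if t then 0 else h)" using run_uminus[OF r] by (auto split: if_splits)
  then show "run 0 (map uminus (ts @ threshold_terms b) @ [\<eta>]) (if t then \<eta> else \<eta>p)"
    unfolding run_append[of _ "map uminus (ts @ threshold_terms b)"]
    by (rule_tac exI[of _ "if t then 0 else h"]) (use out_true out_Omega in auto)
qed

definition pre :: "real \<Rightarrow> bool \<Rightarrow> real \<Rightarrow> bool" where
  "pre R b r \<longleftrightarrow> (if b then \<eta>p \<le> r \<and> r \<le> \<eta>p + R else \<eta> - R \<le> r \<and> r \<le> \<eta>)"

text \<open>No true input gives the sum 0, any true input a sum in \<open>[ul, h]\<close>, so
  thresholding computes the disjunction. The limit of two inputs keeps the sum at most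
  \<open>h\<close>; larger disjunctions are iterated.\<close>

lemma run_gate:
  assumes b: "- (3 / 4) * h \<le> b" "b \<le> - (9 / 16) * h"
    and Us: "length Us \<le> 2" "\<forall>(U, b) \<in> set Us. U \<in> F \<and> near 0 b U"
  defines "t \<equiv> \<exists>(U, b) \<in> set Us. b" and "ts \<equiv> concat (map (\<lambda>(U, b). offset_terms U) Us)"
  shows "run 0 (ts @ threshold_terms b @ [\<eta>p]) (if t then \<eta>p else \<eta>)"
    and "run 0 (map uminus (ts @ threshold_terms b) @ [\<eta>]) (if t then \<eta> else \<eta>p)"
proof -
  have near0: "U = (if b then S' else S)" if "near 0 b U" for U b
    using that by (auto simp: near_def split: if_splits)
  have "\<exists>v\<in>F. run 0 ts v \<and> (if t then ul \<le> v \<and> v \<le> h else v = 0)"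
  proof -
    consider "Us = []" | U1 b1 where "Us = [(U1, b1)]" | U1 b1 U2 b2 where "Us = [(U1, b1), (U2, b2)]"
      using Us(1) by (cases Us rule: list.exhaust; cases "tl Us" rule: list.exhaust) auto
    then show ?thesis
    proof cases
      case 1
      then show ?thesis by (auto simp: ts_def t_def)
    next
      case 2
      have "3 / 16 * h \<le> h" using h_pos by simp
      then show ?thesis using run_one[of U1 b1] near0[of b1 U1] Us(2) unfolding 2 ts_def t_def by (fastforce split: if_splits)
    next
      case 3
      then show ?thesis using run_two[of U1 b1 U2 b2] near0[of b1 U1] near0[of b2 U2] Us(2) by (auto simp: ts_def t_def)
    qed
  qed
  then obtain v where v: "v \<in> F" "run 0 ts v" "if t then ul \<le> v \<and> v \<le> h else v = 0" by auto
  have "if t then ul \<le> v \<and> v \<le> h else - h / 2 \<le> v \<and> v \<le> 0" using v(3) h_pos by (auto split: if_splits)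
  from run_threshold_layer[OF b v(1,2) this]
  show "run 0 (ts @ threshold_terms b @ [\<eta>p]) (if t then \<eta>p else \<eta>)"
    and "run 0 (map uminus (ts @ threshold_terms b) @ [\<eta>]) (if t then \<eta> else \<eta>p)" by auto
qed

text \<open>At radius \<open>2 * h\<close> the true side is at most 7/16 of \<open>h\<close> before
  rounding and the false side at least \<open>- (h / 4 + ul)\<close>, within the ranges the
  threshold accepts.\<close>

lemma run_final:
  assumes b: "- (3 / 4) * h \<le> b" "b \<le> - (9 / 16) * h" and U: "U \<in> F" "near (2 * h) t U"
  shows "run 0 (offset_terms U @ threshold_terms b @ [\<eta>p]) (if t then \<eta>p else \<eta>)"
    and "run 0 (map uminus (offset_terms U @ threshold_terms b) @ [\<eta>]) (if t then \<eta> else \<eta>p)"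
proof -
  have "2 * h \<le> p2 (e1 + 1)" using h_le p2_e1_big p2_Suc[of e1] by linarith
  then obtain v where v: "v \<in> F" "run 0 (offset_terms U) v"
    "if t then ul \<le> v \<and> (\<forall>P\<in>F. 3 / 16 * h + 2 * h / 8 \<le> P \<longrightarrow> v \<le> P)
     else v \<le> 0 \<and> (\<forall>P\<in>F. 2 * h / 8 + ul \<le> P \<longrightarrow> - P \<le> v)"
    using run_literal[OF U, of] h_pos unfolding offset_terms_def by auto
  have "if t then ul \<le> v \<and> v \<le> h else - h / 2 \<le> v \<and> v \<le> 0"
  proof -
    have "3 / 16 * h + 2 * h / 8 \<le> h" "2 * h / 8 + ul \<le> h / 2" using h_le h_pos by linarith+
    then show ?thesis using v(3) h_F by (auto split: if_splits)
  qed
  from run_threshold_layer[OF b v(1,2) this]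
  show "run 0 (offset_terms U @ threshold_terms b @ [\<eta>p]) (if t then \<eta>p else \<eta>)"
    and "run 0 (map uminus (offset_terms U @ threshold_terms b) @ [\<eta>]) (if t then \<eta> else \<eta>p)" by auto
qed

text \<open>For \<open>P = p2 p\<close> the activation and scale reduce the radius
  \<open>4 * P\<close> to \<open>P / 2\<close> plus a fraction of \<open>h\<close>, hence to at most
  \<open>P\<close>. The chain keeps this bound, and the rounding when \<eta> is added at most
  doubles it: a halving altogether.\<close>

lemma run_contract:
  assumes p: "kh \<le> p" "p < e1" and U: "U \<in> F" "near (4 * p2 p) t U"
  shows "\<exists>r\<in>F. run 0 (offset_terms U @ threshold_terms 0 @ [\<eta>]) r \<and> pre (2 * p2 p) t r"
proof -
  define P where "P = p2 p"
  have hP: "h \<le> P" using p by (simp add: h_def P_def)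
  have Pe: "P \<le> p2 (e1 - 1)" using p by (simp add: P_def)
  have PF: "P \<in> F" unfolding P_def using p kh(6) exponent_bounds by (intro F_p2) auto
  have "4 * P \<le> p2 (e1 + 1)" using Pe p2_e1_big p2_Suc[of e1] by linarith
  moreover have "0 \<le> 4 * P" by (simp add: P_def)
  ultimately obtain v where v: "v \<in> F" "run 0 (offset_terms U) v"
    "if t then ul \<le> v \<and> (\<forall>P'\<in>F. 3 / 16 * h + (4 * P) / 8 \<le> P' \<longrightarrow> v \<le> P')
     else v \<le> 0 \<and> (\<forall>P'\<in>F. (4 * P) / 8 + ul \<le> P' \<longrightarrow> - P' \<le> v)"
    using run_literal[OF U(1) U(2)[folded P_def]] unfolding offset_terms_def by auto
  have "3 / 16 * h + (4 * P) / 8 \<le> P" "(4 * P) / 8 + ul \<le> P" using hP h_le h_pos by linarith+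
  then have vP: "if t then ul \<le> v \<and> v \<le> P else - P \<le> v \<and> v \<le> 0" using v(3) PF by (auto split: if_splits)
  then have "- P \<le> v" "v \<le> P" using ul_pos(1) hP h_pos by (cases t; simp; linarith)+
  then have "\<bar>v\<bar> \<le> p2 p" unfolding P_def by linarith
  then obtain v' where v': "run v (threshold_terms 0) v'" "\<bar>v'\<bar> \<le> P" "v' \<in> F" "v \<le> 0 \<longrightarrow> v' \<le> 0" "ul \<le> v \<longrightarrow> h \<le> v'"
    using run_chain_st[OF q p kh(7) _ v(1)] unfolding threshold_terms_def P_def h_def by auto
  define r where "r = fr (v' + \<eta>)"
  have "\<bar>v' + \<eta>\<bar> \<le> Omega E M" using v'(2) Pe eta_le(2) p2_e1_big by (intro p2_e1_margin(2)) linarith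
  then have "run v' [\<eta>] r" by (simp add: r_def)
  then have "run 0 (offset_terms U @ threshold_terms 0 @ [\<eta>]) r" using v(2) v'(1) unfolding run_append by blast
  moreover have "r \<in> F" by (simp add: r_def)
  moreover have "pre (2 * p2 p) t r"
  proof -
    have near: "\<bar>r - \<eta>\<bar> \<le> 2 * P" unfolding r_def using fr_near_F[OF eta(1), of v'] v'(2) by (simp add: add.commute)
    show ?thesis
    proof (cases t)
      case True
      then have "\<eta>p \<le> r" unfolding r_def using vP v' kh(3) eta(2) by (intro fr_ge) auto
      then show ?thesis using True near eta(3) unfolding pre_def P_def by auto
    next
      case False
      then have "r \<le> \<eta>" unfolding r_def using vP v' eta(1) by (intro fr_le) auto
      then show ?thesis using False near unfolding pre_def P_def by auto
    qed
  qed
  ultimately show ?thesis by blast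
qed

lemma pre_near:
  assumes "x \<in> F" "pre R b x" "0 \<le> R"
  shows "\<exists>t\<in>F. \<sigma> (Num x) = Num t \<and> near R b (sg * t)"
proof (cases b)
  case True
  then have x: "\<eta>p \<le> x" "x - \<eta>p \<le> R" using assms by (auto simp: pre_def)
  obtain t where t: "\<sigma> (Num x) = Num t" "sg * s' \<le> sg * t" "sg * t \<le> sg * s' + lam * (x - \<eta>p)"
    using right[OF assms(1) x(1)] by auto
  have "lam * (x - \<eta>p) \<le> lam * R" using x lam(1) by (intro mult_left_mono)
  then show ?thesis using t True sigF[OF assms(1) t(1)] by (intro bexI[of _ t]) (auto simp: near_def S'_def)
next
  case False
  then have x: "x \<le> \<eta>" "\<eta> - x \<le> R" using assms by (auto simp: pre_def)
  obtain t where t: "\<sigma> (Num x) = Num t" "sg * t \<le> sg * s" "sg * s - lam * (\<eta> - x) \<le> sg * t"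
    using left[OF assms(1) x(1)] by auto
  have "lam * (\<eta> - x) \<le> lam * R" using x lam(1) by (intro mult_left_mono)
  then show ?thesis using t False sigF[OF assms(1) t(1)] by (intro bexI[of _ t]) (auto simp: near_def S_def)
qed

text \<open>Summands that are constants must be products of a weight with the output of a constant neuron. Small
  constants come from \<open>\<sigma>(c\<^sub>2)\<close>, large ones from \<open>\<sigma>(\<eta>)\<close>.\<close>
definition avail :: "real \<Rightarrow> real \<times> real \<Rightarrow> real \<Rightarrow> bool" where
  "avail t kv c \<longleftrightarrow> (case kv of (k, v) \<Rightarrow> k \<in> F \<and> v \<in> F \<and> \<sigma> (Num k) = Num v \<and> c \<in> F \<and> \<bar>v * c\<bar> \<le> Omega E M \<and> fr (v * c) = t)"

lemma avail_uminus: "avail t kv c \<Longrightarrow> avail (- t) kv (- c)"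
  by (auto simp: avail_def)

lemma avail_zero: "avail t kv c \<Longrightarrow> avail 0 kv 0"
  using F_le_Omega[of 0] by (auto simp: avail_def)

lemma s2_exponent:
  obtains e where "p2 e \<le> \<bar>s2\<bar>" "\<bar>s2\<bar> < p2 (e + 1)" "- int M - 2 \<le> e" "e \<le> 0"
proof -
  have "0 < \<bar>s2\<bar>" using c2(3) p2_pos(1)[of "- int M - 2"] by linarith
  then obtain e where e: "p2 e \<le> \<bar>s2\<bar>" "\<bar>s2\<bar> < p2 (e + 1)" using p2_between by metis
  have "p2 (- int M - 2) < p2 (e + 1)" "p2 e < p2 1" using c2(3,4) e p2_1 by linarith+
  then have "p2 e < p2 1" "- int M - 2 \<le> e" by simp_all
  moreover from this(1) have "e \<le> 0" unfolding p2_less_iff by simp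
  ultimately show ?thesis using that[OF e] by simp
qed

text \<open>The weight must have an admissible exponent. \<open>s2\<close> may be as small as
  \<open>p2 (- int M - 2)\<close>, which by \<open>int M \<le> e1 + 1\<close> still reaches the
  targets with \<open>k + int M \<le> -3\<close>. The exponent of \<open>s\<close> is at most
  \<open>e1 - 5\<close>, low enough for all larger targets.\<close>

lemma avail_Cc:
  assumes "lo + 1 \<le> k" "k \<le> kh" shows "\<exists>kv c. avail (Cc k) kv c"
proof (cases "k + int M \<le> -3")
  case True
  obtain e where e: "p2 e \<le> \<bar>s2\<bar>" "\<bar>s2\<bar> < p2 (e + 1)" "- int M - 2 \<le> e" "e \<le> 0" using s2_exponent .
  have "0 < \<bar>s2\<bar>" using e(1) p2_pos(1)[of e] by linarith
  then have "s2 \<noteq> 0" by simp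
  then obtain c where "c \<in> F" "fr (s2 * c) = Cc k" "\<bar>s2 * c\<bar> \<le> Omega E M"
    using Cc_product[OF s_F(3) _ e(1,2), of k] assms kh(7) True e exponent_bounds by auto
  then show ?thesis using c2 s_F(3) by (intro exI[of _ "(c2, s2)"] exI[of _ c]) (auto simp: avail_def)
next
  case False
  have "0 < \<bar>s\<bar>" using s(3) p2_pos(1)[of "e0 + 5"] by linarith
  then have s0: "s \<noteq> 0" by simp
  have "0 < \<bar>s\<bar>" using s0 by simp
  then obtain e where e: "p2 e \<le> \<bar>s\<bar>" "\<bar>s\<bar> < p2 (e + 1)" using p2_between by metis
  have "p2 (e0 + 5) < p2 (e + 1)" using e s(3) by linarith
  then have e1': "e0 + 5 \<le> e" by simp
  have "p2 (e1 - 6) * \<bar>\<eta>\<bar> < p2 (e1 - 6) * 4" using eta(5) by (intro mult_strict_left_mono) auto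
  also have "\<dots> = p2 (e1 - 4)" using p2_add[of "e1 - 6" 2] by simp
  finally have "p2 e < p2 (e1 - 4)" using e s(4) by linarith
  then have "e < e1 - 4" by simp
  then obtain c where "c \<in> F" "fr (s * c) = Cc k" "\<bar>s * c\<bar> \<le> Omega E M"
    using Cc_product[OF s_F(1) s0 e, of k] assms kh(7) False e1' exponent_bounds by auto
  then show ?thesis using s eta s_F(1) by (intro exI[of _ "(\<eta>, s)"] exI[of _ c]) (auto simp: avail_def)
qed

text \<open>A power of two brings \<open>\<bar>s2\<bar>\<close> into \<open>[h / 2, h)\<close>, and
  one of the factors 5/4, 1, 3/4 then moves it into \<open>[9 / 16 * h, 3 / 4 * h]\<close>. This is
  why the offset is specified only by an interval.\<close>

lemma avail_beta:
  "\<exists>b kv c. avail b kv c \<and> - (3 / 4) * h \<le> b \<and> b \<le> - (9 / 16) * h"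
proof -
  obtain e where e: "p2 e \<le> \<bar>s2\<bar>" "\<bar>s2\<bar> < p2 (e + 1)" "- int M - 2 \<le> e" "e \<le> 0" using s2_exponent .
  define k where "k = kh - 1 - e"
  define x where "x = \<bar>s2\<bar> * p2 k"
  have "p2 e * p2 k = h / 2" unfolding k_def h_def using p2_Suc[of "kh - 1"] by (simp flip: p2_add)
  moreover have "p2 (e + 1) * p2 k = h" unfolding k_def h_def by (simp flip: p2_add)
  ultimately have x: "h / 2 \<le> x" "x < h"
    using mult_right_mono[OF e(1), of "p2 k"] mult_strict_right_mono[OF e(2), of "p2 k"] p2_pos[of k]
    unfolding x_def by linarith+
  have k4: "p2 k = 4 * p2 (k - 2)" using p2_add[of "k - 2" 2] by simp
  have "\<exists>m. \<bar>m\<bar> \<le> 8 \<and> 9 / 16 * h \<le> x * (real_of_int m / 4) \<and> x * (real_of_int m / 4) \<le> 3 / 4 * h"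
  proof -
    consider "x < 9 / 16 * h" | "9 / 16 * h \<le> x" "x \<le> 3 / 4 * h" | "3 / 4 * h < x" by linarith
    then show ?thesis
      using x h_pos by cases (auto intro: exI[of _ 5] exI[of _ 4] exI[of _ 3])
  qed
  then obtain m where m: "\<bar>m\<bar> \<le> 8" "9 / 16 * h \<le> x * (real_of_int m / 4)" "x * (real_of_int m / 4) \<le> 3 / 4 * h" by auto
  define c where "c = real_of_int m * p2 (k - 2)"
  have cF: "c \<in> F" unfolding c_def using m(1) kh(6,7) e(3,4) exponent_bounds by (intro F_small) (auto simp: k_def)
  have xc: "x * (real_of_int m / 4) = \<bar>s2\<bar> * c" unfolding x_def c_def k4 by simp
  have hh: "- (3 / 4 * h) \<in> F" "- (9 / 16 * h) \<in> F"
    using scaled_h_F[of 12] scaled_h_F[of 9] p2_add[of "kh - 4" 4] unfolding h_def by simp_all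
  define c' where "c' = (if 0 \<le> s2 then - c else c)"
  have sc: "s2 * c' = - (\<bar>s2\<bar> * c)" by (auto simp: c'_def)
  have r: "- (3 / 4 * h) \<le> s2 * c'" "s2 * c' \<le> - (9 / 16 * h)" using m(2,3) xc sc by linarith+
  have "\<bar>s2 * c'\<bar> \<le> Omega E M" using r h_le h_pos by (intro Omega_8) linarith
  moreover have "c' \<in> F" using cF by (auto simp: c'_def)
  ultimately have "avail (fr (s2 * c')) (c2, s2) c'" using c2 s_F by (auto simp: avail_def)
  moreover have "- (3 / 4 * h) \<le> fr (s2 * c')" "fr (s2 * c') \<le> - (9 / 16 * h)"
    using fr_ge[OF r(1) hh(1)] fr_le[OF r(2) hh(2)] by auto
  ultimately show ?thesis by (intro exI[of _ "fr (s2 * c')"] exI[of _ "(c2, s2)"] exI[of _ c']) auto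
qed

definition avails :: "real list \<Rightarrow> (real \<times> real) list \<Rightarrow> real list \<Rightarrow> bool" where
  "avails ts ks cs \<longleftrightarrow> length ks = length ts \<and> length cs = length ts \<and> (\<forall>i < length ts. avail (ts ! i) (ks ! i) (cs ! i))"

lemma avails_Cons: "avail t k c \<Longrightarrow> avails ts ks cs \<Longrightarrow> avails (t # ts) (k # ks) (c # cs)"
  by (auto simp: avails_def nth_Cons split: nat.splits)

lemma avails_append: "avails ts ks cs \<Longrightarrow> avails ts' ks' cs' \<Longrightarrow> avails (ts @ ts') (ks @ ks') (cs @ cs')"
  by (auto simp: avails_def nth_append)

lemma avails_Cc: "lo + 1 \<le> k \<Longrightarrow> k \<le> kh \<Longrightarrow> \<exists>ks cs. avails [Cc k, - Cc k] ks cs"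
proof -
  assume "lo + 1 \<le> k" "k \<le> kh"
  then obtain kv c where a: "avail (Cc k) kv c" using avail_Cc by blast
  have "avails [] [] []" by (simp add: avails_def)
  then have "avails [Cc k, - Cc k] [kv, kv] [c, - c]" using a avail_uminus by (intro avails_Cons)
  then show ?thesis by blast
qed

lemma avails_chain: "n \<le> q \<Longrightarrow> \<exists>ks cs. avails (chain n) ks cs"
proof (induction n)
  case 0
  then show ?case by (auto simp: avails_def)
next
  case (Suc n)
  then obtain ks cs where "avails (chain n) ks cs" by auto
  moreover obtain ks' cs' where "avails [Cc (lo + int n + 1), - Cc (lo + int n + 1)] ks' cs'"
    using avails_Cc[of "lo + int n + 1"] Suc.prems q by auto
  ultimately show ?case using avails_append unfolding chain.simps by blast
qed

text \<open>One list \<open>ks\<close> of constant neurons serves the sums with offset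
  \<open>b\<close> and with offset 0; in the second the neuron of the offset gets weight 0.\<close>

lemma constants_exist:
  "\<exists>b ks cF cC. - (3 / 4) * h \<le> b \<and> b \<le> - (9 / 16) * h \<and> avails (threshold_terms b) ks cF \<and> avails (threshold_terms 0) ks cC"
proof -
  obtain ks cs where 1: "avails (chain q) ks cs" using avails_chain by blast
  obtain b kv c where 2: "avail b kv c" "- (3 / 4) * h \<le> b" "b \<le> - (9 / 16) * h" using avail_beta by blast
  obtain ks' cs' where 3: "avails [Cc kh, - Cc kh] ks' cs'" using avails_Cc[of kh] kh(6) by auto
  have "avails (threshold_terms b) (ks @ kv # ks') (cs @ c # cs')" "avails (threshold_terms 0) (ks @ kv # ks') (cs @ 0 # cs')"
    unfolding threshold_terms_def by (intro avails_append 1 avails_Cons 2 3 avail_zero[OF 2(1)])+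
  then show ?thesis using 2 by blast
qed

text \<open>A one-input neuron computing a test. The radius \<open>p2 (e1 + 1)\<close> holds for
  every input in [-1, 1], however far from the threshold, and is the starting radius of the
  contraction.\<close>

definition literal :: "real \<Rightarrow> real \<Rightarrow> (real \<Rightarrow> bool) \<Rightarrow> bool" where
  "literal c b \<beta> \<longleftrightarrow> c \<in> F \<and> b \<in> F \<and> (\<forall>x\<in>F. \<bar>x\<bar> \<le> 1 \<longrightarrow> \<bar>x * c\<bar> \<le> Omega E M \<and>
    (\<exists>r\<in>F. run (fr (x * c)) [b] r \<and> pre (p2 (e1 + 1)) (\<beta> x) r))"

text \<open>The weight \<open>p2 (kh - k)\<close> maps the grid of \<open>z\<close> and
  \<open>zp\<close> onto that of \<eta>, and the bias translates. The bias must be a float: for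
  opposite signs of \<open>n\<close> and \<open>mh\<close> the difference \<open>mh - n\<close> may
  be too large, so the weight is negated, the pair is mapped in reverse order, and the test comes
  out negated (\<open>up\<close> is false).\<close>

lemma threshold_literal:
  assumes z: "z \<in> F" "zp \<in> F" "z < zp" "\<forall>y\<in>F. \<not> (z < y \<and> y < zp)" "\<bar>z\<bar> \<le> 1" "\<bar>zp\<bar> \<le> 1"
  shows "\<exists>c b up. literal c b (\<lambda>x. (z < x) = up)"
proof -
  obtain n k where nk: "z = real_of_int n * p2 k" "zp = real_of_int (n + 1) * p2 k"
    "\<bar>n\<bar> \<le> 2 ^ (M + 1)" "\<bar>n + 1\<bar> \<le> 2 ^ (M + 1)" "lo \<le> k" "k \<le> e1 - int M"
    using adjacent[OF z(1-4)] .
  have "zp - z = p2 k" unfolding nk by (simp add: algebra_simps)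
  then have "p2 k \<le> p2 1" using z(5,6) by simp
  then have k1: "k \<le> 1" by (simp del: p2_1)
  define c0 where "c0 = p2 (kh - k)"
  \<comment> \<open>The upper end is attained for \<open>kh = 1 - int M\<close> and
    \<open>k = lo\<close>, where the exponent is exactly \<open>e1\<close>.\<close>
  have kk: "lo \<le> kh - k" "kh - k \<le> e1" using kh(6,7) nk(5) k1 exponent_bounds by auto
  have c0F: "c0 \<in> F" unfolding c0_def using kk by (intro F_p2)
  have c0k: "p2 k * c0 = h" unfolding c0_def h_def by (simp flip: p2_add)
  have c0le: "c0 \<le> p2 e1" unfolding c0_def using kk by simp
  have mulF: "real_of_int j * h \<in> F" if "\<bar>j\<bar> \<le> 2 ^ (M + 1)" for j
    unfolding h_def using that kh(6,7) exponent_bounds by (intro F_I) auto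
  have bnd: "\<bar>real_of_int j * h\<bar> \<le> 4" if "\<bar>j\<bar> \<le> 2 ^ (M + 1)" for j
  proof -
    have "real_of_int \<bar>j\<bar> \<le> real_of_int (2 ^ (M + 1))" using that by (simp only: of_int_le_iff)
    then have "\<bar>real_of_int j * h\<bar> \<le> real_of_int (2 ^ (M + 1)) * h" using h_pos by (simp add: abs_mult)
    also have "\<dots> = p2 (kh + int M + 1)" unfolding h_def
      using p2_add[of "int (M + 1)" kh] p2_of_nat[of "M + 1"] by (simp add: algebra_simps)
    also have "\<dots> \<le> p2 2" using kh(7) by (simp del: p2_numeral)
    finally show ?thesis by simp
  qed
  have size: "\<bar>x * c\<bar> \<le> Omega E M \<and> (\<exists>r\<in>F. r = fr (fr (x * c) + b) \<and> run (fr (x * c)) [b] r \<and> \<eta> - p2 (e1 + 1) \<le> r \<and> r \<le> \<eta>p + p2 (e1 + 1))"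
    if x: "\<bar>x\<bar> \<le> 1" "\<bar>c\<bar> = c0" "\<bar>b\<bar> \<le> 4" for x c b
  proof -
    have "\<bar>x * c\<bar> \<le> 1 * c0" unfolding abs_mult x(2) using x(1) by (intro mult_right_mono) (auto simp: c0_def)
    then have xc: "\<bar>x * c\<bar> \<le> p2 e1" using c0le by linarith
    then have "\<bar>fr (x * c)\<bar> \<le> p2 e1" using exponent_bounds by (intro fr_abs_le F_p2) auto
    then have s: "\<bar>fr (x * c) + b\<bar> \<le> p2 e1 + 4" using x(3) by linarith
    have t: "p2 e1 + 4 \<le> 3 * p2 (e1 - 1)" using p2_e1_big by linarith
    \<comment> \<open>A float above \<open>p2 e1 + 4\<close> that leaves the margin
      \<open>p2 (e1 - 1)\<close> to \<open>p2 (e1 + 1)\<close> for the distance of \<eta> from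
      0.\<close>
    have "real_of_int 3 * p2 (e1 - 1) \<in> F"
    proof -
      have "real_of_int 3 * p2 (e1 - 1) = real_of_int (3 * 2 ^ (M - 1)) * p2 (e1 - int M)"
        using p2_split[of "e1 - int M" "e1 - 1"] M3 by (simp add: nat_diff_distrib)
      moreover have "(2::int) ^ (M + 1) = 4 * 2 ^ (M - 1)" using M3 power_add[of "2::int" 2 "M - 1"] by simp
      ultimately show ?thesis using exponent_bounds by (auto intro!: F_rep simp del: of_int_mult)
    qed
    then have r: "\<bar>fr (fr (x * c) + b)\<bar> \<le> 3 * p2 (e1 - 1)" using s t by (intro fr_abs_le) auto
    have "p2 (e1 + 1) = 4 * p2 (e1 - 1)" using p2_Suc[of e1] p2_e1_big by simp
    then have "\<eta> - p2 (e1 + 1) \<le> fr (fr (x * c) + b)" "fr (fr (x * c) + b) \<le> \<eta>p + p2 (e1 + 1)"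
      using r eta_le p2_e1_big by linarith+
    moreover have "\<bar>x * c\<bar> \<le> Omega E M" "\<bar>fr (x * c) + b\<bar> \<le> Omega E M" using xc s p2_e1_margin(2) by auto
    ultimately show ?thesis by auto
  qed
  have zc: "z * c0 = real_of_int n * h" "zp * c0 = real_of_int (n + 1) * h" unfolding nk c0k[symmetric] by auto
  have "\<exists>c b up. \<bar>c\<bar> = c0 \<and> (if up then 0 \<le> c else c \<le> 0) \<and> b \<in> F \<and> \<bar>b\<bar> \<le> 4 \<and>
    fr (z * c) + b = (if up then \<eta> else \<eta>p) \<and> fr (zp * c) + b = (if up then \<eta>p else \<eta>)"
  proof (cases "0 \<le> mh * n")
    case True
    define b where "b = real_of_int (mh - n) * h"
    have "\<bar>mh - n\<bar> \<le> max \<bar>mh\<bar> \<bar>n\<bar>" using True by (auto simp: zero_le_mult_iff)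
    then have mn: "\<bar>mh - n\<bar> \<le> 2 ^ (M + 1)" using kh(4) nk(3) by linarith
    have b: "b \<in> F" "\<bar>b\<bar> \<le> 4" unfolding b_def by (rule mulF[OF mn], rule bnd[OF mn])
    have "fr (z * c0) + b = \<eta>" "fr (zp * c0) + b = \<eta>p"
      using zc mulF[OF nk(3)] mulF[OF nk(4)] kh(1,2) by (auto simp: b_def algebra_simps)
    then show ?thesis using b by - (rule exI[of _ c0], rule exI[of _ b], rule exI[of _ True], simp add: c0_def)
  next
    case False
    define b where "b = real_of_int (mh + 1 + n) * h"
    have "(0 < mh \<and> n < 0) \<or> (mh < 0 \<and> 0 < n)" using False by (auto simp: zero_le_mult_iff)
    then have mn: "\<bar>mh + 1 + n\<bar> \<le> 2 ^ (M + 1)" using kh(4,5) nk(3,4) by linarith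
    have b: "b \<in> F" "\<bar>b\<bar> \<le> 4" unfolding b_def by (rule mulF[OF mn], rule bnd[OF mn])
    have "fr (z * - c0) = - (real_of_int n * h)" "fr (zp * - c0) = - (real_of_int (n + 1) * h)"
      using zc mulF[OF nk(3)] mulF[OF nk(4)] by (simp_all only: mult_minus_right fr_minus fr_id)
    then have "fr (z * - c0) + b = \<eta>p" "fr (zp * - c0) + b = \<eta>"
      using kh(1,2) by (auto simp: b_def algebra_simps)
    then show ?thesis using b by - (rule exI[of _ "- c0"], rule exI[of _ b], rule exI[of _ False], simp add: c0_def)
  qed
  then obtain c b up where c: "\<bar>c\<bar> = c0" "if up then 0 \<le> c else c \<le> 0" and b: "b \<in> F" "\<bar>b\<bar> \<le> 4"
    and f: "fr (z * c) + b = (if up then \<eta> else \<eta>p)" "fr (zp * c) + b = (if up then \<eta>p else \<eta>)" by blast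
  have cF: "c \<in> F" using c(1) c0F by (cases "0 \<le> c") auto
  have "\<bar>x * c\<bar> \<le> Omega E M \<and> (\<exists>r\<in>F. run (fr (x * c)) [b] r \<and> pre (p2 (e1 + 1)) ((z < x) = up) r)"
    if x: "x \<in> F" "\<bar>x\<bar> \<le> 1" for x
  proof -
    obtain r where r: "\<bar>x * c\<bar> \<le> Omega E M" "r \<in> F" "r = fr (fr (x * c) + b)" "run (fr (x * c)) [b] r"
      "\<eta> - p2 (e1 + 1) \<le> r" "r \<le> \<eta>p + p2 (e1 + 1)" using size[OF x(2) c(1) b(2)] by auto
    have up: "u * c \<le> v * c" if up "u \<le> v" for u v using c(2) that by (simp add: mult_right_mono)
    have dn: "v * c \<le> u * c" if "\<not> up" "u \<le> v" for u v using c(2) that by (simp add: mult_right_mono_neg)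
    have "if (z < x) = up then \<eta>p \<le> r else r \<le> \<eta>"
    proof (cases "z < x")
      case True
      then have "zp \<le> x" using z(4) x(1) by force
      then have "if up then fr (zp * c) \<le> fr (x * c) else fr (x * c) \<le> fr (zp * c)"
        using up dn by (auto intro: fr_mono)
      then have "if up then \<eta>p \<le> fr (x * c) + b else fr (x * c) + b \<le> \<eta>" using f(2) by (auto split: if_splits)
      then show ?thesis using True eta(1,2) unfolding r(3) by (auto intro: fr_le fr_ge)
    next
      case False
      then have "if up then fr (x * c) \<le> fr (z * c) else fr (z * c) \<le> fr (x * c)"
        using up dn by (auto intro: fr_mono)
      then have "if up then fr (x * c) + b \<le> \<eta> else \<eta>p \<le> fr (x * c) + b" using f(1) by (auto split: if_splits)
      then show ?thesis using False eta(1,2) unfolding r(3) by (auto intro: fr_le fr_ge)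
    qed
    then show ?thesis using r by (auto simp: pre_def split: if_splits)
  qed
  then show ?thesis using cF b(1) unfolding literal_def by blast
qed

end

section \<open>Interval semantics of certified networks\<close>

lemma xval_inj: "a \<noteq> NaN \<Longrightarrow> b \<noteq> NaN \<Longrightarrow> xval a = xval b \<Longrightarrow> a = b"
  by (cases a; cases b) auto

lemma xle_antisym: "xle a b \<Longrightarrow> xle b a \<Longrightarrow> a = b"
  unfolding xle_def using xval_inj by auto

lemma xle_Num [simp]: "xle (Num a) (Num b) \<longleftrightarrow> a \<le> b"
  by (simp add: xle_def)

lemma ihull_cases:
  assumes "finite S" "S \<noteq> {}" "NaN \<notin> S"
  obtains a b where "ihull S = Ival a b" "a \<in> S" "b \<in> S" "xle a b"
proof -
  have fin: "finite (xval ` S)" "xval ` S \<noteq> {}" using assms by auto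
  have nn: "x \<noteq> NaN" if "x \<in> S" for x using that assms(3) by auto
  obtain a where a: "a \<in> S" "xval a = Min (xval ` S)" using Min_in[OF fin] by auto
  obtain b where b: "b \<in> S" "xval b = Max (xval ` S)" using Max_in[OF fin] by auto
  have a': "\<forall>z\<in>S. xle a z" using a fin nn by (auto simp: xle_def)
  have b': "\<forall>z\<in>S. xle z b" using b fin nn by (auto simp: xle_def)
  have "xmin S = a" unfolding xmin_def using a(1) a' by (auto intro!: the_equality dest: xle_antisym)
  moreover have "xmax S = b" unfolding xmax_def using b(1) b' by (auto intro!: the_equality dest: xle_antisym)
  ultimately show ?thesis using that[of a b] a b a' assms(3) by (auto simp: ihull_def)
qed

text \<open>Only the endpoints must lie in \<open>A\<close>, not the floats between them, so
  \<open>A\<close> may have gaps.\<close>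

definition inside :: "xfloat set \<Rightarrow> ival \<Rightarrow> bool" where
  "inside A I \<longleftrightarrow> (\<exists>a b. I = Ival a b \<and> a \<in> A \<and> b \<in> A \<and> xle a b)"

lemma inside_nonempty: "inside A I \<Longrightarrow> A \<noteq> {}"
  by (auto simp: inside_def)

lemma inside_iop:
  assumes "inside A I" "inside B J" "\<And>a b. a \<in> A \<Longrightarrow> b \<in> B \<Longrightarrow> f a b \<in> C" "NaN \<notin> C"
  shows "inside C (iop f I J)"
proof -
  obtain a b c d where I: "I = Ival a b" "a \<in> A" "b \<in> A" and J: "J = Ival c d" "c \<in> B" "d \<in> B"
    using assms(1,2) by (auto simp: inside_def)
  let ?S = "{f a c, f a d, f b c, f b d}"
  have SC: "?S \<subseteq> C" using I J assms(3) by auto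
  then have "NaN \<notin> ?S" using assms(4) by blast
  then obtain u v where "ihull ?S = Ival u v" "u \<in> ?S" "v \<in> ?S" "xle u v"
    using ihull_cases[of ?S] by blast
  then show ?thesis using SC unfolding inside_def I J iop.simps by blast
qed

fun xsums :: "nat \<Rightarrow> nat \<Rightarrow> xfloat set \<Rightarrow> xfloat set list \<Rightarrow> xfloat set" where
  "xsums E M A [] = A"
| "xsums E M A (B # Bs) = xsums E M {xadd E M a b | a b. a \<in> A \<and> b \<in> B} Bs"

lemma xadd_NaN [simp]: "xadd E M NaN y = NaN"
  by (cases y) auto

text \<open>NaN is absorbing: excluding it from the complete sums excludes it from all partial sums,
  so the interval never degenerates to \<open>Top\<close> on the way.\<close>

lemma NaN_sums: "NaN \<in> A \<Longrightarrow> {} \<notin> set Bs \<Longrightarrow> NaN \<in> xsums E M A Bs"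
proof (induction Bs arbitrary: A)
  case (Cons B Bs)
  then obtain b where "b \<in> B" by auto
  then have "NaN \<in> {xadd E M a b | a b. a \<in> A \<and> b \<in> B}" using Cons.prems(1) by force
  then show ?case using Cons by auto
qed simp

lemma list_all2_setD: "list_all2 P xs ys \<Longrightarrow> x \<in> set xs \<Longrightarrow> \<exists>y. P x y"
  by (induction rule: list_all2_induct) auto

lemma inside_sums:
  assumes "inside A I" "list_all2 inside Bs Js" "NaN \<notin> xsums E M A Bs"
  shows "inside (xsums E M A Bs) (foldl (iadd E M) I Js)"
  using assms(2,1,3)
proof (induction Bs Js arbitrary: A I rule: list_all2_induct)
  case (Cons B Bs J Js)
  have "{} \<notin> set Bs"
    using list_all2_setD[OF Cons.hyps(2)] inside_nonempty by blast
  then have "NaN \<notin> {xadd E M a b | a b. a \<in> A \<and> b \<in> B}"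
    using NaN_sums[of "{xadd E M a b | a b. a \<in> A \<and> b \<in> B}" Bs E M] Cons.prems(2)
    unfolding xsums.simps by blast
  then have "inside {xadd E M a b | a b. a \<in> A \<and> b \<in> B} (iadd E M I J)"
    unfolding iadd_def using Cons.hyps(1) Cons.prems(1) by (intro inside_iop[of A _ B]) auto
  then show ?case using Cons.IH Cons.prems(2) by simp
qed simp

lemma sums_foldl:
  "y \<in> xsums E M A Bs \<Longrightarrow> \<exists>x ys. x \<in> A \<and> list_all2 (\<in>) ys Bs \<and> y = foldl (xadd E M) x ys"
proof (induction Bs arbitrary: A)
  case (Cons B Bs)
  from Cons.prems have "y \<in> xsums E M {xadd E M a b | a b. a \<in> A \<and> b \<in> B} Bs" by simp
  from Cons.IH[OF this] obtain a b ys
    where "a \<in> A" "b \<in> B" "list_all2 (\<in>) ys Bs" "y = foldl (xadd E M) (xadd E M a b) ys" by blast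
  then show ?case by - (rule exI[of _ a], rule exI[of _ "b # ys"], simp)
qed simp

section \<open>Neurons and layers certified by predicates on their wires\<close>

type_synonym neuron = "real list \<times> real"

definition neval :: "nat \<Rightarrow> nat \<Rightarrow> neuron \<Rightarrow> xfloat list \<Rightarrow> xfloat" where
  "neval E M n x = xadd E M (xsum E M (map2 (\<lambda>xj wij. xmul E M xj (Num wij)) x (fst n))) (Num (snd n))"

definition nsharp :: "nat \<Rightarrow> nat \<Rightarrow> neuron \<Rightarrow> ival list \<Rightarrow> ival" where
  "nsharp E M n X = iadd E M (isum E M (map2 (\<lambda>Xj wij. imul E M Xj (Ival (Num wij) (Num wij))) X (fst n)))
     (Ival (Num (snd n)) (Num (snd n)))"

definition mk_layer :: "neuron list \<Rightarrow> layer" where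
  "mk_layer ns = (map fst ns, map snd ns)"

lemma aff_mk: "aff E M (mk_layer ns) x = map (\<lambda>n. neval E M n x) ns"
  unfolding aff_def mk_layer_def neval_def by (induction ns) auto

lemma aff_sharp_mk: "aff_sharp E M (mk_layer ns) X = map (\<lambda>n. nsharp E M n X) ns"
  unfolding aff_sharp_def mk_layer_def nsharp_def by (induction ns) auto

context fp
begin

definition sat :: "(real \<Rightarrow> bool) list \<Rightarrow> real list \<Rightarrow> bool" where
  "sat Qs xs \<longleftrightarrow> list_all2 (\<lambda>Q x. x \<in> F \<and> Q x) Qs xs"

definition ivl :: "(real \<Rightarrow> bool) \<Rightarrow> ival \<Rightarrow> bool" where
  "ivl Q X \<longleftrightarrow> inside {Num x | x. x \<in> F \<and> Q x} X"

definition isat :: "(real \<Rightarrow> bool) list \<Rightarrow> ival list \<Rightarrow> bool" where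
  "isat Qs Xs \<longleftrightarrow> list_all2 ivl Qs Xs"

text \<open>An endpoint of an interval result is an ordinary result computed from endpoints of the
  operands, so the pointwise condition here also controls the interval semantics.\<close>
definition neuron_ok :: "(real \<Rightarrow> bool) list \<Rightarrow> neuron \<Rightarrow> (real \<Rightarrow> bool) \<Rightarrow> bool" where
  "neuron_ok Qs n P \<longleftrightarrow> length (fst n) = length Qs \<and> set (fst n) \<subseteq> F \<and> snd n \<in> F \<and>
     (\<forall>xs. sat Qs xs \<longrightarrow> (\<exists>y\<in>F. P y \<and> neval E M n (map Num xs) = Num y))"

text \<open>The abstract activation ranges over all floats between the endpoints, which explains the
  order-convexity required of \<open>P\<close>.\<close>

definition sig_ok :: "(xfloat \<Rightarrow> xfloat) \<Rightarrow> (real \<Rightarrow> bool) \<Rightarrow> (real \<Rightarrow> bool) \<Rightarrow> bool" where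
  "sig_ok \<sigma> P Q \<longleftrightarrow> (\<forall>a\<in>F. \<forall>b\<in>F. \<forall>x\<in>F. P a \<and> P b \<and> a \<le> x \<and> x \<le> b \<longrightarrow> P x) \<and>
     (\<forall>x\<in>F. P x \<longrightarrow> (\<exists>t\<in>F. \<sigma> (Num x) = Num t \<and> Q t))"

lemma rnd_not_NaN [simp]: "rnd E M x \<noteq> NaN" "NaN \<noteq> rnd E M x"
  by (simp_all add: rnd_def Let_def)

text \<open>Each input occurs in exactly one summand, so summands chosen independently come from one
  input vector: the dependency problem of interval arithmetic does not arise inside a
  neuron.\<close>

lemma term_choice:
  assumes "isat Qs Xs" "length row = length Xs"
    "list_all2 (\<in>) ys (map2 (\<lambda>Q w. {xmul E M (Num x) (Num w) | x. x \<in> F \<and> Q x}) Qs row)"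
  shows "\<exists>xs. sat Qs xs \<and> ys = map2 (\<lambda>x w. xmul E M x (Num w)) (map Num xs) row"
proof -
  have "length Qs = length row" using assms by (auto simp: isat_def dest: list_all2_lengthD)
  then show ?thesis using assms(3)
  proof (induction Qs row arbitrary: ys rule: list_induct2)
    case Nil
    then show ?case by (simp add: sat_def)
  next
    case (Cons Q Qs w row)
    then obtain y ys' where y: "ys = y # ys'" by (cases ys) auto
    obtain xs where "sat Qs xs" "ys' = map2 (\<lambda>x w. xmul E M x (Num w)) (map Num xs) row"
      using Cons y by auto
    moreover obtain x where "x \<in> F" "Q x" "y = xmul E M (Num x) (Num w)" using Cons y by auto
    ultimately show ?case unfolding y by (intro exI[of _ "x # xs"]) (auto simp: sat_def)
  qed
qed

lemma neuron_sharp: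
  assumes ok: "neuron_ok Qs n P" and Xs: "isat Qs Xs"
  shows "ivl P (nsharp E M n Xs)"
proof -
  obtain row b where n: "n = (row, b)" by (cases n)
  have len: "length row = length Qs" "length Qs = length Xs"
    using ok Xs by (auto simp: neuron_ok_def n isat_def dest: list_all2_lengthD)
  define Ts where "Ts = map2 (\<lambda>Q w. {xmul E M (Num x) (Num w) | x. x \<in> F \<and> Q x}) Qs row"
  define Js where "Js = map2 (\<lambda>Xj wij. imul E M Xj (Ival (Num wij) (Num wij))) Xs row"
  have TJ: "list_all2 inside Ts Js"
    unfolding list_all2_conv_all_nth
  proof (intro conjI allI impI)
    show "length Ts = length Js" using len by (simp add: Ts_def Js_def)
    fix i assume "i < length Ts"
    then have i: "i < length Qs" "i < length Xs" "i < length row" using len by (auto simp: Ts_def)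
    have "ivl (Qs ! i) (Xs ! i)" using Xs i by (simp add: isat_def list_all2_conv_all_nth)
    then have "inside {Num x | x. x \<in> F \<and> (Qs ! i) x} (Xs ! i)" by (simp add: ivl_def)
    moreover have "inside {Num (row ! i)} (Ival (Num (row ! i)) (Num (row ! i)))" by (simp add: inside_def)
    ultimately show "inside (Ts ! i) (Js ! i)" using i unfolding Ts_def Js_def imul_def
      by (auto intro!: inside_iop)
  qed
  define C where "C = {Num y | y. y \<in> F \<and> P y}"
  have b1: "inside {Num b} (Ival (Num b) (Num b))" by (simp add: inside_def)
  have nC: "neval E M n (map Num xs) \<in> C" if "sat Qs xs" for xs
    using ok that by (auto simp: neuron_ok_def C_def)
  have NC: "NaN \<notin> C" by (auto simp: C_def)
  have Teq: "xs = [] \<longleftrightarrow> row = []" if "sat Qs xs" for xs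
    using that len by (auto simp: sat_def dest!: list_all2_lengthD)
  \<comment> \<open>An empty sum is the constant 0, a nonempty one starts with its first summand;
    \<open>T0\<close> and \<open>Ts'\<close> cover both forms, with the bias as last
    summand.\<close>
  have fin: "inside (xsums E M T0 (Ts' @ [{Num b}])) (iadd E M (isum E M Js) (Ival (Num b) (Num b))) \<and>
      xsums E M T0 (Ts' @ [{Num b}]) \<subseteq> C"
    if h: "(Ts = [] \<and> T0 = {Num 0} \<and> Ts' = []) \<or> Ts = T0 # Ts'" for T0 Ts'
  proof -
    have sub: "xsums E M T0 (Ts' @ [{Num b}]) \<subseteq> C"
    proof
      fix y assume "y \<in> xsums E M T0 (Ts' @ [{Num b}])"
      then obtain x ys where xy: "x \<in> T0" "list_all2 (\<in>) ys (Ts' @ [{Num b}])" "y = foldl (xadd E M) x ys"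
        using sums_foldl by blast
      obtain ys' where ys': "ys = ys' @ [Num b]" "list_all2 (\<in>) ys' Ts'"
        using xy(2) by (auto simp: list_all2_append2 list_all2_Cons2)
      show "y \<in> C"
      proof (cases "Ts = []")
        case True
        then have "row = []" "Qs = []" using len by (auto simp: Ts_def zip_eq_Nil_iff)
        moreover have "T0 = {Num 0}" "Ts' = []" using h True by auto
        ultimately have "y = neval E M n (map Num [])" using xy ys' by (simp add: neval_def n)
        then show ?thesis using nC[of "[]"] \<open>Qs = []\<close> by (simp add: sat_def)
      next
        case False
        then have T: "Ts = T0 # Ts'" using h by auto
        then have l2: "list_all2 (\<in>) (x # ys') Ts" using xy(1) ys' by simp
        have lr: "length row = length Xs" using len by simp
        from term_choice[OF Xs lr l2[unfolded Ts_def]]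
        obtain xs where xs: "sat Qs xs" "x # ys' = map2 (\<lambda>x w. xmul E M x (Num w)) (map Num xs) row"
          by (elim exE conjE)
        have "neval E M n (map Num xs) = xadd E M (xsum E M (x # ys')) (Num b)"
          unfolding neval_def n fst_conv snd_conv xs(2) ..
        also have "\<dots> = y" unfolding xy(3) ys'(1) by simp
        finally have "neval E M n (map Num xs) = y" .
        then show ?thesis using nC[OF xs(1)] by simp
      qed
    qed
    have "inside (xsums E M T0 (Ts' @ [{Num b}])) (iadd E M (isum E M Js) (Ival (Num b) (Num b)))"
    proof (cases "Ts = []")
      case True
      then have "Js = []" "T0 = {Num 0}" "Ts' = []" using TJ h by auto
      moreover have "inside {Num 0} (Ival (Num 0) (Num 0))" by (simp add: inside_def)
      ultimately show ?thesis using inside_sums[of "{Num 0}" _ "[{Num b}]" "[Ival (Num b) (Num b)]" E M] b1 sub NC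
        by auto
    next
      case False
      then have T: "Ts = T0 # Ts'" using h by auto
      then obtain J Js' where J: "Js = J # Js'" "inside T0 J" "list_all2 inside Ts' Js'"
        using TJ by (auto simp: list_all2_Cons1)
      have "inside (xsums E M T0 (Ts' @ [{Num b}])) (foldl (iadd E M) J (Js' @ [Ival (Num b) (Num b)]))"
        using J b1 sub NC by (intro inside_sums list_all2_appendI) auto
      then show ?thesis using J by simp
    qed
    then show ?thesis using sub by simp
  qed
  have "\<exists>A. inside A (iadd E M (isum E M Js) (Ival (Num b) (Num b))) \<and> A \<subseteq> C"
    using fin[of "{Num 0}" "[]"] fin[of "hd Ts" "tl Ts"] by (cases Ts) auto
  then have "inside C (iadd E M (isum E M Js) (Ival (Num b) (Num b)))"
    by (auto simp: inside_def)
  then show ?thesis by (simp add: ivl_def C_def nsharp_def n Js_def)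
qed

lemma sigma_sharp_ivl:
  assumes ok: "sig_ok \<sigma> P Q" and X: "ivl P X"
  shows "ivl Q (sigma_sharp E M \<sigma> X)"
proof -
  obtain a b where ab: "X = Ival (Num a) (Num b)" "a \<in> F" "P a" "b \<in> F" "P b" "a \<le> b"
    using X by (auto simp: ivl_def inside_def)
  define G where "G = {x \<in> F. a \<le> x \<and> x \<le> b}"
  have g: "gamma E M X = Num ` G"
  proof -
    have "x \<in> Num ` G" if "x \<in> Fbar E M" "xle (Num a) x" "xle x (Num b)" for x
      using that by (cases x) (auto simp: G_def Fbar_def xle_def)
    then show ?thesis unfolding ab(1) gamma.simps by (auto simp: G_def Fbar_def)
  qed
  have sub: "\<sigma> ` gamma E M X \<subseteq> {Num x | x. x \<in> F \<and> Q x}"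
  proof
    fix y assume "y \<in> \<sigma> ` gamma E M X"
    then obtain x where x: "x \<in> F" "a \<le> x" "x \<le> b" "y = \<sigma> (Num x)" unfolding g by (auto simp: G_def)
    then have "P x" using ok ab unfolding sig_ok_def by blast
    then show "y \<in> {Num x | x. x \<in> F \<and> Q x}" using ok x unfolding sig_ok_def by fastforce
  qed
  have fin: "finite (\<sigma> ` gamma E M X)" unfolding g G_def using F_finite by auto
  have "a \<in> G" using ab by (simp add: G_def)
  then have ne: "\<sigma> ` gamma E M X \<noteq> {}" unfolding g by auto
  have nn: "NaN \<notin> \<sigma> ` gamma E M X" using sub by auto
  obtain c d where "ihull (\<sigma> ` gamma E M X) = Ival c d" "c \<in> \<sigma> ` gamma E M X" "d \<in> \<sigma> ` gamma E M X" "xle c d"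
    using ihull_cases[OF fin ne nn] .
  then show ?thesis using sub unfolding ivl_def inside_def sigma_sharp_def
    by - (rule exI[of _ c], rule exI[of _ d], blast)
qed

definition lay_ok :: "(xfloat \<Rightarrow> xfloat) \<Rightarrow> (real \<Rightarrow> bool) list \<Rightarrow> neuron list \<Rightarrow> (real \<Rightarrow> bool) list \<Rightarrow> bool" where
  "lay_ok \<sigma> Qs ns Qs' \<longleftrightarrow> list_all2 (\<lambda>n Q'. \<exists>P. neuron_ok Qs n P \<and> sig_ok \<sigma> P Q') ns Qs'"

text \<open>The predicate lists act as types of the wires; one such typing yields well-formedness,
  the interval semantics and the concrete evaluation.\<close>

fun hidden_ok :: "(xfloat \<Rightarrow> xfloat) \<Rightarrow> neuron list list \<Rightarrow> (real \<Rightarrow> bool) list \<Rightarrow> (real \<Rightarrow> bool) list \<Rightarrow> bool" where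
  "hidden_ok \<sigma> [] Qs Qs'' \<longleftrightarrow> Qs'' = Qs"
| "hidden_ok \<sigma> (ns # nss) Qs Qs'' \<longleftrightarrow> (\<exists>Qs'. lay_ok \<sigma> Qs ns Qs' \<and> hidden_ok \<sigma> nss Qs' Qs'')"

lemma hid_snoc: "hidden_ok \<sigma> nss Qs Qs' \<Longrightarrow> lay_ok \<sigma> Qs' ns Qs'' \<Longrightarrow> hidden_ok \<sigma> (nss @ [ns]) Qs Qs''"
  by (induction nss arbitrary: Qs) auto

definition net :: "neuron list list \<Rightarrow> neuron list \<Rightarrow> layer list" where
  "net nss ns = map mk_layer nss @ [mk_layer ns]"

lemma net_Nil: "net [] ns = [mk_layer ns]" by (simp add: net_def)

lemma net_Cons: "\<exists>l ls. net nss ns = l # ls" "net (n # nss) ns = mk_layer n # net nss ns"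
  by (cases nss; simp add: net_def)+

lemma wf_net_net:
  assumes "hidden_ok \<sigma> nss Qs Qs'" "list_all2 (neuron_ok Qs') ns Ps"
  shows "wf_net E M (length Qs) (net nss ns) (length ns)"
  using assms(1)
proof (induction nss arbitrary: Qs)
  case Nil
  then have "\<exists>P. neuron_ok Qs n P" if "n \<in> set ns" for n
    using list_all2_setD[OF assms(2) that] by simp
  then show ?case by (fastforce simp: net_Nil mk_layer_def neuron_ok_def)
next
  case (Cons n nss)
  then obtain Qs1 where Q: "lay_ok \<sigma> Qs n Qs1" "hidden_ok \<sigma> nss Qs1 Qs'" by auto
  have len: "length n = length Qs1" using Q(1) by (auto simp: lay_ok_def dest: list_all2_lengthD)
  have "\<exists>P. neuron_ok Qs m P" if "m \<in> set n" for m
    using list_all2_setD[OF Q(1)[unfolded lay_ok_def] that] by blast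
  then have "(\<forall>row \<in> set (map fst n). length row = length Qs \<and> set row \<subseteq> F) \<and> set (map snd n) \<subseteq> F"
    by (fastforce simp: neuron_ok_def)
  moreover have "net nss ns \<noteq> []" by (simp add: net_def)
  moreover have "wf_net E M (length Qs1) (net nss ns) (length ns)" using Cons.IH[OF Q(2)] .
  ultimately show ?case unfolding net_Cons using len by (simp add: mk_layer_def)
qed

lemma net_sharp_net:
  assumes "hidden_ok \<sigma> nss Qs Qs'" "list_all2 (neuron_ok Qs') ns Ps" "isat Qs Xs"
  shows "isat Ps (net_sharp E M \<sigma> (net nss ns) Xs)"
  using assms(1,3)
proof (induction nss arbitrary: Qs Xs)
  case Nil
  then have "list_all2 (\<lambda>n P. ivl P (nsharp E M n Xs)) ns Ps"
    using assms(2) by (auto elim!: list_all2_mono intro: neuron_sharp)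
  then show ?case by (auto simp: net_Nil aff_sharp_mk isat_def list_all2_conv_all_nth)
next
  case (Cons n nss)
  then obtain Qs1 where Q: "lay_ok \<sigma> Qs n Qs1" "hidden_ok \<sigma> nss Qs1 Qs'" by auto
  have "isat Qs1 (map (sigma_sharp E M \<sigma>) (aff_sharp E M (mk_layer n) Xs))"
    unfolding isat_def aff_sharp_mk
  proof (rule list_all2_all_nthI)
    show "length Qs1 = length (map (sigma_sharp E M \<sigma>) (map (\<lambda>n. nsharp E M n Xs) n))"
      using Q(1) by (auto simp: lay_ok_def dest: list_all2_lengthD)
    fix i assume i: "i < length Qs1"
    then have i': "i < length n" using Q(1) by (auto simp: lay_ok_def dest: list_all2_lengthD)
    then obtain P where "neuron_ok Qs (n ! i) P" "sig_ok \<sigma> P (Qs1 ! i)"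
      using list_all2_nthD[OF Q(1)[unfolded lay_ok_def] i'] by blast
    then show "ivl (Qs1 ! i) (map (sigma_sharp E M \<sigma>) (map (\<lambda>n. nsharp E M n Xs) n) ! i)"
      using sigma_sharp_ivl neuron_sharp[OF _ Cons.prems(2)] i' by simp
  qed
  moreover obtain l ls where "net nss ns = l # ls" using net_Cons(1) by blast
  ultimately show ?case using Cons.IH[OF Q(2)] unfolding net_Cons(2) by simp
qed

lemma net_eval_net:
  assumes "hidden_ok \<sigma> nss Qs Qs'" "list_all2 (neuron_ok Qs') ns Ps" "sat Qs xs"
  shows "\<exists>ys. net_eval E M \<sigma> (net nss ns) (map Num xs) = map Num ys \<and> sat Ps ys"
proof -
  have layer: "\<exists>ys. map g ns = map Num ys \<and> sat Ps ys"
    if "list_all2 (\<lambda>n P. \<exists>y\<in>F. P y \<and> g n = Num y) ns Ps" for g :: "neuron \<Rightarrow> xfloat" and ns Ps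
    using that
  proof (induction rule: list_all2_induct)
    case (Cons n ns P Ps)
    then obtain y ys where "y \<in> F" "P y" "g n = Num y" "map g ns = map Num ys" "sat Ps ys" by auto
    then show ?case by (intro exI[of _ "y # ys"]) (auto simp: sat_def)
  qed (simp add: sat_def)
  show ?thesis using assms(1,3)
  proof (induction nss arbitrary: Qs xs)
    case Nil
    have L: "list_all2 (\<lambda>n P. \<exists>y\<in>F. P y \<and> neval E M n (map Num xs) = Num y) ns Ps"
      using assms(2) by (rule list_all2_mono) (use Nil in \<open>auto simp: neuron_ok_def\<close>)
    from layer[OF L] show ?case by (simp add: net_Nil aff_mk)
  next
    case (Cons n nss)
    then obtain Qs1 where Q: "lay_ok \<sigma> Qs n Qs1" "hidden_ok \<sigma> nss Qs1 Qs'" by auto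
    have L: "list_all2 (\<lambda>n P. \<exists>y\<in>F. P y \<and> \<sigma> (neval E M n (map Num xs)) = Num y) n Qs1"
      using Q(1) unfolding lay_ok_def
    proof (rule list_all2_mono)
      fix m Q' assume "\<exists>P. neuron_ok Qs m P \<and> sig_ok \<sigma> P Q'"
      then obtain P where P: "neuron_ok Qs m P" "sig_ok \<sigma> P Q'" by auto
      then obtain y where "y \<in> F" "P y" "neval E M m (map Num xs) = Num y"
        using Cons.prems(2) unfolding neuron_ok_def by blast
      moreover from this P(2) obtain t where "t \<in> F" "\<sigma> (Num y) = Num t" "Q' t" unfolding sig_ok_def by blast
      ultimately show "\<exists>y\<in>F. Q' y \<and> \<sigma> (neval E M m (map Num xs)) = Num y" by (intro bexI[of _ t]) simp_all
    qed
    from layer[OF L] obtain ys where ys: "map (\<lambda>m. \<sigma> (neval E M m (map Num xs))) n = map Num ys" "sat Qs1 ys" by auto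
    obtain l ls where "net nss ns = l # ls" using net_Cons(1) by blast
    have "map \<sigma> (aff E M (mk_layer n) (map Num xs)) = map Num ys" using ys(1) unfolding aff_mk map_map comp_def .
    then have "net_eval E M \<sigma> (net (n # nss) ns) (map Num xs) = net_eval E M \<sigma> (net nss ns) (map Num ys)"
      unfolding net_Cons(2) \<open>net nss ns = l # ls\<close> by simp
    then show ?case using Cons.IH[OF Q(2) ys(2)] by simp
  qed
qed

text \<open>\<open>xsum\<close> starts with its first term, \<open>run\<close> with 0; the two agree
  because adding a float to 0 is exact.\<close>

lemma neval_run:
  assumes "length row = length xs" "\<forall>i < length xs. \<bar>xs ! i * row ! i\<bar> \<le> Omega E M"
    and r: "run 0 (map2 (\<lambda>x w. fr (x * w)) xs row @ [b]) r"
  shows "neval E M (row, b) (map Num xs) = Num r"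
proof -
  define ts where "ts = map2 (\<lambda>x w. fr (x * w)) xs row"
  have t: "map2 (\<lambda>x w. xmul E M x (Num w)) (map Num xs) row = map Num ts"
    unfolding ts_def using assms(1,2) by (intro nth_equalityI) (auto simp: rnd_fr)
  have "set ts \<subseteq> F" by (auto simp: ts_def)
  moreover obtain a where "run 0 ts a" "run a [b] r" using r unfolding ts_def run_append by blast
  ultimately have "xsum E M (map Num ts) = Num a" 
    using run_xadd[of "hd ts" "tl ts" a] by (cases ts) auto
  then show ?thesis unfolding neval_def fst_conv snd_conv t using run_xadd[OF \<open>run a [b] r\<close>] by simp
qed

lemma neuron_ok_single:
  assumes j: "j < length Qs" and cb: "c \<in> F" "b \<in> F"
    and P: "\<And>x. x \<in> F \<Longrightarrow> (Qs ! j) x \<Longrightarrow> \<bar>x * c\<bar> \<le> Omega E M \<and> (\<exists>r\<in>F. P r \<and> run (fr (x * c)) [b] r)"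
  shows "neuron_ok Qs (replicate j 0 @ c # replicate (length Qs - j - 1) 0, b) P"
  unfolding neuron_ok_def fst_conv snd_conv
proof (intro conjI allI impI)
  let ?row = "replicate j 0 @ c # replicate (length Qs - j - 1) 0 :: real list"
  show len: "length ?row = length Qs" using j by simp
  show "set ?row \<subseteq> F" using cb by auto
  show "b \<in> F" by (rule cb)
  fix xs assume xs: "sat Qs xs"
  have lx: "length xs = length Qs" using xs by (auto simp: sat_def dest: list_all2_lengthD)
  have "xs ! j \<in> F" "(Qs ! j) (xs ! j)" using xs j by (auto simp: sat_def list_all2_conv_all_nth)
  then obtain r where r: "\<bar>xs ! j * c\<bar> \<le> Omega E M" "r \<in> F" "P r" "run (fr (xs ! j * c)) [b] r" using P by blast
  have xe: "xs = take j xs @ xs ! j # drop (Suc j) xs" using j lx by (intro id_take_nth_drop) simp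
  define z1 where "z1 = map2 (\<lambda>x w. fr (x * w)) (take j xs) (replicate j 0)"
  define z2 where "z2 = map2 (\<lambda>x w. fr (x * w)) (drop (Suc j) xs) (replicate (length Qs - j - 1) 0)"
  have z: "\<forall>t\<in>set z1. t = 0" "\<forall>t\<in>set z2. t = 0" by (auto simp: z1_def z2_def set_zip)
  have "map2 (\<lambda>x w. fr (x * w)) xs ?row = z1 @ fr (xs ! j * c) # z2"
    using j lx by (subst xe) (simp add: z1_def z2_def)
  moreover have "run 0 (z1 @ fr (xs ! j * c) # z2) (fr (xs ! j * c))"
    unfolding run_append using run_zeros[OF _ z(1), of 0] run_zeros[OF _ z(2), of "fr (xs ! j * c)"] F_le_Omega
    by (intro exI[of _ 0]) auto
  ultimately have "run 0 (map2 (\<lambda>x w. fr (x * w)) xs ?row @ [b]) r" using r(4) run_append by metis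
  moreover have "\<forall>i < length xs. \<bar>xs ! i * ?row ! i\<bar> \<le> Omega E M"
  proof (intro allI impI)
    fix i assume "i < length xs"
    have "?row ! i = (if i = j then c else 0)" using \<open>i < length xs\<close> j lx by (auto simp: nth_append nth_Cons')
    then show "\<bar>xs ! i * ?row ! i\<bar> \<le> Omega E M" using r(1) F_le_Omega[of 0] by auto
  qed
  ultimately have "neval E M (?row, b) (map Num xs) = Num r" using len lx by (intro neval_run) auto
  then show "\<exists>y\<in>F. P y \<and> neval E M (?row, b) (map Num xs) = Num y" using r by blast
qed

lemma neuron_ok_const:
  assumes "b \<in> F" shows "neuron_ok Qs (replicate (length Qs) 0, b) (\<lambda>x. x = b)"
  unfolding neuron_ok_def fst_conv snd_conv
proof (intro conjI allI impI)
  show "length (replicate (length Qs) 0) = length Qs" "set (replicate (length Qs) 0) \<subseteq> F" "b \<in> F"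
    using assms by auto
  fix xs assume xs: "sat Qs xs"
  have lx: "length xs = length Qs" using xs by (auto simp: sat_def dest: list_all2_lengthD)
  have "\<forall>t \<in> set (map2 (\<lambda>x w. fr (x * w)) xs (replicate (length Qs) 0)). t = 0" by (auto simp: set_zip)
  then have "run 0 (map2 (\<lambda>x w. fr (x * w)) xs (replicate (length Qs) 0)) 0" by (intro run_zeros) auto
  then have "run 0 (map2 (\<lambda>x w. fr (x * w)) xs (replicate (length Qs) 0) @ [b]) b"
    unfolding run_append using assms F_le_Omega by (intro exI[of _ 0]) auto
  then have "neval E M (replicate (length Qs) 0, b) (map Num xs) = Num b"
    using lx F_le_Omega[of 0] by (intro neval_run) auto
  then show "\<exists>y\<in>F. y = b \<and> neval E M (replicate (length Qs) 0, b) (map Num xs) = Num y" using assms by blast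
qed

end

section \<open>Circuits of threshold gates\<close>

lemma map2_concat_pairs:
  "length us = length cs \<Longrightarrow> map2 f (concat (map (\<lambda>u. [u, s]) us) @ xs) (concat (map (\<lambda>c. [c, - c]) cs) @ ys) =
    concat (map2 (\<lambda>u c. [f u c, f s (- c)]) us cs) @ map2 f xs ys"
  for cs :: "real list"
  by (induction us cs rule: list_induct2) auto

lemma nth_concat_pairs: "j < length xs \<Longrightarrow> concat (map (\<lambda>x. [x, g x]) xs) ! (2 * j) = xs ! j"
proof (induction xs arbitrary: j)
  case (Cons x xs)
  then show ?case by (cases j) auto
qed simp

lemma length_concat_pairs: "length (concat (map (\<lambda>x. [x, g x]) xs)) = 2 * length xs"
  by (induction xs) auto

text \<open>\<open>None\<close> stands for a wire that may carry either truth value.\<close>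

definition compat :: "bool option \<Rightarrow> bool \<Rightarrow> bool" where
  "compat t b \<longleftrightarrow> t = None \<or> t = Some b"

context act
begin

definition preR :: "real \<Rightarrow> bool option \<Rightarrow> real \<Rightarrow> bool" where
  "preR R t r \<longleftrightarrow> (\<exists>b. compat t b \<and> pre R b r)"

definition postR :: "real \<Rightarrow> bool option \<Rightarrow> real \<Rightarrow> bool" where
  "postR R t u \<longleftrightarrow> (\<exists>b. compat t b \<and> near R b (sg * u))"

text \<open>For an unknown value the admissible set has a part on each side of the gap, yet it is
  order-convex among the floats because none lies strictly between \<eta> and
  \<open>\<eta>p\<close>.\<close>

lemma sig_ok_preR:
  assumes "0 \<le> R" shows "sig_ok \<sigma> (preR R t) (postR R t)"
  unfolding sig_ok_def
proof (intro conjI ballI impI)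
  fix a b x assume ab: "a \<in> F" "b \<in> F" "x \<in> F" "preR R t a \<and> preR R t b \<and> a \<le> x \<and> x \<le> b"
  have "x \<le> \<eta> \<or> \<eta>p \<le> x" using eta(4) ab(3) by force
  then have "pre R (\<eta>p \<le> x) x" using ab(4) assms eta(3) unfolding preR_def pre_def by (auto split: if_splits)
  moreover have "compat t (\<eta>p \<le> x)"
  proof (cases t)
    case (Some c)
    then have "pre R c a" "pre R c b" using ab(4) by (auto simp: preR_def compat_def)
    then have "c = (\<eta>p \<le> x)" using ab(4) eta(3) by (auto simp: pre_def split: if_splits)
    then show ?thesis using Some by (simp add: compat_def)
  qed (simp add: compat_def)
  ultimately show "preR R t x" unfolding preR_def by blast
next
  fix x assume x: "x \<in> F" "preR R t x"
  then obtain b where "compat t b" "pre R b x" by (auto simp: preR_def)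
  then show "\<exists>ta\<in>F. \<sigma> (Num x) = Num ta \<and> postR R t ta"
    using pre_near[OF x(1) _ assms] unfolding postR_def by blast
qed

text \<open>Every data wire is followed by a copy of \<open>\<sigma>(\<eta>)\<close>, which is subtracted before the next data
  wire is added, since sums are evaluated from left to right.\<close>
definition layout :: "(real \<times> real) list \<Rightarrow> (real \<Rightarrow> bool) list \<Rightarrow> (real \<Rightarrow> bool) list" where
  "layout ks Ds = concat (map (\<lambda>D. [D, \<lambda>x. x = s]) Ds) @ map (\<lambda>kv x. x = snd kv) ks"

lemma length_layout: "length (layout ks Ds) = 2 * length Ds + length ks"
  by (simp add: layout_def length_concat_pairs)

lemma sat_layout:
  assumes "sat (layout ks Ds) xs"
  obtains us where "xs = concat (map (\<lambda>u. [u, s]) us) @ map snd ks" "sat Ds us"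
proof -
  obtain xs1 xs2 where x: "xs = xs1 @ xs2" "sat (concat (map (\<lambda>D. [D, \<lambda>x. x = s]) Ds)) xs1"
    "sat (map (\<lambda>kv x. x = snd kv) ks) xs2"
    using assms unfolding sat_def layout_def by (auto simp: list_all2_append1)
  have "xs2 = map snd ks"
    using x(3) by (intro nth_equalityI) (auto simp: sat_def list_all2_conv_all_nth)
  moreover have "\<exists>us. xs1 = concat (map (\<lambda>u. [u, s]) us) \<and> sat Ds us"
    using x(2)
  proof (induction Ds arbitrary: xs1)
    case Nil
    then show ?case by (intro exI[of _ "[]"]) (simp add: sat_def)
  next
    case (Cons D Ds)
    then obtain u ys where u: "xs1 = u # s # ys" "u \<in> F" "D u" "sat (concat (map (\<lambda>D. [D, \<lambda>x. x = s]) Ds)) ys"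
      by (auto simp: sat_def list_all2_Cons1)
    from Cons.IH[OF u(4)] obtain us where "ys = concat (map (\<lambda>u. [u, s]) us)" "sat Ds us" by auto
    then show ?case using u by (intro exI[of _ "u # us"]) (auto simp: sat_def)
  qed
  ultimately show ?thesis using that x(1) by blast
qed

text \<open>Each data neuron gets a companion with zero weights and bias \<eta>, whose activation is
  the \<open>s\<close> of the layout. The other constants are regenerated in every layer in the same
  way.\<close>

definition widen :: "(real \<times> real) list \<Rightarrow> nat \<Rightarrow> neuron list \<Rightarrow> neuron list" where
  "widen ks k dn = concat (map (\<lambda>n. [n, (replicate k 0, \<eta>)]) dn) @ map (\<lambda>kv. (replicate k 0, fst kv)) ks"

definition good_consts :: "(real \<times> real) list \<Rightarrow> bool" where
  "good_consts ks \<longleftrightarrow> (\<forall>(k, v) \<in> set ks. k \<in> F \<and> v \<in> F \<and> \<sigma> (Num k) = Num v)"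

lemma good_consts_avails: "avails ts ks cs \<Longrightarrow> good_consts ks"
  unfolding good_consts_def avails_def avail_def by (fastforce simp: in_set_conv_nth)

lemma const_lay:
  assumes "k \<in> F" "v \<in> F" "\<sigma> (Num k) = Num v"
  shows "\<exists>P. neuron_ok Qs (replicate (length Qs) 0, k) P \<and> sig_ok \<sigma> P (\<lambda>x. x = v)"
  using neuron_ok_const[OF assms(1)] assms by (intro exI[of _ "\<lambda>x. x = k"]) (auto simp: sig_ok_def)

lemma lay_ok_widen:
  assumes "list_all2 (\<lambda>n D. \<exists>P. neuron_ok Qs n P \<and> sig_ok \<sigma> P D) dn Ds" "good_consts ks"
  shows "lay_ok \<sigma> Qs (widen ks (length Qs) dn) (layout ks Ds)"
proof -
  have "list_all2 (\<lambda>n D. \<exists>P. neuron_ok Qs n P \<and> sig_ok \<sigma> P D)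
      (concat (map (\<lambda>n. [n, (replicate (length Qs) 0, \<eta>)]) dn)) (concat (map (\<lambda>D. [D, \<lambda>x. x = s]) Ds))"
    using assms(1)
  proof (induction rule: list_all2_induct)
    case (Cons n ns D Ds)
    then show ?case using const_lay[OF eta(1) s_F(1) s(1), of Qs] by simp
  qed simp
  moreover have "list_all2 (\<lambda>n D. \<exists>P. neuron_ok Qs n P \<and> sig_ok \<sigma> P D)
      (map (\<lambda>kv. (replicate (length Qs) 0, fst kv)) ks) (map (\<lambda>kv x. x = snd kv) ks)"
    using assms(2) const_lay[of _ _ Qs]
    by (induction ks) (auto simp: good_consts_def)
  ultimately show ?thesis unfolding lay_ok_def widen_def layout_def by (intro list_all2_appendI)
qed

definition signed :: "bool \<Rightarrow> real list \<Rightarrow> real list" where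
  "signed pol ts = (if pol then map uminus ts else ts)"

text \<open>A companion has the negated weight of its data wire, so that a selected pair contributes
  \<open>offset_terms\<close> up to the sign \<open>pol\<close>, and an unselected one only
  zeros.\<close>

definition drow :: "bool \<Rightarrow> nat set \<Rightarrow> nat \<Rightarrow> real list \<Rightarrow> real list" where
  "drow pol Sel N cs = concat (map (\<lambda>c. [c, - c])
     (map (\<lambda>i. if i \<in> Sel then (if pol then - (sg * w) else sg * w) else 0) [0..<N])) @ signed pol cs"

lemma run_skip:
  assumes "run a (concat (map g (filter P xs)) @ rest) b" "a \<in> F"
  shows "run a (concat (map (\<lambda>i. if P i then g i else [0, 0]) xs) @ rest) b"
  using assms
proof (induction xs arbitrary: a)
  case (Cons x xs)
  show ?case
  proof (cases "P x")
    case True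
    then have "run a (g x @ (concat (map g (filter P xs)) @ rest)) b" using Cons.prems by simp
    then obtain c where c: "run a (g x) c" "run c (concat (map g (filter P xs)) @ rest) b"
      unfolding run_append[of _ "g x"] by blast
    have "c \<in> F" using run_F c Cons.prems by blast
    then have "run a (g x @ (concat (map (\<lambda>i. if P i then g i else [0, 0]) xs) @ rest)) b"
      using c Cons.IH[of c] unfolding run_append[of _ "g x"] by blast
    then show ?thesis using True by simp
  next
    case False
    then have "run a (concat (map (\<lambda>i. if P i then g i else [0, 0]) xs) @ rest) b" using Cons by simp
    then show ?thesis using False Cons.prems(2) F_le_Omega by simp
  qed
qed simp

lemma neuron_ok_drow:
  assumes ks: "avails T ks cs" "set cs \<subseteq> F" and b: "bias \<in> F"
    and P: "\<And>us. sat Ds us \<Longrightarrow> \<exists>r\<in>F. P r \<and>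
      run 0 (signed pol (concat (map (\<lambda>i. offset_terms (sg * us ! i)) (filter (\<lambda>i. i \<in> Sel) [0..<length Ds])) @ T) @ [bias]) r"
  shows "neuron_ok (layout ks Ds) (drow pol Sel (length Ds) cs, bias) P"
  unfolding neuron_ok_def fst_conv snd_conv
proof (intro conjI allI impI)
  define N where "N = length Ds"
  define co where "co = (\<lambda>i. if i \<in> Sel then (if pol then - (sg * w) else sg * w) else 0)"
  have row: "drow pol Sel (length Ds) cs = concat (map (\<lambda>c. [c, - c]) (map co [0..<N])) @ signed pol cs"
    by (simp only: drow_def co_def N_def)
  have hF: "co i \<in> F" for i using w_F by (auto simp: co_def)
  have lk: "length ks = length cs" "length T = length cs" using ks(1) by (auto simp: avails_def)
  have lcs: "length (signed pol cs) = length cs" by (simp add: signed_def)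
  show len: "length (drow pol Sel (length Ds) cs) = length (layout ks Ds)"
    unfolding row length_layout by (simp only: length_append length_concat_pairs lcs) (simp add: N_def lk)
  show "set (drow pol Sel (length Ds) cs) \<subseteq> F" unfolding row using hF ks(2) by (auto simp: signed_def)
  show "bias \<in> F" by (rule b)
  fix xs assume xs: "sat (layout ks Ds) xs"
  obtain us where us: "xs = concat (map (\<lambda>u. [u, s]) us) @ map snd ks" "sat Ds us" using sat_layout[OF xs] .
  have lu: "length us = N" using us(2) by (auto simp: sat_def N_def dest: list_all2_lengthD)
  have uF: "us ! i \<in> F" if "i < N" for i using us(2) that by (auto simp: sat_def list_all2_conv_all_nth N_def)
  obtain r where r: "r \<in> F" "P r"
    "run 0 (signed pol (concat (map (\<lambda>i. offset_terms (sg * us ! i)) (filter (\<lambda>i. i \<in> Sel) [0..<N])) @ T) @ [bias]) r"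
    using P[OF us(2)] unfolding N_def by blast
  have "fr (snd (ks ! i) * cs ! i) = T ! i" if "i < length T" for i
    using ks(1) that by (cases "ks ! i") (force simp: avails_def avail_def)
  then have "map2 (\<lambda>x w. fr (x * w)) (map snd ks) (signed pol cs) = signed pol T"
    using lk by (intro nth_equalityI) (auto simp: signed_def)
  moreover have "map2 (\<lambda>u c. [fr (u * c), fr (s * - c)]) us (map co [0..<N]) =
      map (\<lambda>i. if i \<in> Sel then signed pol (offset_terms (sg * us ! i)) else [0, 0]) [0..<N]"
  proof (rule nth_equalityI)
    fix i assume "i < length (map2 (\<lambda>u c. [fr (u * c), fr (s * - c)]) us (map co [0..<N]))"
    then have i: "i < N" using lu by simp
    have e: "us ! i * (sg * w) = sg * us ! i * w" "s * (sg * w) = S * w" by (auto simp: S_def)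
    have "fr (us ! i * (sg * w)) = fr (sg * us ! i * w)" "fr (s * (sg * w)) = B" unfolding B_def e by simp_all
    then show "map2 (\<lambda>u c. [fr (u * c), fr (s * - c)]) us (map co [0..<N]) ! i =
      map (\<lambda>i. if i \<in> Sel then signed pol (offset_terms (sg * us ! i)) else [0, 0]) [0..<N] ! i"
      using i lu by (auto simp: co_def signed_def offset_terms_def)
  qed (use lu in simp)
  ultimately have m2: "map2 (\<lambda>x w. fr (x * w)) xs (drow pol Sel (length Ds) cs) =
      concat (map (\<lambda>i. if i \<in> Sel then signed pol (offset_terms (sg * us ! i)) else [0, 0]) [0..<N]) @ signed pol T"
    unfolding us(1) row using lu by (subst map2_concat_pairs) auto
  have "signed pol (concat (map (\<lambda>i. offset_terms (sg * us ! i)) (filter (\<lambda>i. i \<in> Sel) [0..<N])) @ T) =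
      concat (map (\<lambda>i. signed pol (offset_terms (sg * us ! i))) (filter (\<lambda>i. i \<in> Sel) [0..<N])) @ signed pol T"
    by (auto simp: signed_def map_concat comp_def)
  then have "run 0 (map2 (\<lambda>x w. fr (x * w)) xs (drow pol Sel (length Ds) cs) @ [bias]) r"
    unfolding m2 append_assoc using r(3) by (intro run_skip) auto
  moreover have "\<forall>i < length xs. \<bar>xs ! i * drow pol Sel (length Ds) cs ! i\<bar> \<le> Omega E M"
  proof -
    have "\<bar>x * c\<bar> \<le> Omega E M" if xc: "(x, c) \<in> set (zip xs (drow pol Sel (length Ds) cs))" for x c
    proof -
      have z: "zip xs (drow pol Sel (length Ds) cs) = concat (map2 (\<lambda>u c. [(u, c), (s, - c)]) us (map co [0..<N])) @ zip (map snd ks) (signed pol cs)"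
        using map2_concat_pairs[of us "map co [0..<N]" Pair s "map snd ks" "signed pol cs"] lu unfolding us(1) row
        by simp
      consider i where "i < N" "x = us ! i \<or> x = s" "c = co i \<or> c = - co i"
        | i where "i < length ks" "x = snd (ks ! i)" "c = signed pol cs ! i"
        using xc unfolding z by (force simp: set_zip lu lk lcs)
      then show ?thesis
      proof cases
        case 1
        have "x \<in> F" using 1 uF s_F by auto
        then have "\<bar>x * w\<bar> \<le> Omega E M" by (rule scale_Omega)
        moreover have "c = 0 \<or> c = sg * w \<or> c = - (sg * w)" using 1 by (auto simp: co_def split: if_splits)
        ultimately show ?thesis using sg_cases(2) F_le_Omega[of 0] by (auto simp: abs_mult mult.left_commute)
      next
        case 2
        have "avail (T ! i) (ks ! i) (cs ! i)" using 2 ks(1) by (simp add: avails_def)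
        then have "\<bar>snd (ks ! i) * cs ! i\<bar> \<le> Omega E M" by (auto simp: avail_def split: prod.splits)
        then show ?thesis using 2 lk by (auto simp: signed_def)
      qed
    qed
    moreover have "length xs = length (drow pol Sel (length Ds) cs)"
      using xs len by (auto simp: sat_def dest: list_all2_lengthD)
    ultimately show ?thesis by (metis (no_types, lifting) in_set_zip fst_conv snd_conv)
  qed
  moreover have "length (drow pol Sel (length Ds) cs) = length xs"
    using xs len by (auto simp: sat_def dest: list_all2_lengthD)
  ultimately have "neval E M (drow pol Sel (length Ds) cs, bias) (map Num xs) = Num r" by (intro neval_run)
  then show "\<exists>y\<in>F. P y \<and> neval E M (drow pol Sel (length Ds) cs, bias) (map Num xs) = Num y" using r by blast
qed

end

text \<open>Kleene's three-valued disjunction and negation, with \<^const>\<open>None\<close> as the unknown value.\<close>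

definition kor :: "bool option set \<Rightarrow> bool option" where
  "kor A = (if Some True \<in> A then Some True else if A \<subseteq> {Some False} then Some False else None)"

definition gate :: "bool \<times> nat set \<Rightarrow> ('p \<Rightarrow> bool option) list \<Rightarrow> 'p \<Rightarrow> bool option" where
  "gate g ts p = (let v = kor ((\<lambda>i. (ts ! i) p) ` snd g) in if fst g then map_option Not v else v)"

lemma kor_compat: "(\<And>i. i \<in> I \<Longrightarrow> compat (t i) (b i)) \<Longrightarrow> compat (kor (t ` I)) (\<exists>i\<in>I. b i)"
proof -
  assume c: "\<And>i. i \<in> I \<Longrightarrow> compat (t i) (b i)"
  consider (T) i where "i \<in> I" "t i = Some True" | (F) "Some True \<notin> t ` I" "t ` I \<subseteq> {Some False}"
    | (N) "Some True \<notin> t ` I" "\<not> t ` I \<subseteq> {Some False}" by force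
  then show ?thesis
  proof cases
    case T
    then have "kor (t ` I) = Some True" by (force simp: kor_def)
    moreover have "b i" using c[OF T(1)] T(2) by (simp add: compat_def)
    ultimately show ?thesis using T(1) by (auto simp: compat_def)
  next
    case F
    then have "\<not> b i" if "i \<in> I" for i using c[OF that] that by (auto simp: compat_def)
    then show ?thesis using F by (auto simp: compat_def kor_def)
  next
    case N
    then show ?thesis by (simp add: compat_def kor_def)
  qed
qed

locale builder = act +
  fixes ks :: "(real \<times> real) list" and cF cC :: "real list" and b0 :: real and inp :: "'p \<Rightarrow> (real \<Rightarrow> bool) list"
    and d :: nat
  assumes b0: "- (3 / 4) * h \<le> b0" "b0 \<le> - (9 / 16) * h"
    and av: "avails (threshold_terms b0) ks cF" "avails (threshold_terms 0) ks cC"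
    and inp: "length (inp p) = d"
begin

text \<open>The order of quantifiers matters: the same hidden layers serve every \<open>p\<close>,
  while the three-valued meaning of a wire depends on the box given by \<open>p\<close>.\<close>

definition realized :: "real \<Rightarrow> ('p \<Rightarrow> bool option) list \<Rightarrow> bool" where
  "realized R ts \<longleftrightarrow> (\<exists>nss. \<forall>p. hidden_ok \<sigma> nss (inp p) (layout ks (map (\<lambda>t. postR R (t p)) ts)))"

lemma constants_good: "good_consts ks" "set cF \<subseteq> F" "set cC \<subseteq> F"
  using good_consts_avails[OF av(1)] av by (fastforce simp: avails_def avail_def in_set_conv_nth)+

lemma realized_step:
  assumes r: "realized R ts" and R': "0 \<le> R'"
    and ok: "\<And>p. list_all2 (\<lambda>n t. neuron_ok (layout ks (map (\<lambda>t. postR R (t p)) ts)) n (preR R' (t p))) dn ts'"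
  shows "realized R' ts'"
proof -
  obtain nss where nss: "\<And>p. hidden_ok \<sigma> nss (inp p) (layout ks (map (\<lambda>t. postR R (t p)) ts))"
    using r by (auto simp: realized_def)
  have "lay_ok \<sigma> (layout ks (map (\<lambda>t. postR R (t p)) ts)) (widen ks (2 * length ts + length ks) dn)
      (layout ks (map (\<lambda>t. postR R' (t p)) ts'))" for p
  proof -
    have "list_all2 (\<lambda>n D. \<exists>P. neuron_ok (layout ks (map (\<lambda>t. postR R (t p)) ts)) n P \<and> sig_ok \<sigma> P D) dn
        (map (\<lambda>t. postR R' (t p)) ts')"
      unfolding list_all2_map2 by (rule list_all2_mono[OF ok[of p]]) (use sig_ok_preR[OF R'] in blast)
    from lay_ok_widen[OF this constants_good(1)] show ?thesis by (simp add: length_layout)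
  qed
  then have "\<forall>p. hidden_ok \<sigma> (nss @ [widen ks (2 * length ts + length ks) dn]) (inp p) (layout ks (map (\<lambda>t. postR R' (t p)) ts'))"
    using nss hid_snoc by blast
  then show ?thesis unfolding realized_def by blast
qed

lemma sat_postR: "sat (map (\<lambda>t. postR R (t p)) ts) us \<longleftrightarrow>
    length us = length ts \<and> (\<forall>i < length ts. us ! i \<in> F \<and> postR R ((ts ! i) p) (us ! i))"
  by (auto simp: sat_def list_all2_conv_all_nth)

lemma filter_single: "i < N \<Longrightarrow> filter (\<lambda>j. j \<in> {i}) [0..<N] = [i]"
proof -
  assume i: "i < N"
  have "[0..<N] = [0..<i] @ i # [Suc i..<N]"
    using i by (metis upt_conv_Cons upt_add_eq_append le_add_diff_inverse less_imp_le_nat le0)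
  then show ?thesis by (auto simp: filter_empty_conv)
qed

lemma realized_contract:
  assumes p: "kh \<le> p" "p < e1" and r: "realized (4 * p2 p) ts" shows "realized (2 * p2 p) ts"
proof (rule realized_step[OF r])
  show "0 \<le> 2 * p2 p" by simp
  fix x
  let ?Ds = "map (\<lambda>t. postR (4 * p2 p) (t x)) ts"
  show "list_all2 (\<lambda>n t. neuron_ok (layout ks ?Ds) n (preR (2 * p2 p) (t x)))
      (map (\<lambda>i. (drow False {i} (length ts) cC, \<eta>)) [0..<length ts]) ts"
  proof (rule list_all2_all_nthI)
    fix i assume "i < length (map (\<lambda>i. (drow False {i} (length ts) cC, \<eta>)) [0..<length ts])"
    then have i: "i < length ts" by simp
    have "neuron_ok (layout ks ?Ds) (drow False {i} (length ?Ds) cC, \<eta>) (preR (2 * p2 p) ((ts ! i) x))"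
    proof (rule neuron_ok_drow[OF av(2) constants_good(3) eta(1)])
      fix us assume "sat ?Ds us"
      then have u: "us ! i \<in> F" "postR (4 * p2 p) ((ts ! i) x) (us ! i)" using i unfolding sat_postR by auto
      then obtain b where b: "compat ((ts ! i) x) b" "near (4 * p2 p) b (sg * us ! i)" by (auto simp: postR_def)
      obtain r where r: "r \<in> F" "run 0 (offset_terms (sg * us ! i) @ threshold_terms 0 @ [\<eta>]) r" "pre (2 * p2 p) b r"
        using run_contract[OF p sg_cases(4)[OF u(1)] b(2)] by blast
      then show "\<exists>r\<in>F. preR (2 * p2 p) ((ts ! i) x) r \<and> run 0 (signed False (concat (map (\<lambda>i. offset_terms (sg * us ! i))
          (filter (\<lambda>j. j \<in> {i}) [0..<length ?Ds])) @ threshold_terms 0) @ [\<eta>]) r"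
        unfolding length_map filter_single[OF i] using b(1) by (intro bexI[of _ r]) (auto simp: preR_def signed_def)
    qed
    then show "neuron_ok (layout ks ?Ds) (map (\<lambda>i. (drow False {i} (length ts) cC, \<eta>)) [0..<length ts] ! i)
        (preR (2 * p2 p) ((ts ! i) x))" using i by simp
  qed simp
qed

text \<open>Each layer lowers the exponent of the radius by one, so \<open>n + 1\<close> layers are
  used.\<close>

lemma realized_contracts:
  assumes "realized (4 * p2 (kh + int n)) ts" "kh + int n < e1" shows "realized (2 * h) ts"
  using assms
proof (induction n)
  case 0
  then show ?case using realized_contract[of kh ts] by (simp add: h_def)
next
  case (Suc n)
  then have "realized (2 * p2 (kh + int (Suc n))) ts" by (intro realized_contract) auto
  moreover have "2 * p2 (kh + int (Suc n)) = 4 * p2 (kh + int n)" using p2_Suc[of "kh + int n"] by (simp add: algebra_simps)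
  ultimately show ?case using Suc by simp
qed

lemma pre_0: "pre 0 b (if b then \<eta>p else \<eta>)"
  by (simp add: pre_def)

lemma realized_final:
  assumes r: "realized (2 * h) ts" and len: "length pols = length ts"
  shows "realized 0 (map2 (\<lambda>pol t p. if pol then map_option Not (t p) else t p) pols ts)"
proof (rule realized_step[OF r])
  fix x
  let ?Ds = "map (\<lambda>t. postR (2 * h) (t x)) ts"
  let ?n = "\<lambda>i. (drow (pols ! i) {i} (length ts) cF, if pols ! i then \<eta> else \<eta>p)"
  let ?ts' = "map2 (\<lambda>pol t p. if pol then map_option Not (t p) else t p) pols ts"
  show "list_all2 (\<lambda>n t. neuron_ok (layout ks ?Ds) n (preR 0 (t x))) (map ?n [0..<length ts]) ?ts'"
  proof (rule list_all2_all_nthI)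
    fix i assume "i < length (map ?n [0..<length ts])"
    then have i: "i < length ts" by simp
    have "neuron_ok (layout ks ?Ds) (drow (pols ! i) {i} (length ?Ds) cF, if pols ! i then \<eta> else \<eta>p) (preR 0 ((?ts' ! i) x))"
    proof (rule neuron_ok_drow[OF av(1) constants_good(2)])
      show "(if pols ! i then \<eta> else \<eta>p) \<in> F" using eta by auto
      fix us assume "sat ?Ds us"
      then have u: "us ! i \<in> F" "postR (2 * h) ((ts ! i) x) (us ! i)" using i unfolding sat_postR by auto
      then obtain b where b: "compat ((ts ! i) x) b" "near (2 * h) b (sg * us ! i)" by (auto simp: postR_def)
      note rf = run_final[OF b0 sg_cases(4)[OF u(1)] b(2)]
      define c where "c = (b \<noteq> pols ! i)"
      have "compat ((?ts' ! i) x) c" using b(1) i len by (auto simp: compat_def c_def)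
      then have "preR 0 ((?ts' ! i) x) (if c then \<eta>p else \<eta>)" using pre_0[of c] unfolding preR_def by blast
      moreover have "(if c then \<eta>p else \<eta>) \<in> F" using eta by auto
      moreover have "run 0 (signed (pols ! i) (offset_terms (sg * us ! i) @ threshold_terms b0) @ [if pols ! i then \<eta> else \<eta>p]) (if c then \<eta>p else \<eta>)"
        using rf by (cases "pols ! i"; cases b) (auto simp: signed_def c_def)
      ultimately show "\<exists>r\<in>F. preR 0 ((?ts' ! i) x) r \<and> run 0 (signed (pols ! i) (concat (map (\<lambda>i. offset_terms (sg * us ! i))
          (filter (\<lambda>j. j \<in> {i}) [0..<length ?Ds])) @ threshold_terms b0) @ [if pols ! i then \<eta> else \<eta>p]) r"
        unfolding length_map filter_single[OF i] by (intro bexI[of _ "if c then \<eta>p else \<eta>"]) auto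
    qed
    then show "neuron_ok (layout ks ?Ds) (map ?n [0..<length ts] ! i) (preR 0 ((?ts' ! i) x))" using i by simp
  qed (use len in simp)
qed simp

text \<open>In a single evaluation even an unknown wire carries one of the two exact values, so the
  two-valued gate applies; Kleene's connective then describes all evaluations together.\<close>

lemma realized_gates:
  assumes r: "realized 0 ts" and gs: "\<forall>g \<in> set gs. snd g \<subseteq> {..<length ts} \<and> card (snd g) \<le> 2"
  shows "realized 0 (map (\<lambda>g. gate g ts) gs)"
proof (rule realized_step[OF r])
  fix x
  let ?Ds = "map (\<lambda>t. postR 0 (t x)) ts"
  let ?n = "\<lambda>g. (drow (fst g) (snd g) (length ts) cF, if fst g then \<eta> else \<eta>p)"
  show "list_all2 (\<lambda>n t. neuron_ok (layout ks ?Ds) n (preR 0 (t x))) (map ?n gs) (map (\<lambda>g. gate g ts) gs)"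
  proof (rule list_all2_all_nthI)
    fix j assume "j < length (map ?n gs)"
    then have j: "j < length gs" by simp
    obtain pol Sel where g: "gs ! j = (pol, Sel)" by (cases "gs ! j")
    have Sel: "Sel \<subseteq> {..<length ts}" "card Sel \<le> 2" using gs nth_mem[OF j] unfolding g by force+
    have "neuron_ok (layout ks ?Ds) (drow pol Sel (length ?Ds) cF, if pol then \<eta> else \<eta>p) (preR 0 (gate (pol, Sel) ts x))"
    proof (rule neuron_ok_drow[OF av(1) constants_good(2)])
      show "(if pol then \<eta> else \<eta>p) \<in> F" using eta by auto
      fix us assume "sat ?Ds us"
      then have "\<forall>i < length ts. us ! i \<in> F \<and> (\<exists>b. compat ((ts ! i) x) b \<and> near 0 b (sg * us ! i))"
        unfolding sat_postR by (auto simp: postR_def)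
      then obtain b where b: "\<And>i. i < length ts \<Longrightarrow> us ! i \<in> F"
        "\<And>i. i < length ts \<Longrightarrow> compat ((ts ! i) x) (b i)" "\<And>i. i < length ts \<Longrightarrow> near 0 (b i) (sg * us ! i)"
        by metis
      define fl where "fl = filter (\<lambda>i. i \<in> Sel) [0..<length ts]"
      have fl: "set fl = Sel" using Sel(1) by (auto simp: fl_def)
      have "length fl = card Sel" unfolding fl[symmetric] by (rule distinct_card[symmetric]) (simp add: fl_def)
      then have l2: "length fl \<le> 2" using Sel by simp
      define Us where "Us = map (\<lambda>i. (sg * us ! i, b i)) fl"
      have U: "length Us \<le> 2" "\<forall>(U, b) \<in> set Us. U \<in> F \<and> near 0 b U"
        using l2 fl Sel b sg_cases(4) by (auto simp: Us_def)
      have eqs: "concat (map (\<lambda>(U, b). offset_terms U) Us) = concat (map (\<lambda>i. offset_terms (sg * us ! i)) fl)"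
        "(\<exists>(U, b) \<in> set Us. b) = (\<exists>i\<in>Sel. b i)" using fl by (auto simp: Us_def comp_def)
      note rg = run_gate[OF b0 U, unfolded eqs]
      define c where "c = ((\<exists>i\<in>Sel. b i) \<noteq> pol)"
      have "compat (kor ((\<lambda>i. (ts ! i) x) ` Sel)) (\<exists>i\<in>Sel. b i)" using Sel b(2) by (intro kor_compat) auto
      then have "compat (gate (pol, Sel) ts x) c" by (auto simp: gate_def c_def compat_def Let_def)
      then have "preR 0 (gate (pol, Sel) ts x) (if c then \<eta>p else \<eta>)" using pre_0[of c] unfolding preR_def by blast
      moreover have "(if c then \<eta>p else \<eta>) \<in> F" using eta by auto
      moreover have "run 0 (signed pol (concat (map (\<lambda>i. offset_terms (sg * us ! i)) fl) @ threshold_terms b0) @ [if pol then \<eta> else \<eta>p]) (if c then \<eta>p else \<eta>)"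
        using rg by (cases pol; cases "\<exists>i\<in>Sel. b i") (auto simp: signed_def c_def)
      ultimately show "\<exists>r\<in>F. preR 0 (gate (pol, Sel) ts x) r \<and> run 0 (signed pol (concat (map (\<lambda>i. offset_terms (sg * us ! i))
          (filter (\<lambda>i. i \<in> Sel) [0..<length ?Ds])) @ threshold_terms b0) @ [if pol then \<eta> else \<eta>p]) r"
        unfolding length_map fl_def[symmetric] by (intro bexI[of _ "if c then \<eta>p else \<eta>"]) auto
    qed
    then show "neuron_ok (layout ks ?Ds) (map ?n gs ! j) (preR 0 ((map (\<lambda>g. gate g ts) gs ! j) x))" using j g by simp
  qed simp
qed simp

lemma kor_single [simp]: "kor {t} = t"
  by (cases t) (auto simp: kor_def)

lemma kor_insert: "kor {kor X, t} = kor (insert t X)"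
  by (cases t) (auto simp: kor_def)

text \<open>Each list \<open>S\<close> has an accumulator behind the wires \<open>ts\<close>, and
  every layer adds one more member of \<open>S\<close> to it by a gate of fan-in two. One-input
  gates copy \<open>ts\<close> forward, so that its wires stay available.\<close>

lemma realized_or_step:
  assumes "realized 0 ts" "\<forall>S \<in> set Ss. set S \<subseteq> {..<length ts}"
  shows "realized 0 (ts @ map (\<lambda>S p. kor ((\<lambda>i. (ts ! i) p) ` set (take k S))) Ss)"
proof (induction k)
  case 0
  let ?gs = "map (\<lambda>i. (False, {i})) [0..<length ts] @ map (\<lambda>S. (False, {})) Ss"
  have "realized 0 (map (\<lambda>g. gate g ts) ?gs)" using assms(1) by (rule realized_gates) auto
  moreover have "map (\<lambda>g. gate g ts) ?gs = ts @ map (\<lambda>S p. kor ((\<lambda>i. (ts ! i) p) ` set (take 0 S))) Ss"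
    by (intro nth_equalityI ext) (auto simp: nth_append gate_def fun_eq_iff)
  ultimately show ?case by (simp only:)
next
  case (Suc k)
  let ?us = "ts @ map (\<lambda>S p. kor ((\<lambda>i. (ts ! i) p) ` set (take k S))) Ss"
  \<comment> \<open>An exhausted list merely copies its accumulator.\<close>
  let ?g = "\<lambda>j. (False, if k < length (Ss ! j) then {length ts + j, Ss ! j ! k} else {length ts + j})"
  let ?gs = "map (\<lambda>i. (False, {i})) [0..<length ts] @ map ?g [0..<length Ss]"
  have Sk: "Ss ! j ! k < length ts" if "j < length Ss" "k < length (Ss ! j)" for j
  proof -
    have "Ss ! j ! k \<in> set (Ss ! j)" using that by simp
    then show ?thesis using assms(2) nth_mem[OF that(1)] by auto
  qed
  have "realized 0 (map (\<lambda>g. gate g ?us) ?gs)"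
    using Suc by (rule realized_gates) (use Sk in \<open>auto simp: card_insert_if trans_less_add1 split: if_splits\<close>)
  moreover have "map (\<lambda>g. gate g ?us) ?gs = ts @ map (\<lambda>S p. kor ((\<lambda>i. (ts ! i) p) ` set (take (Suc k) S))) Ss"
  proof (intro nth_equalityI ext)
    fix m p assume "m < length (map (\<lambda>g. gate g ?us) ?gs)"
    then have m: "m < length ts + length Ss" by simp
    show "(map (\<lambda>g. gate g ?us) ?gs ! m) p = ((ts @ map (\<lambda>S p. kor ((\<lambda>i. (ts ! i) p) ` set (take (Suc k) S))) Ss) ! m) p"
    proof (cases "m < length ts")
      case True
      then show ?thesis by (simp add: nth_append gate_def)
    next
      case False
      define j where "j = m - length ts"
      have j: "m = length ts + j" "j < length Ss" using m False by (auto simp: j_def)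
      show ?thesis
      proof (cases "k < length (Ss ! j)")
        case True
        then show ?thesis using j Sk[OF j(2) True] by (simp add: nth_append gate_def take_Suc_conv_app_nth kor_insert)
      next
        case False
        then show ?thesis using j by (simp add: nth_append gate_def)
      qed
    qed
  qed simp
  ultimately show ?case by simp
qed

text \<open>Once the longest list is exhausted all accumulators are complete; a last layer drops the
  copied wires and negates if required.\<close>

lemma realized_or:
  assumes "realized 0 ts" "\<forall>S \<in> set Ss. set S \<subseteq> {..<length ts}"
  shows "realized 0 (map (\<lambda>S p. let v = kor ((\<lambda>i. (ts ! i) p) ` set S) in if neg then map_option Not v else v) Ss)"
proof -
  define k where "k = Max (length ` set Ss)"
  have k: "take k S = S" if "S \<in> set Ss" for S using that by (simp add: k_def)
  let ?us = "ts @ map (\<lambda>S p. kor ((\<lambda>i. (ts ! i) p) ` set (take k S))) Ss"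
  let ?gs = "map (\<lambda>j. (neg, {length ts + j})) [0..<length Ss]"
  have "realized 0 (map (\<lambda>g. gate g ?us) ?gs)"
    using realized_or_step[OF assms, of k] by (rule realized_gates) auto
  moreover have "map (\<lambda>g. gate g ?us) ?gs =
      map (\<lambda>S p. let v = kor ((\<lambda>i. (ts ! i) p) ` set S) in if neg then map_option Not v else v) Ss"
    by (intro nth_equalityI ext) (auto simp: nth_append gate_def k)
  ultimately show ?thesis by simp
qed

end

section \<open>Separating boxes\<close>

context builder
begin

lemma realized_first:
  assumes "\<And>l. l \<in> set L \<Longrightarrow> i l < d \<and> c l \<in> F \<and> b l \<in> F \<and> (\<forall>p. \<forall>x\<in>F. (inp p ! i l) x \<longrightarrow>
      \<bar>x * c l\<bar> \<le> Omega E M \<and> (\<exists>r\<in>F. run (fr (x * c l)) [b l] r \<and> preR R (t l p) r))" "0 \<le> R"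
  shows "realized R (map t L)"
proof -
  let ?n = "\<lambda>l. (replicate (i l) 0 @ c l # replicate (d - i l - 1) 0, b l)"
  have "lay_ok \<sigma> (inp p) (widen ks (length (inp p)) (map ?n L)) (layout ks (map (\<lambda>t. postR R (t p)) (map t L)))" for p
  proof (intro lay_ok_widen constants_good list_all2_all_nthI)
    fix j assume "j < length (map ?n L)"
    then have j: "j < length L" "L ! j \<in> set L" by auto
    have "neuron_ok (inp p) (replicate (i (L ! j)) 0 @ c (L ! j) # replicate (length (inp p) - i (L ! j) - 1) 0, b (L ! j)) (preR R (t (L ! j) p))"
    proof (rule neuron_ok_single)
      note l = assms(1)[OF j(2)]
      show "i (L ! j) < length (inp p)" "c (L ! j) \<in> F" "b (L ! j) \<in> F" using l inp by auto
      show "\<bar>x * c (L ! j)\<bar> \<le> Omega E M \<and> (\<exists>r\<in>F. preR R (t (L ! j) p) r \<and> run (fr (x * c (L ! j))) [b (L ! j)] r)"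
        if "x \<in> F" "(inp p ! i (L ! j)) x" for x
        using l that by blast
    qed
    then show "\<exists>P. neuron_ok (inp p) (map ?n L ! j) P \<and> sig_ok \<sigma> P (map (\<lambda>t. postR R (t p)) (map t L) ! j)"
      using sig_ok_preR[OF assms(2)] j inp by auto
  qed simp
  then have "\<forall>p. hidden_ok \<sigma> [widen ks d (map ?n L)] (inp p) (layout ks (map (\<lambda>t. postR R (t p)) (map t L)))"
    using inp by simp
  then show ?thesis unfolding realized_def by blast
qed

lemma realized_literals:
  assumes "\<And>l. l \<in> set L \<Longrightarrow> i l < d \<and> c l \<in> F \<and> b l \<in> F \<and> (\<forall>p. \<forall>x\<in>F. (inp p ! i l) x \<longrightarrow>
      \<bar>x * c l\<bar> \<le> Omega E M \<and> (\<exists>r\<in>F. run (fr (x * c l)) [b l] r \<and> preR (p2 (e1 + 1)) (t l p) r))"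
  shows "realized 0 (map (\<lambda>l p. if pol l then map_option Not (t l p) else t l p) L)"
proof -
  have "realized (p2 (e1 + 1)) (map t L)" by (rule realized_first[OF assms]) auto
  \<comment> \<open>The starting radius of the literals is the largest one to which the contraction
    applies, that with \<open>p = e1 - 1\<close>.\<close>
  moreover have "p2 (e1 + 1) = 4 * p2 (kh + int (nat (e1 - 1 - kh)))"
    using p2_add[of "e1 - 1" 2] kh(7) exponent_bounds by (simp add: add.commute)
  ultimately have "realized (2 * h) (map t L)"
    using realized_contracts[of "nat (e1 - 1 - kh)"] kh(7) exponent_bounds by auto
  then have "realized 0 (map2 (\<lambda>pol t p. if pol then map_option Not (t p) else t p) (map pol L) (map t L))"
    by (rule realized_final) simp
  moreover have "map2 (\<lambda>pol t p. if pol then map_option Not (t p) else t p) (map pol L) (map t L) =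
      map (\<lambda>l p. if pol l then map_option Not (t l p) else t l p) L"
    by (induction L) auto
  ultimately show ?thesis by simp
qed

definition outP :: "bool option \<Rightarrow> real \<Rightarrow> bool" where
  "outP t y \<longleftrightarrow> (\<exists>b. compat t b \<and> y = (if b then S' else S))"

text \<open>Each output reads one data wire with weight \<open>sg\<close>. This is exact and orients
  the result, so that true yields the larger value \<open>S'\<close> also for an activation
  decreasing at \<eta>.\<close>

lemma realized_output:
  assumes "realized 0 ts"
  shows "\<exists>Ls. wf_net E M d Ls (length ts) \<and>
    (\<forall>p Xs. isat (inp p) Xs \<longrightarrow> isat (map (\<lambda>t. outP (t p)) ts) (net_sharp E M \<sigma> Ls Xs)) \<and>
    (\<forall>p xs. sat (inp p) xs \<longrightarrow> (\<exists>ys. net_eval E M \<sigma> Ls (map Num xs) = map Num ys \<and> sat (map (\<lambda>t. outP (t p)) ts) ys))"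
proof -
  obtain nss where nss: "\<And>p. hidden_ok \<sigma> nss (inp p) (layout ks (map (\<lambda>t. postR 0 (t p)) ts))"
    using assms by (auto simp: realized_def)
  define len where "len = 2 * length ts + length ks"
  let ?n = "\<lambda>k. (replicate (2 * k) 0 @ sg # replicate (len - 2 * k - 1) 0, 0) :: neuron"
  define ns where "ns = map ?n [0..<length ts]"
  have ok: "list_all2 (neuron_ok (layout ks (map (\<lambda>t. postR 0 (t p)) ts))) ns (map (\<lambda>t. outP (t p)) ts)" for p
  proof (rule list_all2_all_nthI)
    let ?Ds = "map (\<lambda>t. postR 0 (t p)) ts"
    fix k assume "k < length ns"
    then have k: "k < length ts" by (simp add: ns_def)
    have l: "length (layout ks ?Ds) = len" by (simp add: length_layout len_def)
    have nth: "layout ks ?Ds ! (2 * k) = postR 0 ((ts ! k) p)"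
      using k nth_concat_pairs[of k ?Ds "\<lambda>_ x. x = s"] unfolding layout_def
      by (subst nth_append) (simp add: length_concat_pairs del: map_map)
    have "neuron_ok (layout ks ?Ds) (replicate (2 * k) 0 @ sg # replicate (length (layout ks ?Ds) - 2 * k - 1) 0, 0) (outP ((ts ! k) p))"
    proof (rule neuron_ok_single)
      show "2 * k < length (layout ks ?Ds)" using k by (simp add: length_layout)
      fix x assume x: "x \<in> F" "(layout ks ?Ds ! (2 * k)) x"
      then obtain b where b: "compat ((ts ! k) p) b" "near 0 b (sg * x)" unfolding nth by (auto simp: postR_def)
      have xs: "x * sg = (if b then S' else S)" using b(2) by (auto simp: near_def mult.commute split: if_splits)
      then have xF: "x * sg \<in> F" using S_F by auto
      have "outP ((ts ! k) p) (x * sg)" unfolding outP_def xs using b(1) by blast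
      then show "\<bar>x * sg\<bar> \<le> Omega E M \<and> (\<exists>r\<in>F. outP ((ts ! k) p) r \<and> run (fr (x * sg)) [0] r)"
        using xF F_le_Omega[OF xF] by auto
    qed (use sg_cases in auto)
    then show "neuron_ok (layout ks ?Ds) (ns ! k) (map (\<lambda>t. outP (t p)) ts ! k)"
      unfolding l using k by (simp add: ns_def)
  qed (simp add: ns_def)
  have "length ns = length ts" by (simp add: ns_def)
  then have "wf_net E M d (net nss ns) (length ts)"
    using wf_net_net[OF nss ok, of undefined] inp by simp
  then show ?thesis using net_sharp_net[OF nss ok] net_eval_net[OF nss ok] by blast
qed

end

definition boxp :: "real \<Rightarrow> nat \<Rightarrow> real list \<Rightarrow> (real \<Rightarrow> bool) list" where
  "boxp \<delta> d p = map (\<lambda>i r. \<bar>r\<bar> \<le> 1 \<and> \<bar>p ! i - r\<bar> \<le> \<delta>) [0..<d]"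

section \<open>Tests separating two boxes, and the formula for the classes\<close>

context act
begin

definition separable :: "real set \<Rightarrow> real set \<Rightarrow> bool" where
  "separable X Y \<longleftrightarrow> (\<exists>c b \<beta> v. literal c b \<beta> \<and> (\<forall>x\<in>X. \<beta> x = v) \<and> (\<forall>x\<in>Y. \<beta> x = (\<not> v)))"

lemma separable_commute: "separable X Y \<Longrightarrow> separable Y X"
  unfolding separable_def by (metis (full_types))

text \<open>The threshold is the largest element of the lower set. Both sets are intervals of floats
  around their centres, so disjointness and \<open>a1 < a2\<close> force the whole second set above
  it.\<close>

lemma separating_literal_aux:
  fixes a1 a2 \<delta> :: real
  defines "N1 \<equiv> {r \<in> F. \<bar>r\<bar> \<le> 1 \<and> \<bar>a1 - r\<bar> \<le> \<delta>}" and "N2 \<equiv> {r \<in> F. \<bar>r\<bar> \<le> 1 \<and> \<bar>a2 - r\<bar> \<le> \<delta>}"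
  assumes a: "a1 \<in> N1" "a2 \<in> N2" "a1 < a2" "N1 \<inter> N2 = {}"
  shows "separable N1 N2"
proof -
  have fin: "finite N1" unfolding N1_def using F_finite by auto
  define z where "z = Max N1"
  have z: "z \<in> N1" "\<And>x. x \<in> N1 \<Longrightarrow> x \<le> z" unfolding z_def using fin a(1) by (auto intro: Max_in)
  have N2z: "z < y" if y: "y \<in> N2" for y
  proof (rule ccontr)
    assume "\<not> z < y"
    then have yz: "y \<le> z" by simp
    show False
    proof (cases "a1 \<le> y")
      case True
      then have "\<bar>a1 - y\<bar> \<le> \<delta>" using yz z(1) by (auto simp: N1_def)
      then have "y \<in> N1" using y by (auto simp: N1_def N2_def)
      then show False using y a(4) by auto
    next
      case False
      then have "\<bar>a2 - a1\<bar> \<le> \<delta>" using y a(3) by (auto simp: N2_def)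
      then have "a1 \<in> N2" using a(1) by (auto simp: N1_def N2_def)
      then show False using a(1,4) by auto
    qed
  qed
  define G where "G = {y \<in> F. z < y}"
  have G: "finite G" "a2 \<in> G" using F_finite N2z a(2) by (auto simp: G_def N2_def)
  define zp where "zp = Min G"
  have zp: "zp \<in> G" "\<And>y. y \<in> G \<Longrightarrow> zp \<le> y" unfolding zp_def using G by (auto intro: Min_in)
  have zF: "z \<in> F" "zp \<in> F" "z < zp" "\<forall>y\<in>F. \<not> (z < y \<and> y < zp)"
    using z(1) zp(1) zp(2) unfolding N1_def G_def by (auto simp: not_less[symmetric])
  have "\<bar>z\<bar> \<le> 1" "\<bar>zp\<bar> \<le> 1" using z(1) zp(2)[OF G(2)] zF(3) a(2) by (auto simp: N1_def N2_def)
  from threshold_literal[OF zF this] obtain c b up where "literal c b (\<lambda>x. (z < x) = up)" by blast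
  moreover have "\<forall>x\<in>N1. ((z < x) = up) = (\<not> up)" "\<forall>x\<in>N2. ((z < x) = up) = (\<not> \<not> up)" using z N2z by force+
  ultimately show ?thesis unfolding separable_def by blast
qed

lemma separating_literal:
  fixes a1 a2 \<delta> :: real
  assumes a: "a1 \<in> F" "\<bar>a1\<bar> \<le> 1" "a2 \<in> F" "\<bar>a2\<bar> \<le> 1" "0 \<le> \<delta>"
    and dis: "\<forall>r\<in>F. \<not> (\<bar>r\<bar> \<le> 1 \<and> \<bar>a1 - r\<bar> \<le> \<delta> \<and> \<bar>a2 - r\<bar> \<le> \<delta>)"
  shows "separable {r \<in> F. \<bar>r\<bar> \<le> 1 \<and> \<bar>a1 - r\<bar> \<le> \<delta>} {r \<in> F. \<bar>r\<bar> \<le> 1 \<and> \<bar>a2 - r\<bar> \<le> \<delta>}" (is "separable ?X ?Y")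
proof -
  have m: "a1 \<in> ?X" "a2 \<in> ?Y" using a by auto
  have e: "?X \<inter> ?Y = {}" using dis by auto
  have "a1 \<noteq> a2" using m e by auto
  then consider "a1 < a2" | "a2 < a1" by linarith
  then show ?thesis
  proof cases
    case 1
    show ?thesis using separating_literal_aux[OF m 1 e] .
  next
    case 2
    have "?Y \<inter> ?X = {}" using e by auto
    from separating_literal_aux[OF m(2,1) 2 this] show ?thesis by (rule separable_commute)
  qed
qed

definition tri :: "(real \<Rightarrow> bool) \<Rightarrow> real set \<Rightarrow> bool option" where
  "tri \<beta> N = (if \<forall>x\<in>N. \<beta> x then Some True else if \<forall>x\<in>N. \<not> \<beta> x then Some False else None)"

lemma tri_const: "N \<noteq> {} \<Longrightarrow> \<forall>x\<in>N. \<beta> x = v \<Longrightarrow> tri \<beta> N = Some v"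
  by (cases v) (auto simp: tri_def)

lemma tri_compat: "x \<in> N \<Longrightarrow> compat (tri \<beta> N) (\<beta> x)"
  by (auto simp: tri_def compat_def)

text \<open>\<open>G x\<close> conjoins the tests of \<open>x\<close> against all points of other
  classes. It is true on the box of \<open>x\<close>, false on every box of another class, and
  possibly unknown on boxes of the same class. In the disjunction over one class the unknowns are
  harmless: on a box of that class the disjunct of its own centre is true, on any other box all
  disjuncts are false.\<close>

lemma classifier_exists:
  fixes \<delta> :: real and D :: "real list set" and cl :: "real list \<Rightarrow> nat"
  assumes D: "finite D" "\<And>x i. x \<in> D \<Longrightarrow> i < d \<Longrightarrow> x ! i \<in> F \<and> \<bar>x ! i\<bar> \<le> 1" and \<delta>: "0 < \<delta>"
    and cl: "\<And>x. x \<in> D \<Longrightarrow> cl x < n"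
    and sep: "\<And>x y. x \<in> D \<Longrightarrow> y \<in> D \<Longrightarrow> cl x \<noteq> cl y \<Longrightarrow>
      \<exists>i<d. \<forall>r\<in>F. \<not> (\<bar>r\<bar> \<le> 1 \<and> \<bar>x ! i - r\<bar> \<le> \<delta> \<and> \<bar>y ! i - r\<bar> \<le> \<delta>)"
  defines "out p \<equiv> map (\<lambda>k y. y = (if k = cl p then S' else S)) [0..<n]"
  shows "\<exists>Ls. wf_net E M d Ls n \<and>
    (\<forall>p\<in>D. \<forall>Xs. isat (boxp \<delta> d p) Xs \<longrightarrow> isat (out p) (net_sharp E M \<sigma> Ls Xs)) \<and>
    (\<forall>p\<in>D. \<forall>xs. sat (boxp \<delta> d p) xs \<longrightarrow> (\<exists>ys. net_eval E M \<sigma> Ls (map Num xs) = map Num ys \<and> sat (out p) ys))"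
proof -
  obtain b0 ks cF cC where C: "- (3 / 4) * h \<le> b0" "b0 \<le> - (9 / 16) * h" "avails (threshold_terms b0) ks cF" "avails (threshold_terms 0) ks cC"
    using constants_exist by blast
  interpret builder E M \<sigma> c2 s2 \<eta> \<eta>p s s' lam sg ks cF cC b0 "boxp \<delta> d" d
    by unfold_locales (use C in \<open>auto simp: boxp_def\<close>)
  obtain dl where dl: "set dl = D" using finite_list[OF D(1)] by blast
  define PL where "PL = filter (\<lambda>(x, y). cl x \<noteq> cl y) (List.product dl dl)"
  have PL: "(x, y) \<in> set PL \<longleftrightarrow> x \<in> D \<and> y \<in> D \<and> cl x \<noteq> cl y" for x y
    by (auto simp: PL_def dl)
  define N where "N p i = {r \<in> F. \<bar>r\<bar> \<le> 1 \<and> \<bar>p ! i - r\<bar> \<le> \<delta>}" for p :: "real list" and i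
  have "\<exists>i c b \<beta> v. i < d \<and> literal c b \<beta> \<and> (\<forall>x\<in>N (fst q) i. \<beta> x = v) \<and> (\<forall>x\<in>N (snd q) i. \<beta> x = (\<not> v))"
    if q: "q \<in> set PL" for q
  proof -
    obtain x y where xy: "q = (x, y)" "x \<in> D" "y \<in> D" "cl x \<noteq> cl y" using q PL[of "fst q" "snd q"] by (metis prod.collapse)
    obtain i where i: "i < d" "\<forall>r\<in>F. \<not> (\<bar>r\<bar> \<le> 1 \<and> \<bar>x ! i - r\<bar> \<le> \<delta> \<and> \<bar>y ! i - r\<bar> \<le> \<delta>)"
      using sep[OF xy(2-4)] by blast
    have "x ! i \<in> F" "\<bar>x ! i\<bar> \<le> 1" "y ! i \<in> F" "\<bar>y ! i\<bar> \<le> 1" using D(2) xy i by auto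
    from separating_literal[OF this less_imp_le[OF \<delta>] i(2)]
    have "separable (N (fst q) i) (N (snd q) i)" unfolding N_def xy(1) by simp
    then show ?thesis using i(1) unfolding separable_def by blast
  qed
  then have "\<forall>q. \<exists>i c b \<beta> v. q \<in> set PL \<longrightarrow> i < d \<and> literal c b \<beta> \<and>
      (\<forall>x\<in>N (fst q) i. \<beta> x = v) \<and> (\<forall>x\<in>N (snd q) i. \<beta> x = (\<not> v))" by blast
  then obtain i c b \<beta> v where "\<forall>q. q \<in> set PL \<longrightarrow> i q < d \<and> literal (c q) (b q) (\<beta> q) \<and>
      (\<forall>x\<in>N (fst q) (i q). \<beta> q x = v q) \<and> (\<forall>x\<in>N (snd q) (i q). \<beta> q x = (\<not> v q))"
    unfolding choice_iff by blast
  then have L: "i q < d" "literal (c q) (b q) (\<beta> q)" "\<forall>x\<in>N (fst q) (i q). \<beta> q x = v q"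
    "\<forall>x\<in>N (snd q) (i q). \<beta> q x = (\<not> v q)" if "q \<in> set PL" for q
    using that by blast+
  define t where "t q p = tri (\<beta> q) (N p (i q))" for q p
  \<comment> \<open>Negation where \<open>v q\<close> holds orients all literals alike: false on the
    box of the first point, true on that of the second.\<close>
  define lit where "lit = (\<lambda>q p. if v q then map_option Not (t q p) else t q p)"
  have r1: "realized 0 (map lit PL)"
    unfolding lit_def
  proof (rule realized_literals)
    fix q assume q: "q \<in> set PL"
    have "\<bar>x * c q\<bar> \<le> Omega E M \<and> (\<exists>r\<in>F. run (fr (x * c q)) [b q] r \<and> preR (p2 (e1 + 1)) (t q p) r)"
      if x: "x \<in> F" "(boxp \<delta> d p ! i q) x" for p x
    proof -
      have x': "\<bar>x\<bar> \<le> 1" "\<bar>p ! i q - x\<bar> \<le> \<delta>" using x(2) L(1)[OF q] by (auto simp: boxp_def)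
      then have "compat (t q p) (\<beta> q x)" using x(1) unfolding t_def by (intro tri_compat) (simp add: N_def)
      then show ?thesis using L(2)[OF q] x(1) x'(1) unfolding literal_def preR_def by blast
    qed
    then show "i q < d \<and> c q \<in> F \<and> b q \<in> F \<and> (\<forall>p. \<forall>x\<in>F. (boxp \<delta> d p ! i q) x \<longrightarrow>
      \<bar>x * c q\<bar> \<le> Omega E M \<and> (\<exists>r\<in>F. run (fr (x * c q)) [b q] r \<and> preR (p2 (e1 + 1)) (t q p) r))"
      using L(1,2)[OF q] unfolding literal_def by blast
  qed
  have Nne: "N x j \<noteq> {}" if "x \<in> D" "j < d" for x j
    using D(2)[OF that] \<delta> by (auto simp: N_def intro!: exI[of _ "x ! j"])
  have lit: "lit (x, y) x = Some False" "lit (x, y) y = Some True" if "(x, y) \<in> set PL" for x y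
  proof -
    have "tri (\<beta> (x, y)) (N x (i (x, y))) = Some (v (x, y))"
      using L(3)[OF that] Nne[OF _ L(1)[OF that]] that by (intro tri_const) (auto simp: PL)
    moreover have "tri (\<beta> (x, y)) (N y (i (x, y))) = Some (\<not> v (x, y))"
      using L(4)[OF that] Nne[OF _ L(1)[OF that]] that by (intro tri_const) (auto simp: PL)
    ultimately show "lit (x, y) x = Some False" "lit (x, y) y = Some True" by (auto simp: lit_def t_def)
  qed
  define Ss where "Ss = map (\<lambda>x. filter (\<lambda>j. fst (PL ! j) = x) [0..<length PL]) dl"
  \<comment> \<open>A conjunction of negated literals, written as the NOR that the gates
    supply.\<close>
  define G where "G = (\<lambda>x p. map_option Not (kor ((\<lambda>y. lit (x, y) p) ` {y. (x, y) \<in> set PL})))"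
  have "realized 0 (map (\<lambda>S p. let u = kor ((\<lambda>j. (map lit PL ! j) p) ` set S) in if True then map_option Not u else u) Ss)"
    by (rule realized_or[OF r1]) (auto simp: Ss_def)
  moreover have "map (\<lambda>S p. let u = kor ((\<lambda>j. (map lit PL ! j) p) ` set S) in if True then map_option Not u else u) Ss = map G dl"
  proof -
    have "(\<lambda>j. (map lit PL ! j) p) ` set (filter (\<lambda>j. fst (PL ! j) = x) [0..<length PL]) =
        (\<lambda>y. lit (x, y) p) ` {y. (x, y) \<in> set PL}" for x p
    proof (intro equalityI subsetI)
      fix u assume "u \<in> (\<lambda>j. (map lit PL ! j) p) ` set (filter (\<lambda>j. fst (PL ! j) = x) [0..<length PL])"
      then obtain j where j: "j < length PL" "fst (PL ! j) = x" "u = lit (PL ! j) p" by auto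
      then have "PL ! j = (x, snd (PL ! j))" by (metis prod.collapse)
      moreover have "PL ! j \<in> set PL" using j by simp
      ultimately show "u \<in> (\<lambda>y. lit (x, y) p) ` {y. (x, y) \<in> set PL}" using j(3) by (metis (mono_tags) imageI mem_Collect_eq)
    next
      fix u assume "u \<in> (\<lambda>y. lit (x, y) p) ` {y. (x, y) \<in> set PL}"
      then obtain y where y: "(x, y) \<in> set PL" "u = lit (x, y) p" by auto
      then obtain j where "j < length PL" "PL ! j = (x, y)" by (auto simp: in_set_conv_nth)
      then show "u \<in> (\<lambda>j. (map lit PL ! j) p) ` set (filter (\<lambda>j. fst (PL ! j) = x) [0..<length PL])"
        using y(2) by (intro image_eqI[of _ _ j]) auto
    qed
    then show ?thesis by (simp add: Ss_def G_def Let_def comp_def)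
  qed
  ultimately have r2: "realized 0 (map G dl)" by (simp only:)
  have G: "G x p = Some True" if "x = p" "x \<in> D" for x p
    using that lit(1) by (auto simp: G_def kor_def)
  have G': "G x p = Some False" if "x \<in> D" "p \<in> D" "cl x \<noteq> cl p" for x p
  proof -
    have "(x, p) \<in> set PL" using that by (simp add: PL)
    then have "Some True \<in> (\<lambda>y. lit (x, y) p) ` {y. (x, y) \<in> set PL}" using lit(2) by force
    then show ?thesis by (simp add: G_def kor_def)
  qed
  define Ks where "Ks = map (\<lambda>k. filter (\<lambda>m. cl (dl ! m) = k) [0..<length dl]) [0..<n]"
  define ts where "ts = map (\<lambda>S p. let u = kor ((\<lambda>j. (map G dl ! j) p) ` set S) in if False then map_option Not u else u) Ks"
  have "realized 0 ts"
    unfolding ts_def by (rule realized_or[OF r2]) (auto simp: Ks_def)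
  moreover have len: "length ts = n" by (simp add: ts_def Ks_def)
  ultimately obtain Ls where Ls: "wf_net E M d Ls n"
    "\<And>p Xs. isat (boxp \<delta> d p) Xs \<Longrightarrow> isat (map (\<lambda>t. outP (t p)) ts) (net_sharp E M \<sigma> Ls Xs)"
    "\<And>p xs. sat (boxp \<delta> d p) xs \<Longrightarrow> \<exists>ys. net_eval E M \<sigma> Ls (map Num xs) = map Num ys \<and> sat (map (\<lambda>t. outP (t p)) ts) ys"
    using realized_output by metis
  have "map (\<lambda>t. outP (t p)) ts = out p" if p: "p \<in> D" for p
  proof (rule nth_equalityI)
    fix k assume "k < length (map (\<lambda>t. outP (t p)) ts)"
    then have k: "k < n" using len by simp
    have "(ts ! k) p = Some (k = cl p)"
    proof (cases "k = cl p")
      case True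
      obtain m where "m < length dl" "dl ! m = p" using p dl by (metis in_set_conv_nth)
      then have "Some True \<in> (\<lambda>j. (map G dl ! j) p) ` set (filter (\<lambda>m. cl (dl ! m) = k) [0..<length dl])"
        using G[OF refl p] True by (intro image_eqI[of _ _ m]) auto
      then show ?thesis using k True by (simp add: ts_def Ks_def kor_def)
    next
      case False
      have "G (dl ! m) p = Some False" if "m < length dl" "cl (dl ! m) = k" for m
        using that False p dl nth_mem[of m dl] by (intro G') auto
      then have "(\<lambda>j. (map G dl ! j) p) ` set (filter (\<lambda>m. cl (dl ! m) = k) [0..<length dl]) \<subseteq> {Some False}" by auto
      then have "kor ((\<lambda>j. (map G dl ! j) p) ` set (filter (\<lambda>m. cl (dl ! m) = k) [0..<length dl])) = Some False"
        unfolding kor_def by auto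
      then show ?thesis using k False by (simp add: ts_def Ks_def)
    qed
    then show "map (\<lambda>t. outP (t p)) ts ! k = out p ! k"
      using k len by (auto simp: out_def outP_def compat_def fun_eq_iff)
  qed (simp add: len out_def)
  then show ?thesis using Ls by metis
qed

end

section \<open>Robust classification\<close>

lemma eps_p2: "eps M = p2 (- int M - 1)"
  by (simp add: eps_def p2_def)

context fp
begin

text \<open>Finiteness of the extended floats provides a least one above \<open>x\<close>,
  antisymmetry makes it unique, so the definite description in \<open>xsucc\<close> denotes.\<close>

lemma xsucc_Num:
  assumes "x \<in> F" "xsucc E M (Num x) = Num y"
  shows "y \<in> F" "x < y" "\<forall>z\<in>F. \<not> (x < z \<and> z < y)"
proof -
  define P where "P y \<longleftrightarrow> y \<in> Fbar E M - {NaN} \<and> xlt (Num x) y \<and> (\<forall>z \<in> Fbar E M - {NaN}. xlt (Num x) z \<longrightarrow> xle y z)" for y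
  define G where "G = {y \<in> Fbar E M - {NaN}. xlt (Num x) y}"
  have "finite (Fbar E M)" using F_finite by (simp add: Fbar_def)
  then have fin: "finite (xval ` G)" by (simp add: G_def)
  have "PosInf \<in> G" by (simp add: G_def Fbar_def xlt_def)
  then have ne: "xval ` G \<noteq> {}" by auto
  obtain u where u: "u \<in> G" "xval u = Min (xval ` G)" using Min_in[OF fin ne] by auto
  have "P u" using u fin unfolding P_def by (auto simp: G_def xle_def)
  moreover have "v = u" if "P v" for v
    using that \<open>P u\<close> unfolding P_def by (meson xle_antisym)
  ultimately have "P (THE y. P y)" by (rule theI)
  then have "P (Num y)" using assms(2) by (simp add: xsucc_def P_def)
  then have y: "y \<in> F" "x < y" and least: "\<And>z. z \<in> Fbar E M - {NaN} \<Longrightarrow> xlt (Num x) z \<Longrightarrow> xle (Num y) z"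
    unfolding P_def by (auto simp: Fbar_def xlt_def)
  show "y \<in> F" "x < y" by fact+
  have "y \<le> z" if "z \<in> F" "x < z" for z
    using least[of "Num z"] that by (simp add: Fbar_def xlt_def)
  then show "\<forall>z\<in>F. \<not> (x < z \<and> z < y)" by force
qed

text \<open>(C2) offers its alternative separately for each pair of arguments, but the comparison of
  \<open>s\<close> with \<open>s'\<close> does not depend on the pair; \<open>sg\<close> records
  which alternative holds throughout.\<close>

lemma cond1_act:
  assumes \<sigma>: "\<forall>x \<in> Fbar E M. \<sigma> x \<in> Fbar E M" and c: "cond1 E M \<sigma>"
  obtains c2 s2 \<eta> \<eta>p s s' lam sg where "act E M \<sigma> c2 s2 \<eta> \<eta>p s s' lam sg"
proof -
  obtain c2 s2 where c2: "c2 \<in> F" "\<sigma> (Num c2) = Num s2" "eps M / 2 + 2 * eps M ^ 2 \<le> \<bar>s2\<bar>" "\<bar>s2\<bar> \<le> 5 / 4 - 2 * eps M"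
    using c unfolding cond1_def by blast
  obtain \<eta> s s' \<eta>p lam where eta: "\<eta> \<in> F" "xsucc E M (Num \<eta>) = Num \<eta>p"
      "\<sigma> (Num \<eta>) = Num s" "\<sigma> (Num \<eta>p) = Num s'"
      "2 powr (of_int (e0 + 5)) \<le> \<bar>\<eta>\<bar>" "\<bar>\<eta>\<bar> \<le> 4 - 8 * eps M"
      "2 powr (of_int (e0 + 5)) \<le> \<bar>s\<bar>" "\<bar>s\<bar> \<le> 2 powr (of_int (e1 - 6)) * \<bar>\<eta>\<bar>"
      "2 powr (of_int (e0 + 5)) \<le> \<bar>s'\<bar>" "\<bar>s'\<bar> \<le> 2 powr (of_int (e1 - 6)) * \<bar>\<eta>\<bar>"
    and mono0: "\<forall>x \<in> F. \<forall>y \<in> F. x \<le> \<eta> \<and> \<eta>p \<le> y \<longrightarrow>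
          (xle (\<sigma> (Num x)) (Num s) \<and> s < s' \<and> xle (Num s') (\<sigma> (Num y))) \<or>
          (xle (Num s) (\<sigma> (Num x)) \<and> s > s' \<and> xle (\<sigma> (Num y)) (Num s'))"
    and lam: "0 \<le> lam" "lam \<le> 2 powr (of_int (e1 - 7)) * min \<bar>s\<bar> (2 ^ (M + 3))"
    and lip0: "\<forall>x \<in> F. \<forall>y \<in> F. x \<le> \<eta> \<and> \<eta>p \<le> y \<longrightarrow>
             (\<exists>t. \<sigma> (Num x) = Num t \<and> \<bar>t - s\<bar> \<le> lam * \<bar>x - \<eta>\<bar>) \<and>
             (\<exists>t. \<sigma> (Num y) = Num t \<and> \<bar>t - s'\<bar> \<le> lam * \<bar>y - \<eta>p\<bar>)"
    using c[unfolded cond1_def, THEN conjunct2] by (elim conjE bexE exE) (rule that)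
  note mono = mono0[rule_format] and lip = lip0[rule_format]
  note succ = xsucc_Num[OF eta(1,2)]
  define sg :: real where "sg = (if s < s' then 1 else -1)"
  have sg: "sg = 1 \<and> s < s' \<or> sg = -1 \<and> s' < s"
    using mono[OF eta(1) succ(1)] by (auto simp: sg_def)
  have eps: "0 < eps M" by (simp add: eps_p2)
  have "act E M \<sigma> c2 s2 \<eta> \<eta>p s s' lam sg"
  proof
    show "t \<in> F" if "x \<in> F" "\<sigma> (Num x) = Num t" for x t
      using \<sigma> that by (force simp: Fbar_def)
    show "c2 \<in> F" "\<sigma> (Num c2) = Num s2" by fact+
    have "- int M - 1 = (- int M - 2) + 1" by simp
    then have "p2 (- int M - 1) = 2 * p2 (- int M - 2)" by (simp only: p2_Suc)
    then have "p2 (- int M - 2) = eps M / 2" by (simp add: eps_p2)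
    then show "p2 (- int M - 2) \<le> \<bar>s2\<bar>" using c2(3) zero_le_power2[of "eps M"] by linarith
    show "\<bar>s2\<bar> < 2" using c2(4) eps by linarith
    show "\<eta> \<in> F" "\<eta>p \<in> F" "\<eta> < \<eta>p" "\<forall>z\<in>F. \<not> (\<eta> < z \<and> z < \<eta>p)" by fact+
    show "\<bar>\<eta>\<bar> < 4" using eta(6) eps by linarith
    show "p2 (e0 + 5) \<le> \<bar>\<eta>\<bar>" "p2 (e0 + 5) \<le> \<bar>s\<bar>" "\<bar>s\<bar> \<le> p2 (e1 - 6) * \<bar>\<eta>\<bar>" "\<bar>s'\<bar> \<le> p2 (e1 - 6) * \<bar>\<eta>\<bar>"
      unfolding p2_def by fact+
    show "\<sigma> (Num \<eta>) = Num s" "\<sigma> (Num \<eta>p) = Num s'" by fact+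
    show "sg = 1 \<or> sg = - 1" "sg * s < sg * s'" using sg by auto
    show "0 \<le> lam" by fact
    have l: "lam \<le> p2 (e1 - 7) * min \<bar>s\<bar> (2 ^ (M + 3))" unfolding p2_def by fact
    have "p2 (e1 - 7) * min \<bar>s\<bar> (2 ^ (M + 3)) \<le> p2 (e1 - 7) * \<bar>s\<bar>" by (intro mult_left_mono) auto
    then show "lam \<le> p2 (e1 - 7) * \<bar>s\<bar>" using l by linarith
    have "p2 (int M + 3) = 2 ^ (M + 3)" using p2_of_nat[of "M + 3"] by (simp add: add.commute)
    then have "p2 (e1 - 7) * min \<bar>s\<bar> (2 ^ (M + 3)) \<le> p2 (e1 - 7) * p2 (int M + 3)" by (intro mult_left_mono) auto
    then show "lam \<le> p2 (e1 - 7) * p2 (int M + 3)" using l by linarith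
    show "\<exists>t. \<sigma> (Num x) = Num t \<and> sg * t \<le> sg * s \<and> sg * s - lam * (\<eta> - x) \<le> sg * t"
      if x: "x \<in> F" "x \<le> \<eta>" for x
    proof -
      obtain t where t: "\<sigma> (Num x) = Num t" "\<bar>t - s\<bar> \<le> lam * \<bar>x - \<eta>\<bar>" using lip[OF x(1) succ(1)] x(2) by auto
      then have "\<bar>t - s\<bar> \<le> lam * (\<eta> - x)" using x(2) by simp
      moreover have "sg * t \<le> sg * s" using mono[OF x(1) succ(1)] x(2) t(1) sg by auto
      ultimately show ?thesis using t(1) sg by auto
    qed
    show "\<exists>t. \<sigma> (Num x) = Num t \<and> sg * s' \<le> sg * t \<and> sg * t \<le> sg * s' + lam * (x - \<eta>p)"
      if x: "x \<in> F" "\<eta>p \<le> x" for x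
    proof -
      obtain t where t: "\<sigma> (Num x) = Num t" "\<bar>t - s'\<bar> \<le> lam * \<bar>x - \<eta>p\<bar>" using lip[OF eta(1) x(1)] x(2) by auto
      then have "\<bar>t - s'\<bar> \<le> lam * (x - \<eta>p)" using x(2) by simp
      moreover have "sg * s' \<le> sg * t" using mono[OF eta(1) x(1)] x(2) t(1) sg by auto
      ultimately show ?thesis using t(1) sg by auto
    qed
  qed
  then show ?thesis using that by blast
qed

text \<open>The box is known only through its concretization. Replacing one coordinate of the centre
  by any element of \<open>gamma E M (B ! i)\<close> stays inside the product, so each side lies in
  the neighbourhood; in particular NaN is excluded, and with it \<open>Top\<close>.\<close>

lemma isat_box:
  assumes x0: "x0 \<in> Xdom E M d" and \<delta>: "0 < \<delta>" and len: "length B = d" and I: "\<forall>Bi \<in> set B. in_I E M Bi"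
    and g: "gamma_box E M B = map Num ` nbhd E M d \<delta> x0"
  shows "isat (boxp \<delta> d x0) B"
  unfolding isat_def
proof (rule list_all2_all_nthI)
  show "length (boxp \<delta> d x0) = length B" using len by (simp add: boxp_def)
  fix i assume "i < length (boxp \<delta> d x0)"
  then have i: "i < d" by (simp add: boxp_def)
  have lx: "length x0 = d" using x0 by (simp add: Xdom_def)
  have "x0 \<in> nbhd E M d \<delta> x0" using x0 \<delta> by (simp add: nbhd_def)
  then have m: "map Num x0 \<in> gamma_box E M B" unfolding g by (rule imageI)
  have v: "\<exists>r. v = Num r \<and> r \<in> F \<and> \<bar>r\<bar> \<le> 1 \<and> \<bar>x0 ! i - r\<bar> \<le> \<delta>" if v: "v \<in> gamma E M (B ! i)" for v
  proof -
    have "(map Num x0)[i := v] \<in> gamma_box E M B"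
      using m v len lx i by (auto simp: gamma_box_def nth_list_update)
    then obtain y where y: "y \<in> nbhd E M d \<delta> x0" "(map Num x0)[i := v] = map Num y" unfolding g by auto
    have ly: "length y = d" using y(1) by (simp add: nbhd_def Xdom_def)
    have "v = (map Num x0)[i := v] ! i" using i lx by simp
    also have "\<dots> = Num (y ! i)" unfolding y(2) using i ly by simp
    finally show ?thesis using y(1) i ly nth_mem[of i y] by (auto simp: nbhd_def Xdom_def)
  qed
  have nT: "B ! i \<noteq> Top"
  proof
    assume "B ! i = Top"
    then show False using v[of NaN] by (auto simp: Fbar_def)
  qed
  then obtain a b where ab: "B ! i = Ival a b" by (cases "B ! i") auto
  have "in_I E M (B ! i)" using I len i by simp
  then have f: "a \<in> Fbar E M" "b \<in> Fbar E M" "a \<noteq> NaN" "b \<noteq> NaN" "xle a b" unfolding ab by (auto simp: in_I_def)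
  then have "a \<in> gamma E M (B ! i)" "b \<in> gamma E M (B ! i)" unfolding ab by (auto simp: xle_def)
  then obtain ra rb where "a = Num ra" "ra \<in> F" "\<bar>ra\<bar> \<le> 1" "\<bar>x0 ! i - ra\<bar> \<le> \<delta>"
      "b = Num rb" "rb \<in> F" "\<bar>rb\<bar> \<le> 1" "\<bar>x0 ! i - rb\<bar> \<le> \<delta>"
    using v by metis
  then show "ivl (boxp \<delta> d x0 ! i) (B ! i)" using f(5) i unfolding ab ivl_def inside_def by (simp add: boxp_def)
qed

lemma gamma_box_singletons:
  assumes "isat (map (\<lambda>k y. y = v k) [0..<n]) Ys" "y \<in> gamma_box E M Ys"
  shows "y = map Num (map v [0..<n])"
proof (rule nth_equalityI)
  have l: "length Ys = n" using assms(1) by (auto simp: isat_def dest: list_all2_lengthD)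
  then show "length y = length (map Num (map v [0..<n]))" using assms(2) by (simp add: gamma_box_def)
  fix i assume "i < length y"
  then have i: "i < n" using assms(2) l by (simp add: gamma_box_def)
  have "ivl ((map (\<lambda>k y. y = v k) [0..<n]) ! i) (Ys ! i)"
    using list_all2_nthD[OF assms(1)[unfolded isat_def]] i by auto
  then have "Ys ! i = Ival (Num (v i)) (Num (v i))" using i by (auto simp: ivl_def inside_def)
  moreover have "y ! i \<in> gamma E M (Ys ! i)" using assms(2) l i by (simp add: gamma_box_def)
  ultimately show "y ! i = map Num (map v [0..<n]) ! i" using i by (auto dest: xle_antisym)
qed

lemma sat_singletons: "sat (map (\<lambda>k y. y = v k) [0..<n]) ys \<Longrightarrow> ys = map v [0..<n]"
  by (rule nth_equalityI) (auto simp: sat_def list_all2_conv_all_nth)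

end

lemma cls_unique_max:
  assumes "valid_tiebreak tb" "k < n" "a < b"
  shows "cls tb (map Num (map (\<lambda>j. if j = k then b else a) [0..<n])) = k"
proof -
  have "argmax_set (map Num (map (\<lambda>j. if j = k then b else a) [0..<n])) = {k}" (is "argmax_set ?y = _")
  proof (intro equalityI subsetI)
    fix i assume i: "i \<in> argmax_set ?y"
    then have "xle (?y ! k) (?y ! i)" "i < n" using assms(2) by (auto simp: argmax_set_def)
    then show "i \<in> {k}" using assms(2,3) by (auto split: if_splits)
  next
    fix i assume "i \<in> {k}"
    then show "i \<in> argmax_set ?y" using assms(2,3) by (auto simp: argmax_set_def)
  qed
  moreover have "tb {k} \<in> {k}" using assms(1) unfolding valid_tiebreak_def by blast
  ultimately show ?thesis by (simp add: cls_def)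
qed

lemma cls_less:
  assumes "valid_tiebreak tb" "y \<noteq> []" shows "cls tb (map Num y) < length y"
proof -
  have "Max (set y) \<in> set y" using assms(2) by (intro Max_in) auto
  then obtain i where "i < length y" "y ! i = Max (set y)" by (auto simp: in_set_conv_nth)
  then have "i \<in> argmax_set (map Num y)" by (simp add: argmax_set_def)
  then have "tb (argmax_set (map Num y)) \<in> argmax_set (map Num y)"
    using assms(1) unfolding valid_tiebreak_def by blast
  then show ?thesis by (simp add: cls_def argmax_set_def)
qed

text \<open>If no coordinate separated the two points, common floats in all coordinates would form a
  point of both neighbourhoods, and robustness would force the two classes to agree.\<close>

lemma robust_classes_separated:
  assumes r: "robust E M d tb f \<delta> D" and D: "D \<subseteq> Xdom E M d" and \<delta>: "0 < \<delta>"
    and xy: "x \<in> D" "y \<in> D" "cls tb (map Num (f x)) \<noteq> cls tb (map Num (f y))"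
  shows "\<exists>i<d. \<forall>r\<in>Fset E M. \<not> (\<bar>r\<bar> \<le> 1 \<and> \<bar>x ! i - r\<bar> \<le> \<delta> \<and> \<bar>y ! i - r\<bar> \<le> \<delta>)"
proof (rule ccontr)
  assume "\<not> ?thesis"
  then have "\<forall>i<d. \<exists>r. r \<in> Fset E M \<and> \<bar>r\<bar> \<le> 1 \<and> \<bar>x ! i - r\<bar> \<le> \<delta> \<and> \<bar>y ! i - r\<bar> \<le> \<delta>" by blast
  then obtain g where g: "\<And>i. i < d \<Longrightarrow> g i \<in> Fset E M \<and> \<bar>g i\<bar> \<le> 1 \<and> \<bar>x ! i - g i\<bar> \<le> \<delta> \<and> \<bar>y ! i - g i\<bar> \<le> \<delta>"
    by metis
  define z where "z = map g [0..<d]"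
  have "z \<in> nbhd E M d \<delta> x" "z \<in> nbhd E M d \<delta> y" using g by (auto simp: nbhd_def Xdom_def z_def)
  moreover have "x \<in> nbhd E M d \<delta> x" "y \<in> nbhd E M d \<delta> y" using xy D \<delta> by (auto simp: nbhd_def)
  ultimately show False using r xy unfolding robust_def by metis
qed

theorem theorem2:
  fixes E M d n :: nat and \<delta> :: real and D :: "real list set"
    and f :: "real list \<Rightarrow> real list" and \<sigma> :: "xfloat \<Rightarrow> xfloat"
    and tb :: "nat set \<Rightarrow> nat"
  assumes "E \<ge> 5" and "3 \<le> M" and "M \<le> 2 ^ (E - 1)"
    and "valid_tiebreak tb"
    and "\<delta> > 0"
    and "D \<subseteq> Xdom E M d"
    and "\<forall>x \<in> Xdom E M d. length (f x) = n \<and> set (f x) \<subseteq> Fset E M"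
    and "robust E M d tb f \<delta> D"
    and "\<forall>x \<in> Fbar E M. \<sigma> x \<in> Fbar E M"
    and "cond1 E M \<sigma>"
  shows "\<exists>Ls. wf_net E M d Ls n \<and> provably_robust E M d tb \<sigma> Ls \<delta> D \<and>
           (\<forall>x \<in> D. cls tb (net_eval E M \<sigma> Ls (map Num x)) = cls tb (map Num (f x)))"
proof (cases "n = 0")
  \<comment> \<open>With no outputs a single layer without neurons suffices: every output vector is
    empty.\<close>
  case True
  have "f x = []" if "x \<in> D" for x using assms(6,7) that True by fastforce
  then show ?thesis
    by (intro exI[of _ "[([], [])]"])
      (auto simp: True provably_robust_def aff_def aff_sharp_def gamma_box_def)
next
  case False
  interpret fp E M using assms(1-3) by unfold_locales
  obtain c2 s2 \<eta> \<eta>p s s' lam sg where "act E M \<sigma> c2 s2 \<eta> \<eta>p s s' lam sg"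
    using cond1_act[OF assms(9,10)] .
  then interpret act E M \<sigma> c2 s2 \<eta> \<eta>p s s' lam sg .
  define cl where "cl x = cls tb (map Num (f x))" for x
  have XD: "x \<in> Xdom E M d" if "x \<in> D" for x using assms(6) that by auto
  have "finite D"
  proof (rule finite_subset)
    show "D \<subseteq> {xs. set xs \<subseteq> Fset E M \<and> length xs = d}" using XD by (auto simp: Xdom_def)
    show "finite {xs. set xs \<subseteq> Fset E M \<and> length xs = d}" using F_finite by (rule finite_lists_length_eq)
  qed
  moreover have "x ! i \<in> Fset E M \<and> \<bar>x ! i\<bar> \<le> 1" if "x \<in> D" "i < d" for x i
    using XD[OF that(1)] that(2) by (auto simp: Xdom_def)
  moreover have cl: "cl x < n" if "x \<in> D" for x
    using cls_less[OF assms(4), of "f x"] XD[OF that] assms(7) False by (force simp: cl_def)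
  moreover have "\<exists>i<d. \<forall>r\<in>Fset E M. \<not> (\<bar>r\<bar> \<le> 1 \<and> \<bar>x ! i - r\<bar> \<le> \<delta> \<and> \<bar>y ! i - r\<bar> \<le> \<delta>)"
    if "x \<in> D" "y \<in> D" "cl x \<noteq> cl y" for x y
    using robust_classes_separated[OF assms(8,6,5)] that by (simp add: cl_def)
  ultimately obtain Ls where Ls: "wf_net E M d Ls n"
    "\<forall>p\<in>D. \<forall>Xs. isat (boxp \<delta> d p) Xs \<longrightarrow>
      isat (map (\<lambda>k y. y = (if k = cl p then S' else S)) [0..<n]) (net_sharp E M \<sigma> Ls Xs)"
    "\<forall>p\<in>D. \<forall>xs. sat (boxp \<delta> d p) xs \<longrightarrow> (\<exists>ys. net_eval E M \<sigma> Ls (map Num xs) = map Num ys \<and>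
      sat (map (\<lambda>k y. y = (if k = cl p then S' else S)) [0..<n]) ys)"
    using classifier_exists[of D d \<delta> cl n] assms(5) by blast
  have "provably_robust E M d tb \<sigma> Ls \<delta> D"
    unfolding provably_robust_def
  proof (intro ballI allI impI, elim conjE)
    fix x0 B y y' assume x0: "x0 \<in> D" and B: "length B = d" "\<forall>Bi\<in>set B. in_I E M Bi"
      "gamma_box E M B = map Num ` nbhd E M d \<delta> x0"
      and y: "y \<in> gamma_box E M (net_sharp E M \<sigma> Ls B)" "y' \<in> gamma_box E M (net_sharp E M \<sigma> Ls B)"
    have "isat (boxp \<delta> d x0) B" using isat_box[OF XD[OF x0] assms(5) B] .
    then have "isat (map (\<lambda>k y. y = (if k = cl x0 then S' else S)) [0..<n]) (net_sharp E M \<sigma> Ls B)"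
      using Ls(2) x0 by blast
    from gamma_box_singletons[OF this y(1)] gamma_box_singletons[OF this y(2)]
    show "cls tb y = cls tb y'" by simp
  qed
  moreover have "cls tb (net_eval E M \<sigma> Ls (map Num x)) = cls tb (map Num (f x))" if x: "x \<in> D" for x
  proof -
    have "sat (boxp \<delta> d x) x"
      using XD[OF x] assms(5) by (auto simp: sat_def boxp_def list_all2_conv_all_nth Xdom_def)
    then obtain ys where ys: "net_eval E M \<sigma> Ls (map Num x) = map Num ys"
      "sat (map (\<lambda>k y. y = (if k = cl x then S' else S)) [0..<n]) ys"
      using Ls(3) x by blast
    show ?thesis
      unfolding ys(1) sat_singletons[OF ys(2)] using cls_unique_max[OF assms(4) cl[OF x] S_less] by (simp add: cl_def)
  qed
  ultimately show ?thesis using Ls(1) by blast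
qed

end
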